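(* Let $\Omega$ be an open bounded domain of $\mathbb{R}^d$, $d\ge 2$, and let $b\in(L^\infty(\Omega))^d$. Consider $\sigma_h$ an approximation of $\sigma\in H^1(\Omega)$ such that $\inf_\Omega\sigma_h>0$. Then the bilinear form $a_{\rm ss}(\sigma_h;\cdot,\cdot)$ defined in the context is coercive in $H^1_0(\Omega)$, and the discrete problem: find $u_H\in U_H$ such that $$a_{\rm ss}(\sigma_h;u_H,v_H)=F(\sigma_h v_H)\qquad\text{for all }v_H\in U_H,$$ is well-posed, uniformly in $H$.
   Context: Here $\sigma$ is an invariant measure, i.e. a solution to $-\operatorname{div}(\nabla\sigma+b\sigma)=0$ in $\Omega$ (with suitable boundary conditions), and $\sigma_h$ is a Galerkin (finite element) approximation of it, computed with mesh size $h$. With $B_h=\nabla\sigma_h+\sigma_h b$, the bilinear form is $$a_{\rm ss}(\sigma_h;u,v)=\int_\Omega\sigma_h\nabla u\cdot\nabla v+B_h\cdot\frac{(\nabla u)v-(\nabla v)u}{2},$$ and $F(v)=\langle f,v\rangle_{H^{-1}(\Omega),H^1_0(\Omega)}$ with $f\in H^{-1}(\Omega)$. The finite element discretization space $U_H$ is a subspace of $H^1_0(\Omega)$, associated with a mesh of size $H$ (distinct from $h$). "Well-posed, uniformly in $H$" means that there is a unique solution $u_H$, which depends continuously on the data $f$, with a stability constant independent of $H$. *)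

theory Defs
  imports "HOL-Analysis.Analysis"
begin

section \<open>Lebesgue and Sobolev spaces\<close>

text \<open>
  Elements of \<open>L\<^sup>2\<close>, \<open>L\<^sup>\<infinity>\<close>, \<open>H\<^sup>1\<close>, ... are represented by functions on the whole space, of which
  only the values almost everywhere on \<open>\<Omega>\<close> are relevant.  No quotient is formed, so equality in
  these spaces is almost-everywhere equality on \<open>\<Omega>\<close>.
\<close>

definition L2 :: "'a::euclidean_space set \<Rightarrow> ('a \<Rightarrow> 'b::euclidean_space) set" where
  "L2 \<Omega> = {f. f \<in> borel_measurable (lebesgue_on \<Omega>) \<and>
              integrable (lebesgue_on \<Omega>) (\<lambda>x. (norm (f x))\<^sup>2)}"

definition Linf :: "'a::euclidean_space set \<Rightarrow> ('a \<Rightarrow> 'b::euclidean_space) set" where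
  "Linf \<Omega> = {f. f \<in> borel_measurable (lebesgue_on \<Omega>) \<and>
                (\<exists>M. AE x in lebesgue_on \<Omega>. norm (f x) \<le> M)}"

definition ess_inf :: "'a::euclidean_space set \<Rightarrow> ('a \<Rightarrow> real) \<Rightarrow> ereal" where
  "ess_inf \<Omega> u = Sup {c. AE x in lebesgue_on \<Omega>. c \<le> ereal (u x)}"

definition partial :: "'a::euclidean_space \<Rightarrow> ('a \<Rightarrow> real) \<Rightarrow> 'a \<Rightarrow> real" where
  "partial i f = (\<lambda>x. frechet_derivative f (at x) i)"

primrec Ck :: "nat \<Rightarrow> ('a::euclidean_space \<Rightarrow> real) \<Rightarrow> bool" where
  "Ck 0 f \<longleftrightarrow> continuous_on UNIV f"
| "Ck (Suc k) f \<longleftrightarrow> (\<forall>x. f differentiable at x) \<and> (\<forall>i\<in>Basis. Ck k (partial i f))"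

definition test_functions :: "'a::euclidean_space set \<Rightarrow> ('a \<Rightarrow> real) set" where
  "test_functions \<Omega> =
     {\<phi>. (\<forall>k. Ck k \<phi>) \<and> (\<exists>K. compact K \<and> K \<subseteq> \<Omega> \<and> (\<forall>x. x \<notin> K \<longrightarrow> \<phi> x = 0))}"

definition has_weak_grad ::
    "'a::euclidean_space set \<Rightarrow> ('a \<Rightarrow> real) \<Rightarrow> ('a \<Rightarrow> 'a) \<Rightarrow> bool" where
  "has_weak_grad \<Omega> u g \<longleftrightarrow>
     (\<forall>\<phi>\<in>test_functions \<Omega>. \<forall>i\<in>Basis.
        (LINT x|lebesgue_on \<Omega>. u x * partial i \<phi> x) = - (LINT x|lebesgue_on \<Omega>. (g x \<bullet> i) * \<phi> x))"

definition H1 :: "'a::euclidean_space set \<Rightarrow> ('a \<Rightarrow> real) set" where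
  "H1 \<Omega> = {u. u \<in> L2 \<Omega> \<and> (\<exists>g. g \<in> L2 \<Omega> \<and> has_weak_grad \<Omega> u g)}"

text \<open>The weak gradient of a function in \<open>H\<^sup>1\<close> is unique up to null sets; a representative is chosen.\<close>

definition weak_grad :: "'a::euclidean_space set \<Rightarrow> ('a \<Rightarrow> real) \<Rightarrow> 'a \<Rightarrow> 'a" where
  "weak_grad \<Omega> u = (SOME g. g \<in> L2 \<Omega> \<and> has_weak_grad \<Omega> u g)"

definition H1_norm :: "'a::euclidean_space set \<Rightarrow> ('a \<Rightarrow> real) \<Rightarrow> real" where
  "H1_norm \<Omega> u =
     sqrt ((LINT x|lebesgue_on \<Omega>. (u x)\<^sup>2) + (LINT x|lebesgue_on \<Omega>. (norm (weak_grad \<Omega> u x))\<^sup>2))"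

definition H10 :: "'a::euclidean_space set \<Rightarrow> ('a \<Rightarrow> real) set" where
  "H10 \<Omega> = {u. u \<in> H1 \<Omega> \<and>
               (\<forall>\<epsilon>>0. \<exists>\<phi>\<in>test_functions \<Omega>. H1_norm \<Omega> (\<lambda>x. u x - \<phi> x) < \<epsilon>)}"

text \<open>
  The dual of \<open>H\<^sup>1\<^sub>0\<close>.  Boundedness together with linearity forces a functional to
  agree on functions that are equal almost everywhere.
\<close>

definition Hneg1 :: "'a::euclidean_space set \<Rightarrow> (('a \<Rightarrow> real) \<Rightarrow> real) set" where
  "Hneg1 \<Omega> = {f.
     (\<forall>u\<in>H10 \<Omega>. \<forall>v\<in>H10 \<Omega>. f (\<lambda>x. u x + v x) = f u + f v) \<and>
     (\<forall>u\<in>H10 \<Omega>. \<forall>c. f (\<lambda>x. c * u x) = c * f u) \<and>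
     (\<exists>M. \<forall>u\<in>H10 \<Omega>. \<bar>f u\<bar> \<le> M * H1_norm \<Omega> u)}"

definition Hneg1_norm :: "'a::euclidean_space set \<Rightarrow> (('a \<Rightarrow> real) \<Rightarrow> real) \<Rightarrow> real" where
  "Hneg1_norm \<Omega> f = (SUP v\<in>{v \<in> H10 \<Omega>. H1_norm \<Omega> v \<le> 1}. \<bar>f v\<bar>)"

section \<open>Finite element spaces\<close>

text \<open>
  The cells of a mesh may be curved and may extend beyond \<open>\<Omega>\<close>, so that no regularity of the
  boundary of \<open>\<Omega>\<close> is needed.  Simplicial and other polytopal meshes are special cases.
\<close>

definition mesh :: "'a::euclidean_space set \<Rightarrow> real \<Rightarrow> 'a set set \<Rightarrow> bool" where
  "mesh \<Omega> h \<T> \<longleftrightarrow>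
     finite \<T> \<and> \<T> \<noteq> {} \<and> \<Omega> \<subseteq> \<Union>\<T> \<and>
     (\<forall>K\<in>\<T>. compact K \<and> interior K \<inter> \<Omega> \<noteq> {} \<and> negligible (frontier K)) \<and>
     pairwise (\<lambda>K L. interior K \<inter> interior L = {}) \<T> \<and>
     Max (diameter ` \<T>) = h"

definition finite_dim_space :: "'a::euclidean_space set \<Rightarrow> ('a \<Rightarrow> real) set \<Rightarrow> bool" where
  "finite_dim_space \<Omega> V \<longleftrightarrow>
     (\<lambda>x. 0) \<in> V \<and>
     (\<forall>u\<in>V. \<forall>v\<in>V. (\<lambda>x. u x + v x) \<in> V) \<and>
     (\<forall>u\<in>V. \<forall>c. (\<lambda>x. c * u x) \<in> V) \<and>
     (\<exists>B. finite B \<and> B \<subseteq> V \<and>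
        (\<forall>v\<in>V. \<exists>c. AE x in lebesgue_on \<Omega>. v x = (\<Sum>w\<in>B. c w * w x)))"

text \<open>
  Conforming finite element spaces: finite-dimensional subspaces of \<open>H\<^sup>1\<close> whose elements are, on
  each cell, of class \<open>C\<^sup>1\<close> up to the boundary of the cell.  This includes the usual
  piecewise polynomial spaces of any degree.
\<close>

definition fe_space :: "'a::euclidean_space set \<Rightarrow> real \<Rightarrow> ('a \<Rightarrow> real) set \<Rightarrow> bool" where
  "fe_space \<Omega> h V \<longleftrightarrow>
     finite_dim_space \<Omega> V \<and> V \<subseteq> H1 \<Omega> \<and>
     (\<exists>\<T>. mesh \<Omega> h \<T> \<and>
        (\<forall>v\<in>V. \<forall>K\<in>\<T>. \<exists>p. Ck 1 p \<and> (AE x in lebesgue_on (interior K \<inter> \<Omega>). v x = p x)))"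

section \<open>Invariant measure, its approximation, and the discrete problem\<close>

definition flux :: "'a::euclidean_space set \<Rightarrow> ('a \<Rightarrow> 'a) \<Rightarrow> ('a \<Rightarrow> real) \<Rightarrow> 'a \<Rightarrow> 'a" where
  "flux \<Omega> b s = (\<lambda>x. weak_grad \<Omega> s x + s x *\<^sub>R b x)"

text \<open>
  The boundary conditions on the invariant measure are left open: only test functions vanishing
  on the boundary are used, so the solutions for all usual choices (no-flux, Robin, Dirichlet)
  are covered, both for the continuous and for the Galerkin problem.
\<close>

definition invariant_measure ::
    "'a::euclidean_space set \<Rightarrow> ('a \<Rightarrow> 'a) \<Rightarrow> ('a \<Rightarrow> real) \<Rightarrow> bool" where
  "invariant_measure \<Omega> b \<sigma> \<longleftrightarrow>
     \<sigma> \<in> H1 \<Omega> \<and>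
     (\<forall>v\<in>H10 \<Omega>. (LINT x|lebesgue_on \<Omega>. flux \<Omega> b \<sigma> x \<bullet> weak_grad \<Omega> v x) = 0)"

definition galerkin_approximation ::
    "'a::euclidean_space set \<Rightarrow> ('a \<Rightarrow> 'a) \<Rightarrow> ('a \<Rightarrow> real) set \<Rightarrow> ('a \<Rightarrow> real) \<Rightarrow> bool" where
  "galerkin_approximation \<Omega> b V \<sigma>h \<longleftrightarrow>
     \<sigma>h \<in> V \<and>
     (\<forall>v\<in>V \<inter> H10 \<Omega>. (LINT x|lebesgue_on \<Omega>. flux \<Omega> b \<sigma>h x \<bullet> weak_grad \<Omega> v x) = 0)"

definition a_ss ::
    "'a::euclidean_space set \<Rightarrow> ('a \<Rightarrow> 'a) \<Rightarrow> ('a \<Rightarrow> real) \<Rightarrow> ('a \<Rightarrow> real) \<Rightarrow> ('a \<Rightarrow> real) \<Rightarrow> real" where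
  "a_ss \<Omega> b s u v =
     (LINT x|lebesgue_on \<Omega>.
        s x * (weak_grad \<Omega> u x \<bullet> weak_grad \<Omega> v x) +
        flux \<Omega> b s x \<bullet> ((v x *\<^sub>R weak_grad \<Omega> u x - u x *\<^sub>R weak_grad \<Omega> v x) /\<^sub>R 2))"

definition coercive_on ::
    "('a \<Rightarrow> real) set \<Rightarrow> (('a \<Rightarrow> real) \<Rightarrow> real) \<Rightarrow> (('a \<Rightarrow> real) \<Rightarrow> ('a \<Rightarrow> real) \<Rightarrow> real) \<Rightarrow> bool" where
  "coercive_on V nrm a \<longleftrightarrow> (\<exists>\<alpha>>0. \<forall>u\<in>V. a u u \<ge> \<alpha> * (nrm u)\<^sup>2)"

definition discrete_solution ::
    "'a::euclidean_space set \<Rightarrow> ('a \<Rightarrow> 'a) \<Rightarrow> ('a \<Rightarrow> real) \<Rightarrow> ('a \<Rightarrow> real) set \<Rightarrow>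
     (('a \<Rightarrow> real) \<Rightarrow> real) \<Rightarrow> ('a \<Rightarrow> real) \<Rightarrow> bool" where
  "discrete_solution \<Omega> b s U f u \<longleftrightarrow>
     u \<in> U \<and> (\<forall>v\<in>U. a_ss \<Omega> b s u v = f (\<lambda>x. s x * v x))"

text \<open>Well-posedness with a given stability constant \<open>C\<close>.  Since the problem is linear, the
  bound also gives Lipschitz dependence of the solution on \<open>f\<close>.\<close>

definition well_posed ::
    "'a::euclidean_space set \<Rightarrow> ('a \<Rightarrow> 'a) \<Rightarrow> ('a \<Rightarrow> real) \<Rightarrow> ('a \<Rightarrow> real) set \<Rightarrow> real \<Rightarrow> bool" where
  "well_posed \<Omega> b s U C \<longleftrightarrow>
     (\<forall>f\<in>Hneg1 \<Omega>. \<exists>u.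
        discrete_solution \<Omega> b s U f u \<and>
        (\<forall>w. discrete_solution \<Omega> b s U f w \<longrightarrow> (AE x in lebesgue_on \<Omega>. w x = u x)) \<and>
        H1_norm \<Omega> u \<le> C * Hneg1_norm \<Omega> f)"

end

theory Submission
  imports Defs "HOL-Real_Asymp.Real_Asymp"
begin

text \<open>
  On the diagonal the skew-symmetric part of \<open>a\<^sub>s\<^sub>s\<close> cancels pointwise, so coercivity is the lower bound
  on \<open>\<sigma>\<^sub>h\<close> combined with the Poincare inequality on \<open>H\<^sup>1\<^sub>0\<close>.  A finite element function \<open>\<sigma>\<^sub>h\<close> is bounded with
  bounded weak gradient; hence \<open>a\<^sub>s\<^sub>s\<close> is defined on \<open>H\<^sup>1 \<times> H\<^sup>1\<close>, and multiplication by \<open>\<sigma>\<^sub>h\<close> is a bounded operator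
  on \<open>H\<^sup>1\<^sub>0\<close>, so that \<open>v \<mapsto> F(\<sigma>\<^sub>h v)\<close> is again in the dual.  The Lax--Milgram argument then gives a stability
  constant that depends on \<open>\<sigma>\<^sub>h\<close> and \<open>\<Omega>\<close> only.  That \<open>\<sigma>\<^sub>h v\<close> stays in \<open>H\<^sup>1\<^sub>0\<close> is the analytic core: for a test
  function \<open>v\<close> the product has compact support, and mollifying it yields approximating test functions.
\<close>

section \<open>Functions of class \<open>C\<^sup>k\<close>\<close>

text \<open>Two features of the setting shape the argument. Functions that agree almost everywhere
  are not identified, and \<open>weak_grad\<close> is an arbitrary choice among almost equal
  candidates. Hence linearity of the gradient holds only almost everywhere, and on functions the
  form is merely semidefinite. The finite-dimensional solver is therefore stated with degeneracy
  conditions in place of definiteness, and a spanning set reaches the whole discrete space only up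
  to null functions. Second, \<open>H10\<close> is a closure of test functions over a domain without
  boundary regularity, so that \<open>\<sigma>h * v\<close> lies in it has to be shown by explicit
  smooth approximations. This uses bounds on both \<open>\<sigma>h\<close> and its weak gradient,
  and here the finite element structure enters: on each cell the weak gradient is the classical
  gradient of a C^1 function on a compact set. If B bounds both and \<alpha> is the coercivity
  constant, the stability constant is 2 B / \<alpha>, where 2 B bounds multiplication by
  \<open>\<sigma>h\<close> on \<open>H10\<close>.\<close>

abbreviation smooth :: "('a::euclidean_space \<Rightarrow> real) \<Rightarrow> bool" where
  "smooth f \<equiv> \<forall>k. Ck k f"

lemma partial_eq: "(f has_derivative D) (at x) \<Longrightarrow> partial i f x = D i"
  unfolding partial_def by (metis frechet_derivative_at)

lemma Ck_imp_continuous: "Ck k f \<Longrightarrow> continuous_on UNIV f"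
  by (cases k)
    (auto intro!: continuous_at_imp_continuous_on differentiable_imp_continuous_within)

lemma Ck_SucD: "Ck (Suc k) f \<Longrightarrow> Ck k f"
proof (induction k arbitrary: f)
  case 0
  then show ?case using Ck_imp_continuous[OF 0] by simp
qed auto

lemma Ck_1_differentiable: "Ck 1 f \<Longrightarrow> f differentiable at x"
  by simp

lemma Ck_1_partial_continuous: "Ck 1 f \<Longrightarrow> i \<in> Basis \<Longrightarrow> continuous_on UNIV (partial i f)"
  by simp

lemma smooth_1: "smooth f \<Longrightarrow> Ck 1 f"
  by blast

lemma smooth_partial: "smooth f \<Longrightarrow> i \<in> Basis \<Longrightarrow> smooth (partial i f)"
  by (metis Ck.simps(2))

text \<open>The vector that represents the Frechet derivative wherever the function is
  differentiable; elsewhere its value is unspecified.\<close>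

definition grad :: "('a::euclidean_space \<Rightarrow> real) \<Rightarrow> 'a \<Rightarrow> 'a" where
  "grad f x = (\<Sum>i\<in>Basis. partial i f x *\<^sub>R i)"

lemma grad_inner_Basis [simp]: "i \<in> Basis \<Longrightarrow> grad f x \<bullet> i = partial i f x"
  by (simp add: grad_def)

lemma has_derivative_grad:
  assumes "f differentiable at x"
  shows "(f has_derivative (\<lambda>h. grad f x \<bullet> h)) (at x)"
proof -
  have d: "(f has_derivative frechet_derivative f (at x)) (at x)"
    using assms frechet_derivative_works by blast
  then interpret bounded_linear "frechet_derivative f (at x)"
    by (rule has_derivative_bounded_linear)
  have "frechet_derivative f (at x) h = grad f x \<bullet> h" for h
  proof -
    have "frechet_derivative f (at x) h
        = frechet_derivative f (at x) (\<Sum>i\<in>Basis. (h \<bullet> i) *\<^sub>R i)"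
      by (simp add: euclidean_representation)
    also have "\<dots> = (\<Sum>i\<in>Basis. (h \<bullet> i) * partial i f x)"
      by (simp add: sum scaleR partial_def)
    also have "\<dots> = grad f x \<bullet> h"
      unfolding grad_def inner_sum_left by (intro sum.cong) (auto simp: inner_commute)
    finally show ?thesis .
  qed
  then show ?thesis using d by (metis (no_types, lifting) ext)
qed

lemma partial_inner: "f differentiable at x \<Longrightarrow> partial v f x = grad f x \<bullet> v"
  using partial_eq[OF has_derivative_grad] .

section \<open>Sum, product and reflection rules, and closure properties of C^k\<close>

lemma partial_add:
  assumes "f differentiable at x" "g differentiable at x"
  shows "partial i (\<lambda>x. f x + g x) x = partial i f x + partial i g x"
  by (subst partial_eq[OF has_derivative_add[OF assms[THEN has_derivative_grad]]])
    (simp add: partial_inner assms)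

lemma partial_mult:
  assumes "f differentiable at x" "g differentiable at x"
  shows "partial i (\<lambda>x. f x * g x) x = f x * partial i g x + partial i f x * g x"
  by (subst partial_eq[OF has_derivative_mult[OF assms[THEN has_derivative_grad]]])
    (simp add: partial_inner assms)

text \<open>Needed for kernels \<open>\<lambda>y. \<eta> (x - y)\<close>, which serve as test
  functions when a weak gradient is moved through a mollification.\<close>

lemma partial_reflect:
  fixes f :: "'a::euclidean_space \<Rightarrow> real"
  assumes "f differentiable at (a - x)"
  shows "((\<lambda>x. f (a - x)) has_derivative (\<lambda>h. - (grad f (a - x) \<bullet> h))) (at x)"
    and "partial i (\<lambda>x. f (a - x)) x = - partial i f (a - x)"
proof -
  show D: "((\<lambda>x. f (a - x)) has_derivative (\<lambda>h. - (grad f (a - x) \<bullet> h))) (at x)"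
  proof -
    have "((\<lambda>x. a - x) has_derivative uminus) (at x)"
      by (auto intro!: derivative_eq_intros)
    from has_derivative_compose[OF this has_derivative_grad[OF assms]] show ?thesis
      by simp
  qed
  show "partial i (\<lambda>x. f (a - x)) x = - partial i f (a - x)"
    using partial_eq[OF D] by (simp add: partial_inner assms)
qed

lemma Ck_const: "Ck k (\<lambda>x. c)"
proof (induction k arbitrary: c)
  case (Suc k)
  have "partial i (\<lambda>x::'a. c) = (\<lambda>x. 0)" for i
    by (rule ext) (rule partial_eq[OF has_derivative_const])
  then show ?case using Suc by simp
qed simp

lemma Ck_add: "Ck k f \<Longrightarrow> Ck k g \<Longrightarrow> Ck k (\<lambda>x. f x + g x)"
proof (induction k arbitrary: f g)
  case 0
  then show ?case by (simp add: continuous_on_add)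
next
  case (Suc k)
  have "partial i (\<lambda>x. f x + g x) = (\<lambda>x. partial i f x + partial i g x)" for i
    using Suc.prems by (auto intro!: partial_add)
  then show ?case using Suc by simp
qed

lemma Ck_mult: "Ck k f \<Longrightarrow> Ck k g \<Longrightarrow> Ck k (\<lambda>x. f x * g x)"
proof (induction k arbitrary: f g)
  case 0
  then show ?case by (simp add: continuous_on_mult)
next
  case (Suc k)
  have "partial i (\<lambda>x. f x * g x) = (\<lambda>x. f x * partial i g x + partial i f x * g x)" for i
    using Suc.prems by (auto intro!: partial_mult)
  \<comment> \<open>The product rule still contains the undifferentiated factors, which have to be
    downgraded from order \<open>Suc k\<close> to \<open>k\<close> before the induction hypothesis
    applies.\<close>
  then show ?case using Suc Ck_SucD[of k f] Ck_SucD[of k g] by (simp add: Ck_add del: Ck.simps(1))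
qed

lemma Ck_cmult: "Ck k f \<Longrightarrow> Ck k (\<lambda>x. c * f x)"
  by (intro Ck_mult Ck_const)

lemma Ck_diff: "Ck k f \<Longrightarrow> Ck k g \<Longrightarrow> Ck k (\<lambda>x. f x - g x)"
  using Ck_add[of k f "\<lambda>x. -1 * g x"] Ck_cmult[of k g "-1"] by simp

lemma Ck_prod: "finite A \<Longrightarrow> (\<And>a. a \<in> A \<Longrightarrow> Ck k (f a)) \<Longrightarrow> Ck k (\<lambda>x. \<Prod>a\<in>A. f a x)"
  by (induction A rule: finite_induct) (auto intro: Ck_const Ck_mult)

lemma Ck_reflect: "Ck k f \<Longrightarrow> Ck k (\<lambda>x. f (a - x))"
proof (induction k arbitrary: f)
  case 0
  have "continuous_on UNIV (\<lambda>x. f (a - x))"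
    by (rule continuous_on_compose2[where t=UNIV]) (use 0 in \<open>auto intro!: continuous_intros\<close>)
  then show ?case by simp
next
  case (Suc k)
  then have d: "f differentiable at x" for x by simp
  have "partial i (\<lambda>x. f (a - x)) = (\<lambda>x. -1 * partial i f (a - x))" for i
    using partial_reflect(2)[OF d] by auto
  moreover have "Ck k (\<lambda>x. -1 * partial i f (a - x))" if "i \<in> Basis" for i
    by (rule Ck_cmult) (use Suc that in simp)
  moreover have "(\<lambda>x. f (a - x)) differentiable at x" for x
    using partial_reflect(1)[OF d] unfolding differentiable_def by blast
  ultimately show ?case by (auto simp: simp del: Ck.simps(1))
qed

lemma Ck_inner: "Ck k (\<lambda>x. x \<bullet> e)"
proof (cases k)
  case (Suc j)
  have "((\<lambda>x::'a. x \<bullet> e) has_derivative (\<lambda>h. h \<bullet> e)) (at x)" for x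
    by (auto intro!: derivative_eq_intros)
  then have "partial i (\<lambda>x. x \<bullet> e) = (\<lambda>x. i \<bullet> e)" "(\<lambda>x. x \<bullet> e) differentiable at x" for i x :: 'a
    by (auto simp: differentiable_def intro!: partial_eq)
  then show ?thesis using Suc by (simp add: Ck_const)
qed (auto intro: continuous_intros)

section \<open>Smooth bump functions\<close>

text \<open>The derivative of exp(-1/t) / t^n is a combination of two members of the same family, so
  admitting all powers n makes the smoothness proof an induction without explicit higher
  derivatives.\<close>

definition flat_exp :: "nat \<Rightarrow> real \<Rightarrow> real" where
  "flat_exp n t = (if t > 0 then exp (- 1 / t) / t ^ n else 0)"

lemma flat_exp_deriv:
  "(flat_exp n has_real_derivative flat_exp (n + 2) t - n * flat_exp (n + 1) t) (at t)"
proof -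
  consider "t > 0" | "t < 0" | "t = 0" by linarith
  then show ?thesis
  proof cases
    case 1
    have "((\<lambda>t. exp (- 1 / t) / t ^ n) has_real_derivative
        flat_exp (n + 2) t - n * flat_exp (n + 1) t) (at t)"
      using 1 by (auto intro!: derivative_eq_intros simp: flat_exp_def divide_simps power2_eq_square)
        (cases n; auto simp: algebra_simps)
    then show ?thesis
      by (rule has_field_derivative_transform_within_open[of _ _ _ "{0<..}"])
        (use 1 in \<open>auto simp: flat_exp_def\<close>)
  next
    case 2
    have "((\<lambda>t. 0) has_real_derivative flat_exp (n + 2) t - n * flat_exp (n + 1) t) (at t)"
      using 2 by (auto intro!: derivative_eq_intros simp: flat_exp_def)
    then show ?thesis
      by (rule has_field_derivative_transform_within_open[of _ _ _ "{..<0}"])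
        (use 2 in \<open>auto simp: flat_exp_def\<close>)
  next
    case 3
    have "((\<lambda>h::real. exp (- 1 / h) / h ^ (n + 1)) \<longlongrightarrow> 0) (at_right 0)"
      by real_asymp
    then have r: "((\<lambda>h. flat_exp n h / h) \<longlongrightarrow> 0) (at_right 0)"
      by (rule Lim_transform_eventually)
        (auto simp: flat_exp_def eventually_at_right_less eventually_at_filter intro!: always_eventually)
    have "((\<lambda>h. flat_exp n h / h) \<longlongrightarrow> 0) (at_left 0)"
      by (rule Lim_transform_eventually[OF tendsto_const])
        (auto simp: flat_exp_def eventually_at_filter intro!: always_eventually)
    with r have "((\<lambda>h. flat_exp n h / h) \<longlongrightarrow> 0) (at 0)"
      using filterlim_split_at by blast
    then show ?thesis
      using 3 by (simp add: DERIV_def flat_exp_def)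
  qed
qed

lemma flat_exp_nonneg: "flat_exp n t \<ge> 0"
  by (simp add: flat_exp_def)

text \<open>The induction runs over all n at once because a derivative raises n by one and by two.
  The affine argument is the form in which the one-dimensional profile enters the bump
  functions.\<close>

lemma Ck_flat_exp_affine: "Ck k (\<lambda>x. flat_exp n (x \<bullet> e + c))"
proof (induction k arbitrary: n)
  case 0
  have "isCont (flat_exp n) t" for t
    using flat_exp_deriv DERIV_isCont by blast
  then have "continuous_on UNIV (flat_exp n)"
    by (simp add: continuous_at_imp_continuous_on)
  then have "continuous_on UNIV (\<lambda>x::'a. flat_exp n (x \<bullet> e + c))"
    by (rule continuous_on_compose2) (auto intro!: continuous_intros)
  then show ?case by simp
next
  case (Suc k)
  have D: "((\<lambda>x::'a. flat_exp n (x \<bullet> e + c)) has_derivative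
      (\<lambda>h. (h \<bullet> e) * (flat_exp (n + 2) (x \<bullet> e + c) - n * flat_exp (n + 1) (x \<bullet> e + c)))) (at x)" for x
    by (rule has_derivative_eq_rhs, rule has_derivative_compose[OF _ flat_exp_deriv[unfolded has_field_derivative_def]])
      (auto intro!: derivative_eq_intros simp: mult.commute)
  then have "partial i (\<lambda>x. flat_exp n (x \<bullet> e + c)) =
      (\<lambda>x. (i \<bullet> e) * (flat_exp (n + 2) (x \<bullet> e + c) - n * flat_exp (n + 1) (x \<bullet> e + c)))" for i
    by (intro ext partial_eq)
  moreover have "(\<lambda>x. flat_exp n (x \<bullet> e + c)) differentiable at x" for x
    using D differentiable_def by blast
  ultimately show ?case using Suc
    by (auto intro!: Ck_cmult Ck_diff simp del: Ck.simps(1))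
qed

section \<open>Integration by parts for compactly supported functions\<close>

text \<open>Sobolev notions integrate over the domain, whereas translation and convolution live on
  the whole space; this passes between the two for functions vanishing off the set.\<close>

lemma lebesgue_on_eq_lebesgue:
  fixes f :: "'a::euclidean_space \<Rightarrow> 'b::euclidean_space"
  assumes "S \<in> sets lebesgue" "\<And>x. x \<notin> S \<Longrightarrow> f x = 0"
  shows "integral\<^sup>L (lebesgue_on S) f = integral\<^sup>L lebesgue f"
    and "integrable (lebesgue_on S) f \<longleftrightarrow> integrable lebesgue f"
proof -
  have "(\<lambda>x. indicator S x *\<^sub>R f x) = f"
    using assms(2) by (auto simp: indicator_def)
  then show "integral\<^sup>L (lebesgue_on S) f = integral\<^sup>L lebesgue f"
    "integrable (lebesgue_on S) f \<longleftrightarrow> integrable lebesgue f"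
    using assms(1) by (auto simp: integral_restrict_space integrable_restrict_space)
qed

lemma integral_lebesgue_on_indicator:
  fixes f :: "'a::euclidean_space \<Rightarrow> 'b::euclidean_space"
  assumes "S \<in> sets lebesgue"
  shows "integral\<^sup>L (lebesgue_on S) f = (LINT x|lebesgue. indicator S x *\<^sub>R f x)"
    and "integrable (lebesgue_on S) f \<longleftrightarrow> integrable lebesgue (\<lambda>x. indicator S x *\<^sub>R f x)"
  using assms by (auto simp: integral_restrict_space integrable_restrict_space)

lemma borel_measurable_lebesgue_on_continuous:
  fixes f :: "'a::euclidean_space \<Rightarrow> 'b::euclidean_space"
  assumes "continuous_on UNIV f"
  shows "f \<in> borel_measurable (lebesgue_on S)"
proof -
  have "f \<in> borel_measurable lebesgue"
    using borel_measurable_continuous_onI[OF assms] by (simp add: measurable_completion)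
  then show ?thesis by (rule measurable_restrict_space1)
qed

lemma compact_support_bounded:
  fixes f :: "'a::euclidean_space \<Rightarrow> real"
  assumes "continuous_on UNIV f" "compact K" "\<And>x. x \<notin> K \<Longrightarrow> f x = 0"
  obtains M where "M > 0" "\<And>x. \<bar>f x\<bar> \<le> M"
proof -
  have "bounded (f ` K)"
    using assms(1,2) by (meson compact_continuous_image compact_imp_bounded continuous_on_subset subset_UNIV)
  then obtain M where M: "M > 0" "\<And>x. x \<in> K \<Longrightarrow> \<bar>f x\<bar> \<le> M"
    by (auto simp: bounded_pos)
  then have "\<bar>f x\<bar> \<le> M" for x
    using assms(3)[of x] by (cases "x \<in> K") auto
  with M(1) that show ?thesis by blast
qed

lemma compact_support_integrable:
  fixes f :: "'a::euclidean_space \<Rightarrow> real"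
  assumes "continuous_on UNIV f" "compact K" "\<And>x. x \<notin> K \<Longrightarrow> f x = 0"
  shows "integrable lborel f" "integrable lebesgue f"
proof -
  have "(\<lambda>x. indicator K x *\<^sub>R f x) = f"
    using assms(3) by (auto simp: indicator_def fun_eq_iff)
  then show "integrable lborel f"
    using borel_integrable_compact[OF assms(2) continuous_on_subset[OF assms(1)]] by simp
  then show "integrable lebesgue f"
    by (simp add: integrable_completion)
qed

text \<open>The complement of a closed set is open, so near x the function is identically zero; no
  differentiability of f elsewhere is involved.\<close>

lemma partial_zero_outside:
  fixes f :: "'a::euclidean_space \<Rightarrow> real"
  assumes "closed K" "\<And>x. x \<notin> K \<Longrightarrow> f x = 0" "x \<notin> K"
  shows "partial i f x = 0"
proof (rule partial_eq)
  show "(f has_derivative (\<lambda>_. 0)) (at x)"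
    by (rule has_derivative_transform_within_open[of "\<lambda>_. 0" _ _ _ "- K"])
      (use assms in auto)
qed

lemma test_functionsI:
  "smooth \<phi> \<Longrightarrow> compact K \<Longrightarrow> K \<subseteq> \<Omega> \<Longrightarrow> (\<And>x. x \<notin> K \<Longrightarrow> \<phi> x = 0) \<Longrightarrow> \<phi> \<in> test_functions \<Omega>"
  unfolding test_functions_def by blast

lemma test_functionsD:
  assumes "\<phi> \<in> test_functions \<Omega>"
  obtains K where "compact K" "K \<subseteq> \<Omega>" "\<And>x. x \<notin> K \<Longrightarrow> \<phi> x = 0" "smooth \<phi>"
  using assms by (auto simp: test_functions_def)

section \<open>Invariance of Lebesgue measure under translation and reflection\<close>

lemma lborel_translation:
  fixes f :: "'a::euclidean_space \<Rightarrow> real"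
  assumes "f \<in> borel_measurable borel"
  shows "(LINT x|lborel. f (x + c)) = integral\<^sup>L lborel f"
    and "integrable lborel (\<lambda>x. f (x + c)) \<longleftrightarrow> integrable lborel f"
proof -
  have "integral\<^sup>L lborel f = integral\<^sup>L (distr lborel borel ((+) c)) f"
    by (simp add: lborel_distr_plus)
  also have "\<dots> = (LINT x|lborel. f (c + x))"
    by (rule integral_distr) (use assms in auto)
  finally show "(LINT x|lborel. f (x + c)) = integral\<^sup>L lborel f"
    by (simp add: add.commute)
  have "integrable lborel f \<longleftrightarrow> integrable (distr lborel borel ((+) c)) f"
    by (simp add: lborel_distr_plus)
  also have "\<dots> \<longleftrightarrow> integrable lborel (\<lambda>x. f (c + x))"
    by (rule integrable_distr_eq) (use assms in auto)
  finally show "integrable lborel (\<lambda>x. f (x + c)) \<longleftrightarrow> integrable lborel f"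
    by (simp add: add.commute)
qed

lemma lborel_reflection:
  fixes f :: "'a::euclidean_space \<Rightarrow> real"
  assumes "f \<in> borel_measurable borel"
  shows "(LINT x|lborel. f (c - x)) = integral\<^sup>L lborel f"
    and "integrable lborel (\<lambda>x. f (c - x)) \<longleftrightarrow> integrable lborel f"
proof -
  have eq: "distr lborel borel (\<lambda>x. c - x) = (lborel :: 'a measure)"
    using lborel_affine[of "-1" c] by (simp add: density_1)
  have "integral\<^sup>L lborel f = integral\<^sup>L (distr lborel borel ((-) c)) f"
    using eq by simp
  also have "\<dots> = (LINT x|lborel. f (c - x))"
    by (rule integral_distr) (use assms in auto)
  finally show "(LINT x|lborel. f (c - x)) = integral\<^sup>L lborel f"
    by simp
  have "integrable lborel f \<longleftrightarrow> integrable (distr lborel borel ((-) c)) f"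
    using eq by simp
  also have "\<dots> \<longleftrightarrow> integrable lborel (\<lambda>x. f (c - x))"
    by (rule integrable_distr_eq) (use assms in auto)
  finally show "integrable lborel (\<lambda>x. f (c - x)) \<longleftrightarrow> integrable lborel f"
    by simp
qed

text \<open>Difference quotients integrate to zero by translation invariance; pass to the limit.\<close>

lemma integral_partial_zero:
  fixes f :: "'a::euclidean_space \<Rightarrow> real"
  assumes f: "Ck 1 f" and K: "compact K" "\<And>x. x \<notin> K \<Longrightarrow> f x = 0" and i: "i \<in> Basis"
  shows "integral\<^sup>L lebesgue (partial i f) = 0"
proof -
  define t :: "nat \<Rightarrow> real" where "t n = inverse (real (Suc n))" for n
  have t: "t n > 0" "t n \<le> 1" for n by (auto simp: t_def inverse_le_1_iff)
  have tlim: "t \<longlonglongrightarrow> 0"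
    unfolding t_def by (rule LIMSEQ_inverse_real_of_nat)
  have cf: "continuous_on UNIV f" and df: "\<And>x. f differentiable at x"
    using f Ck_imp_continuous[OF f] by auto
  have cp: "continuous_on UNIV (partial i f)"
    using f i by (rule Ck_1_partial_continuous)
  have D: "((\<lambda>s. f (x + s *\<^sub>R i)) has_real_derivative partial i f (x + s *\<^sub>R i)) (at s)" for x s
  proof -
    have "((\<lambda>s. x + s *\<^sub>R i) has_derivative (\<lambda>h. h *\<^sub>R i)) (at s)"
      by (auto intro!: derivative_eq_intros)
    from has_derivative_compose[OF this has_derivative_grad[OF df]]
    moreover have "(\<lambda>h. grad f (x + s *\<^sub>R i) \<bullet> (h *\<^sub>R i)) = (*) (partial i f (x + s *\<^sub>R i))"
      using i by auto
    ultimately show ?thesis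
      by (simp add: has_field_derivative_def)
  qed
  have z: "x \<notin> K \<Longrightarrow> partial i f x = 0" for x
    using partial_zero_outside[OF compact_imp_closed[OF K(1)] K(2)] .
  obtain M where M: "M > 0" "\<And>x. \<bar>partial i f x\<bar> \<le> M"
    using compact_support_bounded[OF cp K(1) z] by blast
  obtain R where R: "R > 0" "\<And>x. x \<in> K \<Longrightarrow> norm x \<le> R"
    using compact_imp_bounded[OF K(1)] by (auto simp: bounded_pos)
  define Q where "Q n x = (f (x + t n *\<^sub>R i) - f x) / t n" for n x
  have bm: "f \<in> borel_measurable borel" "partial i f \<in> borel_measurable borel"
    using cf cp by (auto intro: borel_measurable_continuous_onI)
  have intf: "integrable lborel f"
    using compact_support_integrable[OF cf K] by blast
  \<comment> \<open>By the mean value theorem each quotient is bounded by M. As all increments are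
    at most 1 and the support lies in the ball of radius R, the quotients vanish off the ball of
    radius R + 1, which gives an integrable majorant.\<close>
  have "(\<lambda>n. integral\<^sup>L lborel (Q n)) \<longlonglongrightarrow> integral\<^sup>L lborel (partial i f)"
  proof (rule integral_dominated_convergence[where w="\<lambda>x. M * indicator (cball 0 (R + 1)) x"])
    show "partial i f \<in> borel_measurable lborel" "Q n \<in> borel_measurable lborel" for n
      unfolding Q_def using bm by measurable
    show "integrable lborel (\<lambda>x::'a. M * indicator (cball 0 (R + 1)) x)"
      by (intro integrable_mult_right integrable_real_indicator) (use emeasure_bounded_finite[OF bounded_cball] in auto)
    show "AE x in lborel. (\<lambda>n. Q n x) \<longlonglongrightarrow> partial i f x"
    proof (rule AE_I2)
      fix x
      have "((\<lambda>h. (f (x + h *\<^sub>R i) - f x) / h) \<longlongrightarrow> partial i f x) (at 0)"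
        using D[of x 0] by (simp add: DERIV_def)
      moreover have "filterlim t (at 0) sequentially"
        using tlim t(1) by (auto simp: filterlim_at intro!: always_eventually dest: less_imp_neq)
          (metis less_irrefl)
      ultimately show "(\<lambda>n. Q n x) \<longlonglongrightarrow> partial i f x"
        unfolding Q_def using filterlim_compose by blast
    qed
    show "AE x in lborel. norm (Q n x) \<le> M * indicator (cball 0 (R + 1)) x" for n
    proof (rule AE_I2)
      fix x
      show "norm (Q n x) \<le> M * indicator (cball 0 (R + 1)) x"
      proof (cases "norm x \<le> R + 1")
        case True
        obtain s where "f (x + t n *\<^sub>R i) - f (x + 0 *\<^sub>R i) = (t n - 0) * partial i f (x + s *\<^sub>R i)"
          using MVT2[OF t(1)[of n] D[of x]] by blast
        then have "Q n x = partial i f (x + s *\<^sub>R i)"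
          using t(1)[of n] by (simp add: Q_def)
        then show ?thesis using M True by (simp add: indicator_def)
      next
        case False
        have "norm x \<le> norm (x + t n *\<^sub>R i) + norm (t n *\<^sub>R i)"
          using norm_triangle_ineq4[of "x + t n *\<^sub>R i" "t n *\<^sub>R i"] by simp
        then have "norm (x + t n *\<^sub>R i) > R"
          using False t[of n] i by simp
        then have "x + t n *\<^sub>R i \<notin> K" "x \<notin> K"
          using R(2)[of "x + t n *\<^sub>R i"] R(2)[of x] False by auto
        then show ?thesis using K(2) M(1) by (simp add: Q_def)
      qed
    qed
  qed
  moreover have "integral\<^sup>L lborel (Q n) = 0" for n
    unfolding Q_def using intf bm lborel_translation[of f "t n *\<^sub>R i"] by simp
  ultimately have "integral\<^sup>L lborel (partial i f) = 0"
    by (simp add: LIMSEQ_const_iff)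
  then show ?thesis
    using bm by (simp add: integral_completion)
qed

text \<open>Only g needs compact support: the product then has it too, and the integral of its
  partial derivative vanishes.\<close>

lemma integral_by_parts:
  fixes f g :: "'a::euclidean_space \<Rightarrow> real"
  assumes f: "Ck 1 f" and g: "Ck 1 g" and K: "compact K" "K \<subseteq> S" "\<And>x. x \<notin> K \<Longrightarrow> g x = 0"
    and i: "i \<in> Basis" and S: "S \<in> sets lebesgue"
  shows "(LINT x|lebesgue_on S. f x * partial i g x) = - (LINT x|lebesgue_on S. partial i f x * g x)"
proof -
  have c: "continuous_on UNIV f" "continuous_on UNIV g"
      "continuous_on UNIV (partial i f)" "continuous_on UNIV (partial i g)"
    using f g i by (auto intro: Ck_imp_continuous Ck_1_partial_continuous simp del: One_nat_def)
  have z: "x \<notin> K \<Longrightarrow> partial i g x = 0" for x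
    using partial_zero_outside[OF compact_imp_closed[OF K(1)] K(3)] .
  have int: "integrable lebesgue (\<lambda>x. f x * partial i g x)" "integrable lebesgue (\<lambda>x. partial i f x * g x)"
    using c z K(3) by (auto intro!: compact_support_integrable(2)[OF _ K(1)] continuous_on_mult)
  have "0 = integral\<^sup>L lebesgue (partial i (\<lambda>x. f x * g x))"
    using integral_partial_zero[OF Ck_mult[OF f g] K(1) _ i] K(3) by simp
  also have "partial i (\<lambda>x. f x * g x) = (\<lambda>x. f x * partial i g x + partial i f x * g x)"
    by (rule ext, rule partial_mult) (use f g in auto)
  also have "integral\<^sup>L lebesgue \<dots> = (LINT x|lebesgue. f x * partial i g x) + (LINT x|lebesgue. partial i f x * g x)"
    using int by simp
  finally show ?thesis
    using lebesgue_on_eq_lebesgue(1)[OF S, of "\<lambda>x. f x * partial i g x"]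
      lebesgue_on_eq_lebesgue(1)[OF S, of "\<lambda>x. partial i f x * g x"] z K(2,3)
    by (simp add: subset_iff) (metis K(3) add.inverse_unique add.commute mult_zero_right z)
qed

section \<open>Mollification\<close>

text \<open>A predicate on kernels rather than a rescaling of one fixed kernel: smoothness, sign,
  support radius and mass are all that the estimates use, so no dilation has to be carried
  along.\<close>

definition mollifier :: "real \<Rightarrow> ('a::euclidean_space \<Rightarrow> real) \<Rightarrow> bool" where
  "mollifier e \<eta> \<longleftrightarrow> smooth \<eta> \<and> (\<forall>x. 0 \<le> \<eta> x) \<and> (\<forall>x. e < norm x \<longrightarrow> \<eta> x = 0) \<and> integral\<^sup>L lborel \<eta> = 1"

text \<open>A product of one-dimensional bumps, one for each coordinate, is smooth and supported in
  a cube; dividing by its integral gives mass one.\<close>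

lemma mollifier_exists:
  assumes "e > 0"
  shows "\<exists>\<eta>::'a::euclidean_space \<Rightarrow> real. mollifier e \<eta>"
proof -
  \<comment> \<open>The half-side of the cube. Since the norm is at most the sum of the absolute
    coordinates, the cube lies in the ball of radius e.\<close>
  define d where "d = e / real DIM('a)"
  have d: "d > 0" using assms by (simp add: d_def)
  define \<beta> :: "'a \<Rightarrow> real" where
    "\<beta> x = (\<Prod>i\<in>Basis. flat_exp 0 (x \<bullet> i + d) * flat_exp 0 (x \<bullet> (- i) + d))" for x
  have sm: "smooth \<beta>"
    unfolding \<beta>_def by (intro allI Ck_prod Ck_mult Ck_flat_exp_affine) auto
  have nn: "\<beta> x \<ge> 0" for x
    unfolding \<beta>_def by (intro prod_nonneg ballI mult_nonneg_nonneg flat_exp_nonneg)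
  have z: "\<beta> x = 0" if "e < norm x" for x
  proof -
    have "\<exists>i\<in>Basis. \<bar>x \<bullet> i\<bar> > d"
    proof (rule ccontr)
      assume "\<not> ?thesis"
      then have "(\<Sum>i\<in>Basis. \<bar>x \<bullet> i\<bar>) \<le> (\<Sum>i\<in>(Basis::'a set). d)"
        by (intro sum_mono) force
      then have "norm x \<le> e" using norm_le_l1[of x] by (simp add: d_def)
      with that show False by simp
    qed
    then obtain i where i: "i \<in> Basis" "\<bar>x \<bullet> i\<bar> > d" by blast
    then have "flat_exp 0 (x \<bullet> i + d) * flat_exp 0 (x \<bullet> (- i) + d) = 0"
      using d by (auto simp: flat_exp_def)
    then show ?thesis unfolding \<beta>_def using i(1) by (auto intro: prod_zero)
  qed
  have c: "continuous_on UNIV \<beta>" using sm Ck_imp_continuous by blast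
  have int: "integrable lborel \<beta>"
    by (rule compact_support_integrable[OF c compact_cball[of 0 e]]) (use z in auto)
  have "\<beta> 0 > 0"
    unfolding \<beta>_def using d by (intro prod_pos) (auto simp: flat_exp_def)
  have "integral\<^sup>L lborel \<beta> \<noteq> 0"
  proof
    assume "integral\<^sup>L lborel \<beta> = 0"
    then have ae: "AE x in lborel. \<beta> x = 0"
      using integral_nonneg_eq_0_iff_AE[OF int] nn by simp
    \<comment> \<open>A nonnegative function with zero integral vanishes almost everywhere, but this
      set is open and contains 0, so it cannot be negligible.\<close>
    have op: "open {x. \<beta> x > 0}"
      using c by (intro open_Collect_less) auto
    have "{x. \<beta> x > 0} \<in> null_sets lborel"
      using ae op by (subst AE_iff_null_sets) auto
    then have "negligible {x. \<beta> x > 0}"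
      by (simp add: negligible_iff_null_sets null_sets_completionI)
    then show False
      using open_not_negligible[OF op] \<open>\<beta> 0 > 0\<close> by auto
  qed
  then have I: "integral\<^sup>L lborel \<beta> > 0"
    using Bochner_Integration.integral_nonneg[of lborel \<beta>] nn by (simp add: less_le)
  have "mollifier e (\<lambda>x. inverse (integral\<^sup>L lborel \<beta>) * \<beta> x)"
    unfolding mollifier_def using sm nn z I by (auto intro: Ck_cmult)
  then show ?thesis by blast
qed

lemma integrable_bounded_mult:
  fixes g h :: "'a \<Rightarrow> real"
  assumes "integrable M g" "h \<in> borel_measurable M" "AE x in M. \<bar>h x\<bar> \<le> B"
  shows "integrable M (\<lambda>x. g x * h x)"
proof (rule Bochner_Integration.integrable_bound)
  show "integrable M (\<lambda>x. B * g x)" using assms(1) by simp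
  show "(\<lambda>x. g x * h x) \<in> borel_measurable M" using assms by auto
  show "AE x in M. norm (g x * h x) \<le> norm (B * g x)"
    using assms(3)
  proof eventually_elim
    case (elim x)
    then have "\<bar>h x\<bar> \<le> \<bar>B\<bar>" by simp
    then show ?case
      by (simp add: abs_mult mult.commute mult_right_mono)
        (metis abs_ge_zero mult.commute mult_left_mono)
  qed
qed

section \<open>Uniform first-order estimates for compactly supported functions\<close>

lemma grad_continuous: "Ck 1 f \<Longrightarrow> continuous_on UNIV (grad f)"
  unfolding grad_def by (intro continuous_intros Ck_1_partial_continuous)

lemma compact_support_grad_bounded:
  fixes f :: "'a::euclidean_space \<Rightarrow> real"
  assumes "Ck 1 f" "compact K" "\<And>x. x \<notin> K \<Longrightarrow> f x = 0"
  obtains L where "L > 0" "\<And>x. norm (grad f x) \<le> L"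
proof -
  have "x \<notin> K \<Longrightarrow> norm (grad f x) = 0" for x
    using partial_zero_outside[OF compact_imp_closed[OF assms(2)] assms(3)] by (simp add: grad_def)
  moreover have "continuous_on UNIV (\<lambda>x. norm (grad f x))"
    using grad_continuous[OF assms(1)] by (rule continuous_on_norm)
  ultimately obtain L where "L > 0" "\<And>x. \<bar>norm (grad f x)\<bar> \<le> L"
    using compact_support_bounded[OF _ assms(2), of "\<lambda>x. norm (grad f x)"] by blast
  then show ?thesis using that by simp
qed

lemma compact_support_lipschitz:
  fixes f :: "'a::euclidean_space \<Rightarrow> real"
  assumes "Ck 1 f" "compact K" "\<And>x. x \<notin> K \<Longrightarrow> f x = 0"
  obtains L where "L > 0" "\<And>x y. \<bar>f x - f y\<bar> \<le> L * norm (x - y)"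
proof -
  obtain L where L: "L > 0" "\<And>x. norm (grad f x) \<le> L"
    using compact_support_grad_bounded[OF assms] by blast
  have "norm (f x - f y) \<le> L * norm (x - y)" for x y
  proof (rule differentiable_bound[where S=UNIV and f'="\<lambda>x h. grad f x \<bullet> h"])
    show "(f has_derivative (\<lambda>h. grad f x \<bullet> h)) (at x)" for x
      using assms(1) by (intro has_derivative_grad) simp
    show "onorm (\<lambda>h. grad f x \<bullet> h) \<le> L" for x
    proof (rule onorm_bound)
      show "norm (grad f x \<bullet> h) \<le> L * norm h" for h
        using Cauchy_Schwarz_ineq2[of "grad f x" h] mult_right_mono[OF L(2)[of x] norm_ge_zero[of h]]
        by simp
    qed (use L in auto)
  qed auto
  with L(1) that show ?thesis by simp
qed

text \<open>The partial derivatives are Lipschitz, which makes the remainder quadratic with a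
  constant independent of the base point. This uniformity allows the expansion of a kernel to be
  integrated against any integrable function.\<close>

lemma compact_support_taylor:
  fixes f :: "'a::euclidean_space \<Rightarrow> real"
  assumes f: "smooth f" and K: "compact K" "\<And>x. x \<notin> K \<Longrightarrow> f x = 0"
  obtains C where "C > 0" "\<And>z h. \<bar>f (z + h) - f z - grad f z \<bullet> h\<bar> \<le> C * (norm h)\<^sup>2"
proof -
  have z: "x \<notin> K \<Longrightarrow> partial i f x = 0" for i x
    using partial_zero_outside[OF compact_imp_closed[OF K(1)] K(2)] .
  have "\<exists>L>0. \<forall>x y. \<bar>partial i f x - partial i f y\<bar> \<le> L * norm (x - y)" if "i \<in> Basis" for i
  proof -
    have "Ck 1 (partial i f)"
      using smooth_partial[OF f that] by blast
    then obtain L where "L > 0" "\<And>x y. \<bar>partial i f x - partial i f y\<bar> \<le> L * norm (x - y)"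
      using compact_support_lipschitz[where f="partial i f", OF _ K(1) z] by blast
    then show ?thesis by blast
  qed
  then have "\<forall>i\<in>Basis. \<exists>L>0. \<forall>x y. \<bar>partial i f x - partial i f y\<bar> \<le> L * norm (x - y)"
    by blast
  from bchoice[OF this] obtain L where L: "\<And>i. i \<in> Basis \<Longrightarrow> L i > 0"
    "\<And>i x y. i \<in> Basis \<Longrightarrow> \<bar>partial i f x - partial i f y\<bar> \<le> L i * norm (x - y)"
    by blast
  \<comment> \<open>The norm of a gradient difference is at most the sum of its components, so the
    Lipschitz constants of the partial derivatives add up.\<close>
  define C where "C = (\<Sum>i\<in>Basis. L i)"
  have C: "C > 0" unfolding C_def using L(1) by (intro sum_pos) auto
  have lip: "norm (grad f x - grad f y) \<le> C * norm (x - y)" for x y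
  proof -
    have "norm (grad f x - grad f y) \<le> (\<Sum>i\<in>Basis. \<bar>(grad f x - grad f y) \<bullet> i\<bar>)"
      by (rule norm_le_l1)
    also have "\<dots> \<le> (\<Sum>i\<in>Basis. L i * norm (x - y))"
      using L(2) by (intro sum_mono) (simp add: inner_diff_left)
    finally show ?thesis by (simp add: C_def sum_distrib_right)
  qed
  have "\<bar>f (z + h) - f z - grad f z \<bullet> h\<bar> \<le> C * (norm h)\<^sup>2" for z h
  proof -
    have "norm (f (z + h) - f z - grad f z \<bullet> (z + h - z)) \<le> norm (z + h - z) * (C * norm h)"
    proof (rule differentiable_bound_linearization[where S="cball z (norm h)" and f'="\<lambda>x h. grad f x \<bullet> h"])
      show "z + t *\<^sub>R (z + h - z) \<in> cball z (norm h)" if "t \<in> {0..1}" for t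
        using that mult_right_mono[of t 1 "norm h"] by (auto simp: dist_norm)
      show "(f has_derivative (\<lambda>h. grad f x \<bullet> h)) (at x within cball z (norm h))" for x
        using smooth_1[OF f] by (intro has_derivative_at_withinI[OF has_derivative_grad]) simp
      show "onorm ((\<lambda>h. grad f x \<bullet> h) - (\<lambda>h. grad f z \<bullet> h)) \<le> C * norm h" if "x \<in> cball z (norm h)" for x
      proof (rule onorm_bound)
        fix k
        have "norm (grad f x - grad f z) \<le> C * norm h"
        proof (rule order_trans[OF lip])
          show "C * norm (x - z) \<le> C * norm h"
            using C that by (intro mult_left_mono) (auto simp: dist_norm norm_minus_commute)
        qed
        then show "norm (((\<lambda>h. grad f x \<bullet> h) - (\<lambda>h. grad f z \<bullet> h)) k) \<le> C * norm h * norm k"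
          using Cauchy_Schwarz_ineq2[of "grad f x - grad f z" k]
            mult_right_mono[of "norm (grad f x - grad f z)" "C * norm h" "norm k"]
          by (simp add: inner_diff_left)
      qed (use C in auto)
    qed auto
    then show ?thesis by (simp add: power2_eq_square mult.left_commute mult.assoc)
  qed
  with C that show ?thesis by blast
qed

section \<open>Convolution with a compactly supported kernel\<close>

definition conv :: "('a::euclidean_space \<Rightarrow> real) \<Rightarrow> ('a \<Rightarrow> real) \<Rightarrow> 'a \<Rightarrow> real" where
  "conv g \<eta> x = (LINT y|lebesgue. g y * \<eta> (x - y))"

lemma borel_measurable_lebesgue_continuous:
  fixes f :: "'a::euclidean_space \<Rightarrow> 'b::euclidean_space"
  shows "continuous_on UNIV f \<Longrightarrow> f \<in> borel_measurable lebesgue"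
  using borel_measurable_lebesgue_on_continuous[of f UNIV] by (simp add: lebesgue_on_UNIV_eq)

lemma continuous_on_reflect:
  fixes f :: "'a::real_normed_vector \<Rightarrow> 'b::topological_space"
  assumes "continuous_on UNIV f"
  shows "continuous_on UNIV (\<lambda>y. f (x - y))"
  by (rule continuous_on_compose2[OF assms]) (auto intro!: continuous_intros)

lemma conv_integrable:
  fixes g :: "'a::euclidean_space \<Rightarrow> real"
  assumes "integrable lebesgue g" "continuous_on UNIV \<eta>" "compact K" "\<And>x. x \<notin> K \<Longrightarrow> \<eta> x = 0"
  shows "integrable lebesgue (\<lambda>y. g y * \<eta> (x - y))"
proof -
  obtain M where "\<And>x. \<bar>\<eta> x\<bar> \<le> M"
    using compact_support_bounded[OF assms(2-4)] by blast
  then show ?thesis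
    by (intro integrable_bounded_mult[OF assms(1), where B=M] borel_measurable_lebesgue_continuous
        continuous_on_reflect assms(2)) auto
qed

text \<open>The variable x occurs only in the kernel, so g need only be integrable. Integrating the
  Taylor expansion of the kernel against g leaves a remainder of at most C times the L^1 norm of g
  times the squared increment.\<close>

lemma conv_has_derivative:
  fixes g :: "'a::euclidean_space \<Rightarrow> real"
  assumes g: "integrable lebesgue g" and \<eta>: "smooth \<eta>" and K: "compact K" "\<And>x. x \<notin> K \<Longrightarrow> \<eta> x = 0"
  shows "(conv g \<eta> has_derivative (\<lambda>h. (\<Sum>i\<in>Basis. conv g (partial i \<eta>) x *\<^sub>R i) \<bullet> h)) (at x)"
proof -
  obtain C where C: "C > 0" "\<And>z h. \<bar>\<eta> (z + h) - \<eta> z - grad \<eta> z \<bullet> h\<bar> \<le> C * (norm h)\<^sup>2"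
    using compact_support_taylor[OF \<eta> K] by blast
  define G where "G = (\<Sum>i\<in>Basis. conv g (partial i \<eta>) x *\<^sub>R i)"
  define A where "A = C * (LINT y|lebesgue. \<bar>g y\<bar>)"
  have A: "A \<ge> 0" unfolding A_def using C by simp
  have z: "x \<notin> K \<Longrightarrow> partial i \<eta> x = 0" for i x
    using partial_zero_outside[OF compact_imp_closed[OF K(1)] K(2)] .
  have ip: "integrable lebesgue (\<lambda>y. g y * partial i \<eta> (x - y))" if "i \<in> Basis" for i
    using conv_integrable[OF g Ck_1_partial_continuous[OF smooth_1[OF \<eta>] that] K(1) z] .
  have i\<eta>: "integrable lebesgue (\<lambda>y. g y * \<eta> (x - y))" for x
    using conv_integrable[OF g Ck_imp_continuous[OF smooth_1[OF \<eta>]] K] .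
  have main: "\<bar>conv g \<eta> (x + h) - conv g \<eta> x - G \<bullet> h\<bar> \<le> A * (norm h)\<^sup>2" for h
  proof -
    have gr: "g y * (grad \<eta> (x - y) \<bullet> h) = (\<Sum>i\<in>Basis. (h \<bullet> i) * (g y * partial i \<eta> (x - y)))" for y
      by (subst euclidean_inner) (simp add: sum_distrib_left mult_ac)
    have ig: "integrable lebesgue (\<lambda>y. g y * (grad \<eta> (x - y) \<bullet> h))"
      unfolding gr by (intro Bochner_Integration.integrable_sum integrable_mult_right ip)
    have "G \<bullet> h = (LINT y|lebesgue. g y * (grad \<eta> (x - y) \<bullet> h))"
      unfolding gr G_def conv_def inner_sum_left
      by (subst Bochner_Integration.integral_sum) (auto simp: ip inner_commute mult.commute intro!: sum.cong)
    then have "conv g \<eta> (x + h) - conv g \<eta> x - G \<bullet> h =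
        (LINT y|lebesgue. g y * \<eta> (x + h - y) - g y * \<eta> (x - y) - g y * (grad \<eta> (x - y) \<bullet> h))"
      unfolding conv_def using i\<eta> ig by simp
    also have "\<bar>\<dots>\<bar> \<le> (LINT y|lebesgue. C * (norm h)\<^sup>2 * \<bar>g y\<bar>)"
    proof (rule integral_abs_bound[THEN order_trans], rule integral_mono)
      fix y
      have "\<bar>g y * \<eta> (x + h - y) - g y * \<eta> (x - y) - g y * (grad \<eta> (x - y) \<bullet> h)\<bar>
          = \<bar>g y\<bar> * \<bar>\<eta> (x - y + h) - \<eta> (x - y) - grad \<eta> (x - y) \<bullet> h\<bar>"
        by (simp add: abs_mult[symmetric] algebra_simps)
      also have "\<dots> \<le> \<bar>g y\<bar> * (C * (norm h)\<^sup>2)"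
        by (rule mult_left_mono[OF C(2)]) simp
      finally show "\<bar>g y * \<eta> (x + h - y) - g y * \<eta> (x - y) - g y * (grad \<eta> (x - y) \<bullet> h)\<bar>
          \<le> C * (norm h)\<^sup>2 * \<bar>g y\<bar>" by (simp add: mult_ac)
    qed (use g i\<eta> ig in auto)
    finally show ?thesis by (simp add: A_def mult_ac)
  qed
  have "(conv g \<eta> has_derivative (\<lambda>h. G \<bullet> h)) (at x)"
    unfolding has_derivative_at_alt
  proof (intro conjI allI impI)
    show "bounded_linear (\<lambda>h. G \<bullet> h)" by (rule bounded_linear_inner_right)
    fix e :: real assume e: "e > 0"
    show "\<exists>d>0. \<forall>y. norm (y - x) < d \<longrightarrow>
        norm (conv g \<eta> y - conv g \<eta> x - G \<bullet> (y - x)) \<le> e * norm (y - x)"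
    \<comment> \<open>The summand 1 covers the case A = 0.\<close>
    proof (intro exI[of _ "e / (A + 1)"] conjI allI impI)
      show "e / (A + 1) > 0" using e A by simp
      fix y assume "norm (y - x) < e / (A + 1)"
      then have "(A + 1) * norm (y - x) \<le> e"
        using A by (simp add: field_simps)
      moreover have "A * norm (y - x) \<le> (A + 1) * norm (y - x)"
        by (simp add: mult_right_mono)
      ultimately have "A * norm (y - x) * norm (y - x) \<le> e * norm (y - x)"
        by (intro mult_right_mono) auto
      then show "norm (conv g \<eta> y - conv g \<eta> x - G \<bullet> (y - x)) \<le> e * norm (y - x)"
        using main[of "y - x"] by (simp add: power2_eq_square mult.assoc)
    qed
  qed
  then show ?thesis by (simp add: G_def)
qed

lemma conv_partial:
  fixes g :: "'a::euclidean_space \<Rightarrow> real"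
  assumes g: "integrable lebesgue g" and \<eta>: "smooth \<eta>" and K: "compact K" "\<And>x. x \<notin> K \<Longrightarrow> \<eta> x = 0"
    and i: "i \<in> Basis"
  shows "partial i (conv g \<eta>) = conv g (partial i \<eta>)"
proof
  fix x
  show "partial i (conv g \<eta>) x = conv g (partial i \<eta>) x"
    using partial_eq[OF conv_has_derivative[OF g \<eta> K], of i] i by simp
qed

text \<open>A partial derivative of the convolution is the convolution with a partial derivative of
  the kernel, which is again smooth and supported in K; hence the kernel is generalised in the
  induction.\<close>

lemma conv_smooth:
  fixes g :: "'a::euclidean_space \<Rightarrow> real"
  assumes g: "integrable lebesgue g" and \<eta>: "smooth \<eta>" and K: "compact K" "\<And>x. x \<notin> K \<Longrightarrow> \<eta> x = 0"
  shows "smooth (conv g \<eta>)"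
proof
  fix k
  show "Ck k (conv g \<eta>)"
    using \<eta> K(2)
  proof (induction k arbitrary: \<eta>)
    case 0
    have "continuous_on UNIV (conv g \<eta>)"
      using conv_has_derivative[OF g 0(1) K(1) 0(2)]
      by (intro continuous_at_imp_continuous_on) (auto intro: has_derivative_continuous)
    then show ?case by simp
  next
    case (Suc k)
    have "Ck k (conv g (partial i \<eta>))" if "i \<in> Basis" for i
      using Suc.IH[OF smooth_partial[OF Suc.prems(1) that]]
        partial_zero_outside[where f=\<eta>, OF compact_imp_closed[OF K(1)] Suc.prems(2)] by blast
    moreover have "conv g \<eta> differentiable at x" for x
      using conv_has_derivative[OF g Suc.prems(1) K(1) Suc.prems(2)] by (auto simp: differentiable_def)
    ultimately show ?case
      using conv_partial[OF g Suc.prems(1) K(1) Suc.prems(2)] by simp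
  qed
qed

lemma mollifierD:
  assumes "mollifier e \<eta>"
  shows "smooth \<eta>" "0 \<le> \<eta> x" "x \<notin> cball 0 e \<Longrightarrow> \<eta> x = 0" "continuous_on UNIV \<eta>"
    "integrable lborel \<eta>" "(LINT y|lebesgue. \<eta> (x - y)) = 1" "integrable lebesgue (\<lambda>y. \<eta> (x - y))"
proof -
  show s: "smooth \<eta>" and "0 \<le> \<eta> x" and z: "\<And>x. x \<notin> cball 0 e \<Longrightarrow> \<eta> x = 0"
    using assms by (auto simp: mollifier_def)
  show c: "continuous_on UNIV \<eta>" using s Ck_imp_continuous by blast
  show i: "integrable lborel \<eta>"
    by (rule compact_support_integrable[OF c compact_cball z])
  have m: "\<eta> \<in> borel_measurable borel" using c by (rule borel_measurable_continuous_onI)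
  then have m': "(\<lambda>y. \<eta> (x - y)) \<in> borel_measurable borel" by measurable
  show "(LINT y|lebesgue. \<eta> (x - y)) = 1" "integrable lebesgue (\<lambda>y. \<eta> (x - y))"
    using lborel_reflection[OF m, of x] m' i assms
    by (simp_all add: integral_completion integrable_completion mollifier_def)
qed

lemma conv_zero_outside:
  assumes \<eta>: "\<And>z. z \<notin> cball 0 e \<Longrightarrow> \<eta> z = 0" and g: "\<And>x. x \<notin> K \<Longrightarrow> g x = 0"
    and x: "\<And>y. y \<in> K \<Longrightarrow> e < dist x y"
  shows "conv g \<eta> x = 0"
proof -
  have "g y * \<eta> (x - y) = 0" for y
    using g[of y] x[of y] \<eta>[of "x - y"] by (cases "y \<in> K") (auto simp: dist_norm norm_minus_commute)
  then show ?thesis by (simp only: conv_def Bochner_Integration.integral_zero)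
qed

lemma conv_bounded:
  assumes \<eta>: "mollifier e \<eta>" and g: "integrable lebesgue g" "AE x in lebesgue. \<bar>g x\<bar> \<le> B"
  shows "\<bar>conv g \<eta> x\<bar> \<le> B"
proof -
  have "\<bar>conv g \<eta> x\<bar> \<le> (LINT y|lebesgue. \<bar>g y * \<eta> (x - y)\<bar>)"
    unfolding conv_def by (rule integral_abs_bound)
  also have "\<dots> \<le> (LINT y|lebesgue. B * \<eta> (x - y))"
  proof (rule integral_mono_AE)
    show "integrable lebesgue (\<lambda>y. \<bar>g y * \<eta> (x - y)\<bar>)"
      using conv_integrable[OF g(1) mollifierD(4)[OF \<eta>] compact_cball[of 0 e] mollifierD(3)[OF \<eta>]] by simp
    show "AE y in lebesgue. \<bar>g y * \<eta> (x - y)\<bar> \<le> B * \<eta> (x - y)"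
      using g(2) by eventually_elim (auto simp: abs_mult mollifierD(2)[OF \<eta>] intro: mult_right_mono)
  qed (use mollifierD(7)[OF \<eta>] in simp)
  also have "\<dots> = B" using mollifierD(6)[OF \<eta>] by simp
  finally show ?thesis .
qed

section \<open>Convergence of mollifications, uniformly and in L^1\<close>

lemma conv_uniform:
  fixes k :: "'a::euclidean_space \<Rightarrow> real"
  assumes k: "continuous_on UNIV k" "\<And>x. x \<notin> cball 0 R \<Longrightarrow> k x = 0" and d: "d > 0"
  obtains e0 where "e0 > 0" "\<And>e \<eta> x. e < e0 \<Longrightarrow> mollifier e \<eta> \<Longrightarrow> \<bar>conv k \<eta> x - k x\<bar> \<le> d"
proof -
  \<comment> \<open>The radius is enlarged by 1 so that two points at distance below 1 either both
    lie in this ball or both lie outside the support of k.\<close>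
  have "uniformly_continuous_on (cball 0 (R + 1)) k"
    using compact_uniformly_continuous[OF continuous_on_subset[OF k(1)] compact_cball] by auto
  then obtain r where r: "r > 0"
    "\<And>x y. x \<in> cball 0 (R + 1) \<Longrightarrow> y \<in> cball 0 (R + 1) \<Longrightarrow> dist y x < r \<Longrightarrow> dist (k y) (k x) < d"
    using d unfolding uniformly_continuous_on_def by metis
  have near: "\<bar>k y - k x\<bar> \<le> d" if "dist y x < min r 1" for x y
  proof (cases "x \<in> cball 0 (R + 1) \<and> y \<in> cball 0 (R + 1)")
    case True
    then show ?thesis using r(2)[of x y] that by (auto simp: dist_real_def)
  next
    case False
    have "norm x \<le> norm y + dist y x" "norm y \<le> norm x + dist y x"
      by (metis add.commute dist_commute dist_norm norm_triangle_sub,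
          metis dist_norm norm_triangle_sub)
    then have "norm x > R" "norm y > R" using False that by auto
    then show ?thesis using k(2) d by auto
  qed
  have ik: "integrable lebesgue k"
    using compact_support_integrable[OF k(1) compact_cball k(2)] by blast
  have "\<bar>conv k \<eta> x - k x\<bar> \<le> d" if e: "e < min r 1" and \<eta>: "mollifier e \<eta>" for e \<eta> x
  proof -
    note \<eta>' = mollifierD[OF \<eta>]
    have ic: "integrable lebesgue (\<lambda>y. k y * \<eta> (x - y))"
      by (rule conv_integrable[OF ik \<eta>'(4) compact_cball[of 0 e] \<eta>'(3)])
    have "k x = (LINT y|lebesgue. k x * \<eta> (x - y))" using \<eta>'(6) by simp
    then have "conv k \<eta> x - k x = (LINT y|lebesgue. k y * \<eta> (x - y) - k x * \<eta> (x - y))"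
      unfolding conv_def using ic \<eta>'(7) by simp
    also have "\<bar>\<dots>\<bar> \<le> (LINT y|lebesgue. d * \<eta> (x - y))"
    proof (rule integral_abs_bound[THEN order_trans], rule integral_mono)
      fix y
      have "\<bar>k y * \<eta> (x - y) - k x * \<eta> (x - y)\<bar> = \<bar>k y - k x\<bar> * \<eta> (x - y)"
        using \<eta>'(2)[of "x - y"] by (simp add: abs_mult[symmetric] left_diff_distrib[symmetric] abs_mult)
      also have "\<dots> \<le> d * \<eta> (x - y)"
      proof (cases "dist y x < min r 1")
        case True
        then show ?thesis using near \<eta>'(2) by (intro mult_right_mono) auto
      next
        case False
        then have "\<eta> (x - y) = 0" using e by (intro \<eta>'(3)) (auto simp: dist_norm norm_minus_commute)
        then show ?thesis by simp
      qed
      finally show "\<bar>k y * \<eta> (x - y) - k x * \<eta> (x - y)\<bar> \<le> d * \<eta> (x - y)" .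
    qed (use ic \<eta>'(7) in auto)
    also have "\<dots> = d" using \<eta>'(6) by simp
    finally show ?thesis .
  qed
  moreover have "min r 1 > 0" using r by simp
  ultimately show ?thesis using that by blast
qed

text \<open>Young's inequality for a kernel of mass one: exchange the order of integration and
  integrate the kernel out first.\<close>

lemma conv_L1_bound:
  fixes g :: "'a::euclidean_space \<Rightarrow> real"
  assumes g: "integrable lebesgue g" and \<eta>: "mollifier e \<eta>"
  shows "integrable lebesgue (conv g \<eta>)"
    and "(LINT x|lebesgue. \<bar>conv g \<eta> x\<bar>) \<le> (LINT x|lebesgue. \<bar>g x\<bar>)"
proof -
  note \<eta>' = mollifierD[OF \<eta>]
  have [measurable]: "\<eta> \<in> borel_measurable borel"
    using \<eta>'(4) by (rule borel_measurable_continuous_onI)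
  \<comment> \<open>The exchange of integrals is carried out for \<open>lborel\<close> and needs
    joint Borel measurability, whereas g is only Lebesgue measurable. A Borel representative has the
    same convolution.\<close>
  obtain g' where g'[measurable]: "g' \<in> borel_measurable lborel" and ae: "AE x in lborel. g x = g' x"
    using completion_ex_borel_measurable_real[of g lborel] g by auto
  have ae': "AE x in lebesgue. g x = g' x" using ae by (rule AE_completion)
  have g'm: "g' \<in> borel_measurable lebesgue" by (rule measurable_completion) simp
  have "integrable lebesgue g'"
    using g ae' g'm Bochner_Integration.integrable_cong_AE[of g lebesgue g'] by auto
  then have ig': "integrable lborel g'" by (simp add: integrable_completion)
  have conv_eq: "conv g \<eta> x = (LINT y|lborel. g' y * \<eta> (x - y))" for x
  proof -
    have "conv g \<eta> x = (LINT y|lebesgue. g' y * \<eta> (x - y))"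
      unfolding conv_def
    proof (rule integral_cong_AE)
      show "AE y in lebesgue. g y * \<eta> (x - y) = g' y * \<eta> (x - y)"
        using ae' by eventually_elim simp
    qed (use g g'm \<eta>'(7)[of x] in \<open>auto dest: borel_measurable_integrable\<close>)
    also have "\<dots> = (LINT y|lborel. g' y * \<eta> (x - y))"
      by (rule integral_completion) simp
    finally show ?thesis .
  qed
  have sm: "smooth (conv g \<eta>)"
    by (rule conv_smooth[OF g \<eta>'(1) compact_cball[of 0 e] \<eta>'(3)])
  then have cm[measurable]: "conv g \<eta> \<in> borel_measurable borel"
    using Ck_imp_continuous by (intro borel_measurable_continuous_onI) blast
  have n\<eta>: "(\<integral>\<^sup>+x. ennreal (\<eta> (x - y)) \<partial>lborel) = 1" for y
  proof -
    have "(LINT x|lborel. \<eta> (x - y)) = 1" "integrable lborel (\<lambda>x. \<eta> (x - y))"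
      using lborel_translation[of \<eta> "- y"] \<eta> \<eta>'(5) by (auto simp: mollifier_def)
    then show ?thesis using nn_integral_eq_integral[of lborel "\<lambda>x. \<eta> (x - y)"] \<eta>'(2) by simp
  qed
  have "(\<integral>\<^sup>+x. ennreal (norm (conv g \<eta> x)) \<partial>lborel)
      \<le> (\<integral>\<^sup>+x. (\<integral>\<^sup>+y. ennreal (norm (g' y)) * ennreal (\<eta> (x - y)) \<partial>lborel) \<partial>lborel)"
  proof (rule nn_integral_mono)
    fix x
    have "ennreal (norm (conv g \<eta> x)) \<le> (\<integral>\<^sup>+y. ennreal (norm (g' y * \<eta> (x - y))) \<partial>lborel)"
      unfolding conv_eq by (rule integral_norm_bound_ennreal)
        (use conv_integrable[of g' \<eta> "cball 0 e" x] \<eta>' ig' in \<open>auto simp: integrable_completion\<close>)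
    then show "ennreal (norm (conv g \<eta> x)) \<le> (\<integral>\<^sup>+y. ennreal (norm (g' y)) * ennreal (\<eta> (x - y)) \<partial>lborel)"
      using \<eta>'(2) by (simp add: abs_mult ennreal_mult)
  qed
  also have "\<dots> = (\<integral>\<^sup>+y. (\<integral>\<^sup>+x. ennreal (norm (g' y)) * ennreal (\<eta> (x - y)) \<partial>lborel) \<partial>lborel)"
    by (rule lborel_pair.Fubini') measurable
  also have "\<dots> = (\<integral>\<^sup>+y. ennreal (norm (g' y)) \<partial>lborel)"
    by (simp add: nn_integral_cmult n\<eta>)
  finally have le: "(\<integral>\<^sup>+x. ennreal (norm (conv g \<eta> x)) \<partial>lborel) \<le> (\<integral>\<^sup>+y. ennreal (norm (g' y)) \<partial>lborel)" .
  have fin: "(\<integral>\<^sup>+y. ennreal (norm (g' y)) \<partial>lborel) < \<infinity>"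
    using ig' by (simp add: integrable_iff_bounded)
  have ic: "integrable lborel (conv g \<eta>)"
    unfolding integrable_iff_bounded using le fin cm by (auto intro: le_less_trans)
  then show "integrable lebesgue (conv g \<eta>)" by (simp add: integrable_completion)
  have "(LINT x|lebesgue. \<bar>conv g \<eta> x\<bar>) = (LINT x|lborel. norm (conv g \<eta> x))"
    by (simp add: integral_completion)
  also have "\<dots> \<le> (LINT x|lborel. norm (g' x))"
    using le nn_integral_eq_integral[OF integrable_norm[OF ic]] nn_integral_eq_integral[OF integrable_norm[OF ig']]
    by (simp add: ennreal_le_iff)
  also have "\<dots> = (LINT x|lebesgue. norm (g' x))"
    by (simp add: integral_completion)
  also have "\<dots> = (LINT x|lebesgue. \<bar>g x\<bar>)"
  proof (rule integral_cong_AE)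
    show "AE x in lebesgue. norm (g' x) = \<bar>g x\<bar>" using ae' by eventually_elim simp
  qed (use g g'm in auto)
  finally show "(LINT x|lebesgue. \<bar>conv g \<eta> x\<bar>) \<le> (LINT x|lebesgue. \<bar>g x\<bar>)" .
qed

lemma integrable_indicator_cball:
  "integrable lebesgue (\<lambda>x::'a::euclidean_space. c * indicator (cball 0 R) x :: real)"
proof -
  have "integrable lborel (\<lambda>x::'a. c * indicator (cball 0 R) x :: real)"
    by (intro integrable_mult_right integrable_real_indicator) (use emeasure_bounded_finite[OF bounded_cball] in auto)
  then show ?thesis by (subst integrable_completion) auto
qed

text \<open>Measurability provides continuous functions converging almost everywhere. Truncating
  them at B and multiplying by a cutoff does not change the limit g and supplies an integrable
  majorant.\<close>

lemma approx_continuous_L1: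
  fixes g :: "'a::euclidean_space \<Rightarrow> real"
  assumes g: "g \<in> borel_measurable lebesgue" "\<And>x. \<bar>g x\<bar> \<le> B" "\<And>x. x \<notin> cball 0 R \<Longrightarrow> g x = 0"
    and d: "d > 0"
  obtains k where "continuous_on UNIV k" "\<And>x. x \<notin> cball 0 (R + 1) \<Longrightarrow> k x = 0"
    "(LINT x|lebesgue. \<bar>g x - k x\<bar>) < d"
proof -
  have B: "B \<ge> 0" using g(2) abs_ge_zero order_trans by blast
  obtain N f where N: "negligible N" and f: "\<And>n. continuous_on UNIV (f n)"
    and lim: "\<And>x. x \<notin> N \<Longrightarrow> (\<lambda>n. f n x) \<longlonglongrightarrow> g x"
  proof -
    have "g measurable_on UNIV"
      using lebesgue_measurable_imp_measurable_on[of g UNIV] g(1) by (simp add: lebesgue_on_UNIV_eq)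
    then show ?thesis using that unfolding measurable_on_def by auto
  qed
  \<comment> \<open>Equal to 1 on the ball of radius R and to 0 outside the ball of radius R +
    1.\<close>
  define c :: "'a \<Rightarrow> real" where "c x = max 0 (min 1 (R + 1 - norm x))" for x
  define k where "k n x = max (- B) (min B (f n x)) * c x" for n x
  have c: "continuous_on UNIV c" unfolding c_def by (intro continuous_intros)
  have c01: "0 \<le> c x" "c x \<le> 1" for x by (auto simp: c_def)
  have k: "continuous_on UNIV (k n)" for n
    unfolding k_def by (intro continuous_intros f c)
  have kz: "k n x = 0" if "x \<notin> cball 0 (R + 1)" for n x
    using that by (simp add: k_def c_def)
  have kB: "\<bar>k n x\<bar> \<le> B" for n x
  proof -
    have "\<bar>k n x\<bar> = \<bar>max (- B) (min B (f n x))\<bar> * c x" using c01 by (simp add: k_def abs_mult)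
    also have "\<dots> \<le> B * 1" using B c01 by (intro mult_mono) auto
    finally show ?thesis by simp
  qed
  have "(\<lambda>n. LINT x|lebesgue. \<bar>g x - k n x\<bar>) \<longlonglongrightarrow> (LINT x|(lebesgue::'a measure). 0)"
  proof (rule integral_dominated_convergence[where w="\<lambda>x. 2 * B * indicator (cball 0 (R + 1)) x"])
    show "(\<lambda>x. \<bar>g x - k n x\<bar>) \<in> borel_measurable lebesgue" for n
      using g(1) borel_measurable_lebesgue_continuous[OF k] by measurable
    show "integrable lebesgue (\<lambda>x::'a. 2 * B * indicator (cball 0 (R + 1)) x)"
      by (rule integrable_indicator_cball)
    have "AE x in lebesgue. x \<notin> N"
      using N by (metis AE_not_in negligible_iff_null_sets)
    then show "AE x in lebesgue. (\<lambda>n. \<bar>g x - k n x\<bar>) \<longlonglongrightarrow> 0"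
    proof eventually_elim
      case (elim x)
      have "(\<lambda>n. k n x) \<longlonglongrightarrow> max (- B) (min B (g x)) * c x"
        unfolding k_def by (intro tendsto_intros lim elim)
      also have "max (- B) (min B (g x)) * c x = g x"
        using g(2)[of x] g(3)[of x] by (cases "x \<in> cball 0 R") (auto simp: c_def)
      finally have "(\<lambda>n. g x - k n x) \<longlonglongrightarrow> g x - g x" by (intro tendsto_intros)
      then show ?case using tendsto_rabs by fastforce
    qed
    show "AE x in lebesgue. norm \<bar>g x - k n x\<bar> \<le> 2 * B * indicator (cball 0 (R + 1)) x" for n
    proof (rule AE_I2)
      fix x
      show "norm \<bar>g x - k n x\<bar> \<le> 2 * B * indicator (cball 0 (R + 1)) x"
        using g(2)[of x] g(3)[of x] kB[of n x] kz[of x n] by (cases "x \<in> cball 0 (R + 1)") auto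
    qed
  qed auto
  then have "eventually (\<lambda>n. (LINT x|lebesgue. \<bar>g x - k n x\<bar>) < d) sequentially"
    using d by (auto simp: order_tendsto_iff)
  then obtain n where "(LINT x|lebesgue. \<bar>g x - k n x\<bar>) < d"
    by (auto simp: eventually_sequentially)
  with k kz that show ?thesis by blast
qed

text \<open>With k a continuous L^1 approximation of g, split the error into the convolution of g -
  k, the mollification error of k, and k - g. The first is controlled by the L^1 contraction
  property and the second by uniform convergence on a bounded set; each receives d / 3.\<close>

lemma conv_L1_approx:
  fixes g :: "'a::euclidean_space \<Rightarrow> real"
  assumes g: "g \<in> borel_measurable lebesgue" "\<And>x. \<bar>g x\<bar> \<le> B" "\<And>x. x \<notin> cball 0 R \<Longrightarrow> g x = 0"
    and d: "d > 0"
  obtains e0 where "e0 > 0" "\<And>e \<eta>. e < e0 \<Longrightarrow> mollifier e \<eta> \<Longrightarrow> (LINT x|lebesgue. \<bar>conv g \<eta> x - g x\<bar>) \<le> d"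
proof -
  have ig: "integrable lebesgue g"
  proof (rule Bochner_Integration.integrable_bound)
    show "integrable lebesgue (\<lambda>x::'a. B * indicator (cball 0 R) x)" by (rule integrable_indicator_cball)
    show "AE x in lebesgue. norm (g x) \<le> norm (B * indicator (cball 0 R) x)"
    proof (rule AE_I2)
      fix x
      show "norm (g x) \<le> norm (B * indicator (cball 0 R) x)"
        using g(2)[of x] g(3)[of x] by (cases "x \<in> cball 0 R") auto
    qed
  qed (rule g(1))
  obtain k where k: "continuous_on UNIV k" "\<And>x. x \<notin> cball 0 (R + 1) \<Longrightarrow> k x = 0"
    "(LINT x|lebesgue. \<bar>g x - k x\<bar>) < d / 3"
    using approx_continuous_L1[where R=R and d="d / 3", OF g] d by (metis divide_pos_pos zero_less_numeral)
  have ik: "integrable lebesgue k"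
    using compact_support_integrable[OF k(1) compact_cball k(2)] by blast
  \<comment> \<open>The support of k has radius R + 1 and the kernel radius is below 1, so the error
    of k lives in the ball of radius R + 2; a uniform error d' contributes at most d' * V. The
    summand 1 in d' avoids a division by zero.\<close>
  define V where "V = measure lebesgue (cball (0::'a) (R + 2))"
  define d' where "d' = d / 3 / (V + 1)"
  have d': "d' > 0" "d' * V \<le> d / 3"
  proof -
    have "V \<ge> 0" by (simp add: V_def)
    then show "d' > 0" "d' * V \<le> d / 3" using d by (auto simp: d'_def field_simps)
  qed
  obtain e0 where e0: "e0 > 0" "\<And>e \<eta> x. e < e0 \<Longrightarrow> mollifier e \<eta> \<Longrightarrow> \<bar>conv k \<eta> x - k x\<bar> \<le> d'"
    using conv_uniform[OF k(1,2) d'(1)] by blast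
  have "(LINT x|lebesgue. \<bar>conv g \<eta> x - g x\<bar>) \<le> d" if e: "e < min e0 1" and \<eta>: "mollifier e \<eta>" for e \<eta>
  proof -
    note \<eta>' = mollifierD[OF \<eta>]
    have sub: "conv (\<lambda>x. g x - k x) \<eta> x = conv g \<eta> x - conv k \<eta> x" for x
      unfolding conv_def
      using conv_integrable[OF ig \<eta>'(4) compact_cball[of 0 e] \<eta>'(3), of x]
        conv_integrable[OF ik \<eta>'(4) compact_cball[of 0 e] \<eta>'(3), of x]
      by (simp add: left_diff_distrib)
    have igk: "integrable lebesgue (\<lambda>x. g x - k x)" using ig ik by simp
    note Y = conv_L1_bound[OF igk \<eta>, unfolded sub]
    note ic = conv_L1_bound(1)[OF ig \<eta>] conv_L1_bound(1)[OF ik \<eta>]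
    have "(LINT x|lebesgue. \<bar>conv k \<eta> x - k x\<bar>) \<le> (LINT x|lebesgue. d' * indicator (cball (0::'a) (R + 2)) x)"
    proof (rule integral_mono)
      show "\<bar>conv k \<eta> x - k x\<bar> \<le> d' * indicator (cball 0 (R + 2)) x" for x
      proof (cases "x \<in> cball 0 (R + 2)")
        case False
        have "e < dist x y" if "y \<in> cball 0 (R + 1)" for y
        proof -
          have "norm x \<le> norm y + dist x y" using norm_triangle_sub[of x y] by (simp add: dist_norm)
          then show ?thesis using that False e by simp
        qed
        then have "conv k \<eta> x = 0"
          using conv_zero_outside[where K="cball 0 (R + 1)" and e=e and \<eta>=\<eta> and g=k, OF \<eta>'(3) k(2)] by blast
        then show ?thesis using False k(2)[of x] by simp
      qed (use e0 e \<eta> in auto)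
    qed (use ic ik integrable_indicator_cball in auto)
    also have "\<dots> = d' * V" by (simp add: V_def)
    finally have 1: "(LINT x|lebesgue. \<bar>conv k \<eta> x - k x\<bar>) \<le> d / 3" using d' by simp
    have "(LINT x|lebesgue. \<bar>conv g \<eta> x - g x\<bar>) \<le>
        (LINT x|lebesgue. \<bar>conv g \<eta> x - conv k \<eta> x\<bar> + \<bar>conv k \<eta> x - k x\<bar> + \<bar>g x - k x\<bar>)"
      by (rule integral_mono) (use ic ig ik in auto)
    also have "\<dots> = (LINT x|lebesgue. \<bar>conv g \<eta> x - conv k \<eta> x\<bar>) + (LINT x|lebesgue. \<bar>conv k \<eta> x - k x\<bar>)
        + (LINT x|lebesgue. \<bar>g x - k x\<bar>)"
      using ic ig ik by simp
    finally show ?thesis using Y(2) 1 k(3) by simp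
  qed
  moreover have "min e0 1 > 0" using e0 by simp
  ultimately show ?thesis using that by blast
qed

text \<open>Truncation at B changes g only on a null set and leaves its convolution untouched.
  Products with Sobolev functions are bounded only in this weaker sense.\<close>

lemma conv_L1_approx_AE:
  fixes g :: "'a::euclidean_space \<Rightarrow> real"
  assumes g: "g \<in> borel_measurable lebesgue" "AE x in lebesgue. \<bar>g x\<bar> \<le> B" "\<And>x. x \<notin> cball 0 R \<Longrightarrow> g x = 0"
    and d: "d > 0" and B: "B \<ge> 0"
  obtains e0 where "e0 > 0" "\<And>e \<eta>. e < e0 \<Longrightarrow> mollifier e \<eta> \<Longrightarrow> (LINT x|lebesgue. \<bar>conv g \<eta> x - g x\<bar>) \<le> d"
proof -
  define g' where "g' x = max (- B) (min B (g x))" for x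
  have ae: "AE x in lebesgue. g x = g' x" using g(2) by eventually_elim (auto simp: g'_def)
  have m: "g' \<in> borel_measurable lebesgue" unfolding g'_def using g(1) by measurable
  have b: "\<bar>g' x\<bar> \<le> B" for x using B by (auto simp: g'_def)
  have z: "x \<notin> cball 0 R \<Longrightarrow> g' x = 0" for x using g(3) B by (auto simp: g'_def)
  obtain e0 where e0: "e0 > 0"
      "\<And>e \<eta>. e < e0 \<Longrightarrow> mollifier e \<eta> \<Longrightarrow> (LINT x|lebesgue. \<bar>conv g' \<eta> x - g' x\<bar>) \<le> d"
    using conv_L1_approx[OF m b z d] by blast
  have "(LINT x|lebesgue. \<bar>conv g \<eta> x - g x\<bar>) \<le> d" if "e < e0" and \<eta>: "mollifier e \<eta>" for e \<eta>
  proof -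
    have "conv g \<eta> x = conv g' \<eta> x" for x
      unfolding conv_def
    proof (rule integral_cong_AE)
      show "AE y in lebesgue. g y * \<eta> (x - y) = g' y * \<eta> (x - y)" using ae by eventually_elim simp
    qed (use g(1) m mollifierD(7)[OF \<eta>, of x] in \<open>auto dest: borel_measurable_integrable\<close>)
    then have eq: "conv g \<eta> = conv g' \<eta>" by blast
    have "smooth (conv g \<eta>)"
      unfolding eq
    proof (rule conv_smooth[OF _ mollifierD(1)[OF \<eta>] compact_cball[of 0 e] mollifierD(3)[OF \<eta>]])
      show "integrable lebesgue g'"
      proof -
        have "integrable lebesgue (\<lambda>x. (1 * indicator (cball 0 R) x) * g' x)"
          by (rule integrable_bounded_mult[OF integrable_indicator_cball m, of B]) (use b in auto)
        also have "(\<lambda>x. (1 * indicator (cball 0 R) x) * g' x) = g'"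
          using z by (auto simp: fun_eq_iff indicator_def)
        finally show ?thesis .
      qed
    qed
    then have "conv g \<eta> \<in> borel_measurable lebesgue"
      using Ck_imp_continuous by (intro borel_measurable_lebesgue_continuous) blast
    then have "(LINT x|lebesgue. \<bar>conv g \<eta> x - g x\<bar>) = (LINT x|lebesgue. \<bar>conv g' \<eta> x - g' x\<bar>)"
      unfolding eq using g(1) m ae by (intro integral_cong_AE) (auto elim: eventually_mono)
    then show ?thesis using e0(2)[OF that] by simp
  qed
  with e0(1) that show ?thesis by blast
qed

section \<open>The fundamental lemma of the calculus of variations\<close>

text \<open>The convolution is supported in the sum of K and the closed e-ball, which is compact as
  a continuous image of a product of compact sets.\<close>

lemma test_function_conv:
  fixes k :: "'a::euclidean_space \<Rightarrow> real"
  assumes k: "integrable lebesgue k" "\<And>x. x \<notin> K \<Longrightarrow> k x = 0" and K: "compact K"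
    and sub: "(\<Union>x\<in>K. cball x e) \<subseteq> \<Omega>" and \<eta>: "mollifier e \<eta>"
  shows "conv k \<eta> \<in> test_functions \<Omega>"
proof -
  define K' where "K' = (\<lambda>(x, y). x + y) ` (K \<times> cball 0 e)"
  have eq: "K' = (\<Union>x\<in>K. cball x e)"
  proof -
    have "z \<in> K'" if "x \<in> K" "dist x z \<le> e" for x z
      unfolding K'_def using that
      by (intro image_eqI[of _ _ "(x, z - x)"]) (auto simp: dist_norm norm_minus_commute)
    then show ?thesis by (auto simp: K'_def dist_norm)
  qed
  have "compact K'"
    unfolding K'_def by (intro compact_continuous_image compact_Times K compact_cball)
      (auto intro!: continuous_intros simp: case_prod_unfold)
  moreover have "conv k \<eta> x = 0" if "x \<notin> K'" for x
    by (rule conv_zero_outside[OF mollifierD(3)[OF \<eta>] k(2)]) (use that in \<open>auto simp: eq dist_commute not_le[symmetric]\<close>)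
  moreover have "smooth (conv k \<eta>)"
    by (rule conv_smooth[OF k(1) mollifierD(1)[OF \<eta>] compact_cball[of 0 e] mollifierD(3)[OF \<eta>]])
  ultimately show ?thesis
    using sub eq unfolding test_functions_def by blast
qed

text \<open>For small radius the mollification of k is a test function, and it converges to k
  uniformly; integrability of f then passes the vanishing integrals to k.\<close>

lemma lebesgue_on_integral_mult_continuous_zero:
  fixes f :: "'a::euclidean_space \<Rightarrow> real"
  assumes \<Omega>: "open \<Omega>" and f: "integrable (lebesgue_on \<Omega>) f"
    and test: "\<And>\<phi>. \<phi> \<in> test_functions \<Omega> \<Longrightarrow> (LINT x|lebesgue_on \<Omega>. f x * \<phi> x) = 0"
    and k: "continuous_on UNIV k" "compact K" "K \<subseteq> \<Omega>" "\<And>x. x \<notin> K \<Longrightarrow> k x = 0"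
  shows "(LINT x|lebesgue_on \<Omega>. f x * k x) = 0"
proof -
  define I where "I = (LINT x|lebesgue_on \<Omega>. \<bar>f x\<bar>)"
  have I: "I \<ge> 0" by (simp add: I_def)
  obtain R where R: "\<And>x. x \<in> K \<Longrightarrow> norm x \<le> R"
    using compact_imp_bounded[OF k(2)] by (auto simp: bounded_iff)
  have kR: "x \<notin> cball 0 R \<Longrightarrow> k x = 0" for x using k(4) R by auto
  have ik: "integrable lebesgue k" using compact_support_integrable[OF k(1,2,4)] by blast
  obtain r where r: "r > 0" "(\<Union>x\<in>K. cball x r) \<subseteq> \<Omega>"
    using compact_subset_open_imp_cball_epsilon_subset[OF k(2) \<Omega> k(3)] by blast
  have "\<bar>LINT x|lebesgue_on \<Omega>. f x * k x\<bar> \<le> 0 + d" if d: "d > 0" for d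
  proof -
    \<comment> \<open>A uniform error d' costs at most d' times the L^1 norm I of f.\<close>
    define d' where "d' = d / (I + 1)"
    have d': "d' > 0" "d' * I \<le> d" using d I by (auto simp: d'_def field_simps)
    obtain e0 where e0: "e0 > 0" "\<And>e \<eta> x. e < e0 \<Longrightarrow> mollifier e \<eta> \<Longrightarrow> \<bar>conv k \<eta> x - k x\<bar> \<le> d'"
      using conv_uniform[OF k(1) kR d'(1)] by blast
    define e where "e = min r (e0 / 2)"
    have e: "e > 0" "e < e0" "e \<le> r" using r e0 by (auto simp: e_def)
    obtain \<eta> :: "'a \<Rightarrow> real" where \<eta>: "mollifier e \<eta>" using mollifier_exists[OF e(1)] by blast
    have "(\<Union>x\<in>K. cball x e) \<subseteq> \<Omega>" using r(2) e(3) by force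
    then have t: "conv k \<eta> \<in> test_functions \<Omega>"
      using test_function_conv[where K=K, OF ik k(4) k(2) _ \<eta>] by blast
    have ct: "continuous_on UNIV (conv k \<eta>)"
      using t Ck_imp_continuous by (auto simp: test_functions_def)
    obtain M where M: "\<And>x. \<bar>k x\<bar> \<le> M" using compact_support_bounded[OF k(1,2,4)] by blast
    have i1: "integrable (lebesgue_on \<Omega>) (\<lambda>x. f x * k x)"
      by (rule integrable_bounded_mult[OF f borel_measurable_lebesgue_on_continuous[OF k(1)]])
        (use M in auto)
    have i2: "integrable (lebesgue_on \<Omega>) (\<lambda>x. f x * conv k \<eta> x)"
      by (rule integrable_bounded_mult[OF f borel_measurable_lebesgue_on_continuous[OF ct]])
        (use conv_bounded[OF \<eta> ik, of M] M in auto)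
    have "(LINT x|lebesgue_on \<Omega>. f x * k x) = (LINT x|lebesgue_on \<Omega>. f x * k x - f x * conv k \<eta> x)"
      using i1 i2 test[OF t] by simp
    also have "\<bar>\<dots>\<bar> \<le> (LINT x|lebesgue_on \<Omega>. d' * \<bar>f x\<bar>)"
    proof (rule integral_abs_bound[THEN order_trans], rule integral_mono)
      fix x
      have "\<bar>f x * k x - f x * conv k \<eta> x\<bar> = \<bar>f x\<bar> * \<bar>conv k \<eta> x - k x\<bar>"
        by (simp add: abs_mult[symmetric] right_diff_distrib abs_minus_commute)
      also have "\<dots> \<le> \<bar>f x\<bar> * d'" using e0(2)[OF e(2) \<eta>] by (intro mult_left_mono) auto
      finally show "\<bar>f x * k x - f x * conv k \<eta> x\<bar> \<le> d' * \<bar>f x\<bar>" by (simp add: mult.commute)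
    qed (use i1 i2 f in auto)
    also have "\<dots> = d' * I" by (simp add: I_def)
    finally show ?thesis using d' by simp
  qed
  then have "\<bar>LINT x|lebesgue_on \<Omega>. f x * k x\<bar> \<le> 0" by (rule field_le_epsilon)
  then show ?thesis by simp
qed

text \<open>Test with continuous cutoffs of continuous approximations of \<open>f / (1 + \<bar>f\<bar>)\<close>.\<close>

lemma fundamental_lemma:
  fixes f :: "'a::euclidean_space \<Rightarrow> real"
  assumes \<Omega>: "open \<Omega>" "bounded \<Omega>" and f: "integrable (lebesgue_on \<Omega>) f"
    and test: "\<And>\<phi>. \<phi> \<in> test_functions \<Omega> \<Longrightarrow> (LINT x|lebesgue_on \<Omega>. f x * \<phi> x) = 0"
  shows "AE x in lebesgue_on \<Omega>. f x = 0"
proof -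
  have S: "\<Omega> \<in> sets lebesgue" using \<Omega>(1) by simp
  obtain N g where N: "negligible N" and g: "\<And>n. continuous_on UNIV (g n)"
    and lim: "\<And>x. x \<in> \<Omega> \<Longrightarrow> x \<notin> N \<Longrightarrow> (\<lambda>n. g n x) \<longlonglongrightarrow> f x"
  proof -
    have "f measurable_on \<Omega>"
      using measurable_on_iff_borel_measurable[OF S, of f] f by auto
    then obtain N g where "negligible N" "\<And>n. continuous_on UNIV (g n)"
      "\<And>x. x \<notin> N \<Longrightarrow> (\<lambda>n. g n x) \<longlonglongrightarrow> (if x \<in> \<Omega> then f x else 0)"
      unfolding measurable_on_def by blast
    then show ?thesis using that[of N g] by presburger
  qed
  \<comment> \<open>The cutoff vanishes within distance 1/n of the complement and equals 1 beyond
    distance 2/n. In \<open>k\<close>, the map t / (1 + \<bar>t\<bar>) is continuous, bounded by one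
    and keeps the sign of t: the absolute value of f dominates all products, and the limit integrand
    is nonnegative and zero only where f is.\<close>
  define c :: "nat \<Rightarrow> 'a \<Rightarrow> real" where "c n x = max 0 (min 1 (real n * infdist x (- \<Omega>) - 1))" for n x
  define k where "k n x = g n x / (1 + \<bar>g n x\<bar>) * c n x" for n x
  \<comment> \<open>The distance to an empty set is 0 by convention, which would make every cutoff
    vanish; boundedness rules this out.\<close>
  have ne: "- \<Omega> \<noteq> {}" using \<Omega>(2) not_bounded_UNIV by (metis Compl_empty_eq double_complement)
  have c01: "0 \<le> c n x" "c n x \<le> 1" for n x by (auto simp: c_def)
  have gb: "\<bar>g n x / (1 + \<bar>g n x\<bar>)\<bar> \<le> 1" for n x
    by (auto simp: divide_simps abs_if)
  have k1: "\<bar>k n x\<bar> \<le> 1" for n x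
    using mult_mono[OF gb[of n x] c01(2)[of n x]] c01(1)[of n x] by (simp add: k_def abs_mult)
  have kc: "continuous_on UNIV (k n)" for n
    unfolding k_def c_def by (intro continuous_intros g) (auto simp: add_nonneg_eq_0_iff)
  have zero: "(LINT x|lebesgue_on \<Omega>. f x * k n x) = 0" for n
  proof (cases "n = 0")
    case True
    then show ?thesis by (simp add: k_def c_def)
  next
    case False
    define K where "K = {x. 1 / real n \<le> infdist x (- \<Omega>)}"
    have KO: "K \<subseteq> \<Omega>"
    proof
      fix x assume x: "x \<in> K"
      have "0 < 1 / real n" using False by simp
      also have "\<dots> \<le> infdist x (- \<Omega>)" using x by (simp add: K_def)
      finally have "infdist x (- \<Omega>) > 0" .
      then show "x \<in> \<Omega>" using infdist_zero[of x "- \<Omega>"] by (cases "x \<in> \<Omega>") auto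
    qed
    have "closed K" unfolding K_def by (intro closed_Collect_le continuous_intros)
    then have "compact K" using bounded_subset[OF \<Omega>(2) KO] compact_eq_bounded_closed by blast
    moreover have "k n x = 0" if "x \<notin> K" for x
    proof -
      have "real n * infdist x (- \<Omega>) \<le> 1" using that False by (auto simp: K_def field_simps)
      then show ?thesis by (simp add: k_def c_def)
    qed
    ultimately show ?thesis
      by (intro lebesgue_on_integral_mult_continuous_zero[OF \<Omega>(1) f test kc _ KO])
  qed
  have fm: "f \<in> borel_measurable (lebesgue_on \<Omega>)" using f by auto
  have lk: "AE x in lebesgue_on \<Omega>. (\<lambda>n. f x * k n x) \<longlonglongrightarrow> f x * (f x / (1 + \<bar>f x\<bar>))"
  proof -
    have "AE x in lebesgue. x \<notin> N"
      using N by (metis AE_not_in negligible_iff_null_sets)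
    then have "AE x in lebesgue_on \<Omega>. x \<in> \<Omega> \<and> x \<notin> N"
      using S by (subst AE_restrict_space_iff) auto
    then show ?thesis
    proof eventually_elim
      case (elim x)
      have p: "infdist x (- \<Omega>) > 0"
        using elim \<Omega>(1) ne in_closed_iff_infdist_zero[of "- \<Omega>" x] infdist_nonneg[of x "- \<Omega>"]
        by (auto simp: closed_Compl less_le)
      have "filterlim (\<lambda>n. real n * infdist x (- \<Omega>)) at_top sequentially"
        using p by (intro filterlim_at_top_mult_tendsto_pos[OF tendsto_const] filterlim_real_sequentially)
      then have "eventually (\<lambda>n. real n * infdist x (- \<Omega>) \<ge> 2) sequentially"
        by (auto simp: filterlim_at_top)
      then have "eventually (\<lambda>n. c n x = 1) sequentially"
        by eventually_elim (auto simp: c_def)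
      then have "(\<lambda>n. c n x) \<longlonglongrightarrow> 1" by (rule tendsto_eventually)
      moreover have "(\<lambda>n. g n x / (1 + \<bar>g n x\<bar>)) \<longlonglongrightarrow> f x / (1 + \<bar>f x\<bar>)"
        using lim[of x] elim by (intro tendsto_intros) auto
      ultimately have "(\<lambda>n. k n x) \<longlonglongrightarrow> f x / (1 + \<bar>f x\<bar>) * 1"
        unfolding k_def by (intro tendsto_mult)
      then show ?case by (intro tendsto_mult tendsto_const) simp
    qed
  qed
  have dom: "AE x in lebesgue_on \<Omega>. norm (f x * k n x) \<le> \<bar>f x\<bar>" for n
    using k1 by (intro AE_I2) (auto simp: abs_mult mult_left_le)
  have "(\<lambda>n. LINT x|lebesgue_on \<Omega>. f x * k n x) \<longlonglongrightarrow> (LINT x|lebesgue_on \<Omega>. f x * (f x / (1 + \<bar>f x\<bar>)))"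
    by (rule integral_dominated_convergence[OF _ _ integrable_abs[OF f] lk dom])
      (use fm borel_measurable_lebesgue_on_continuous[OF kc] in auto)
  then have "(LINT x|lebesgue_on \<Omega>. f x * (f x / (1 + \<bar>f x\<bar>))) = 0"
    unfolding zero by (simp add: LIMSEQ_const_iff)
  moreover have "integrable (lebesgue_on \<Omega>) (\<lambda>x. f x * (f x / (1 + \<bar>f x\<bar>)))"
    by (rule integrable_bounded_mult[OF f, of _ 1]) (use fm in \<open>auto simp: divide_simps abs_if\<close>)
  ultimately have "AE x in lebesgue_on \<Omega>. f x * (f x / (1 + \<bar>f x\<bar>)) = 0"
    by (subst (asm) integral_nonneg_eq_0_iff_AE) (auto simp: divide_simps)
  then show ?thesis
    by eventually_elim (auto simp: add_nonneg_eq_0_iff)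
qed

section \<open>Calculus of Sobolev functions\<close>

text \<open>The parallelogram identity without its second square. It stands in for the triangle
  inequality throughout: all norm estimates are made on squared norms, at the price of a factor
  2.\<close>

lemma square_norm_add_le:
  fixes a b :: "'b::real_inner"
  shows "(norm (a + b))\<^sup>2 \<le> 2 * (norm a)\<^sup>2 + 2 * (norm b)\<^sup>2"
proof -
  have "(norm (a + b))\<^sup>2 + (norm (a - b))\<^sup>2 = 2 * (norm a)\<^sup>2 + 2 * (norm b)\<^sup>2"
    by (simp add: power2_norm_eq_inner inner_add_left inner_add_right inner_diff_left inner_diff_right)
  then show ?thesis using zero_le_power2[of "norm (a - b)"] by linarith
qed

lemma test_add:
  assumes "\<phi> \<in> test_functions \<Omega>" "\<psi> \<in> test_functions \<Omega>"
  shows "(\<lambda>x. \<phi> x + \<psi> x) \<in> test_functions \<Omega>"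
proof -
  obtain K where K: "compact K" "K \<subseteq> \<Omega>" "\<And>x. x \<notin> K \<Longrightarrow> \<phi> x = 0" "smooth \<phi>"
    using test_functionsD[OF assms(1)] by blast
  obtain L where L: "compact L" "L \<subseteq> \<Omega>" "\<And>x. x \<notin> L \<Longrightarrow> \<psi> x = 0" "smooth \<psi>"
    using test_functionsD[OF assms(2)] by blast
  have "compact (K \<union> L) \<and> K \<union> L \<subseteq> \<Omega> \<and> (\<forall>x. x \<notin> K \<union> L \<longrightarrow> \<phi> x + \<psi> x = 0)"
    using K L by auto
  then show ?thesis unfolding test_functions_def using K(4) L(4) Ck_add by blast
qed

lemma test_mult_smooth:
  assumes "\<phi> \<in> test_functions \<Omega>" "smooth \<psi>"
  shows "(\<lambda>x. \<phi> x * \<psi> x) \<in> test_functions \<Omega>"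
proof -
  obtain K where K: "compact K" "K \<subseteq> \<Omega>" "\<And>x. x \<notin> K \<Longrightarrow> \<phi> x = 0" "smooth \<phi>"
    using test_functionsD[OF assms(1)] by blast
  then have "compact K \<and> K \<subseteq> \<Omega> \<and> (\<forall>x. x \<notin> K \<longrightarrow> \<phi> x * \<psi> x = 0)" by auto
  then show ?thesis unfolding test_functions_def using K(4) assms(2) Ck_mult by blast
qed

text \<open>Abstract in the set, since facts about it are also used for the open pieces cut out of
  the domain by the mesh cells.\<close>

locale bounded_domain =
  fixes \<Omega> :: "'a::euclidean_space set"
  assumes open_domain: "open \<Omega>" and bounded_domain: "bounded \<Omega>"
begin

abbreviation "M \<equiv> lebesgue_on \<Omega>"

lemma sets_domain: "\<Omega> \<in> sets lebesgue"
  using open_domain by simp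

lemma emeasure_domain: "emeasure lebesgue \<Omega> < \<infinity>"
  using emeasure_bounded_finite[OF bounded_domain] open_domain by simp

lemma finite_measure_domain: "finite_measure M"
  by (rule finite_measureI) (use emeasure_domain sets_domain in \<open>simp add: emeasure_restrict_space\<close>)

lemma integrable_const_domain: "integrable M (\<lambda>x. c :: real)"
  using finite_measure.integrable_const[OF finite_measure_domain] .

lemma L2_measurable: "f \<in> L2 \<Omega> \<Longrightarrow> f \<in> borel_measurable M"
  by (simp add: L2_def)

section \<open>Square-integrable functions on a domain of finite measure\<close>

lemma L2_square_integrable: "f \<in> L2 \<Omega> \<Longrightarrow> integrable M (\<lambda>x. (norm (f x))\<^sup>2)"
  by (simp add: L2_def)

lemma L2I_bound:
  fixes f :: "'a \<Rightarrow> 'b::euclidean_space"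
  assumes "f \<in> borel_measurable M" "integrable M h" "AE x in M. (norm (f x))\<^sup>2 \<le> h x"
  shows "f \<in> L2 \<Omega>"
  unfolding L2_def mem_Collect_eq
proof (intro conjI)
  show "integrable M (\<lambda>x. (norm (f x))\<^sup>2)"
  proof (rule Bochner_Integration.integrable_bound[OF assms(2)])
    show "AE x in M. norm ((norm (f x))\<^sup>2) \<le> norm (h x)"
      using assms(3) by eventually_elim auto
  qed (use assms(1) in measurable)
qed (rule assms(1))

lemma L2_add:
  assumes "f \<in> L2 \<Omega>" "g \<in> L2 \<Omega>"
  shows "(\<lambda>x. f x + g x) \<in> L2 \<Omega>"
  by (rule L2I_bound[of _ "\<lambda>x. 2 * (norm (f x))\<^sup>2 + 2 * (norm (g x))\<^sup>2"])
    (use assms[THEN L2_measurable] assms[THEN L2_square_integrable] square_norm_add_le in auto)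

lemma L2_mult_bounded:
  fixes f :: "'a \<Rightarrow> 'b::euclidean_space"
  assumes f: "f \<in> L2 \<Omega>" and s: "s \<in> borel_measurable M" "AE x in M. \<bar>s x\<bar> \<le> B"
  shows "(\<lambda>x. s x *\<^sub>R f x) \<in> L2 \<Omega>"
proof (rule L2I_bound[of _ "\<lambda>x. B\<^sup>2 * (norm (f x))\<^sup>2"])
  show "AE x in M. (norm (s x *\<^sub>R f x))\<^sup>2 \<le> B\<^sup>2 * (norm (f x))\<^sup>2"
    using s(2)
  proof eventually_elim
    case (elim x)
    then have "\<bar>s x\<bar>\<^sup>2 \<le> B\<^sup>2" by (intro power_mono) auto
    then show ?case by (simp add: power_mult_distrib mult_right_mono)
  qed
qed (use L2_measurable[OF f] L2_square_integrable[OF f] s in auto)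

lemma L2_bounded_mult:
  fixes f :: "'a \<Rightarrow> real" and g :: "'a \<Rightarrow> 'b::euclidean_space"
  assumes f: "f \<in> L2 \<Omega>" and g: "g \<in> borel_measurable M" "AE x in M. norm (g x) \<le> B"
  shows "(\<lambda>x. f x *\<^sub>R g x) \<in> L2 \<Omega>"
proof (rule L2I_bound[of _ "\<lambda>x. B\<^sup>2 * (norm (f x))\<^sup>2"])
  show "AE x in M. (norm (f x *\<^sub>R g x))\<^sup>2 \<le> B\<^sup>2 * (norm (f x))\<^sup>2"
    using g(2)
  proof eventually_elim
    case (elim x)
    then have "(norm (g x))\<^sup>2 \<le> B\<^sup>2" by (intro power_mono) auto
    then show ?case using mult_left_mono[of "(norm (g x))\<^sup>2" "B\<^sup>2" "(f x)\<^sup>2"]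
      by (simp add: power_mult_distrib mult.commute)
  qed
qed (use L2_measurable[OF f] L2_square_integrable[OF f] g in auto)

lemma L2_scaleR:
  fixes f :: "'a \<Rightarrow> 'b::euclidean_space"
  assumes f: "f \<in> L2 \<Omega>"
  shows "(\<lambda>x. c *\<^sub>R f x) \<in> L2 \<Omega>"
  using L2_mult_bounded[OF f, of "\<lambda>x. c" "\<bar>c\<bar>"] by simp

lemma L2_diff:
  fixes f :: "'a \<Rightarrow> 'b::euclidean_space"
  assumes "f \<in> L2 \<Omega>" "g \<in> L2 \<Omega>"
  shows "(\<lambda>x. f x - g x) \<in> L2 \<Omega>"
  using L2_add[OF assms(1) L2_scaleR[OF assms(2), of "-1"]] by simp

lemma L2_inner_integrable:
  fixes f g :: "'a \<Rightarrow> 'b::euclidean_space"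
  assumes "f \<in> L2 \<Omega>" "g \<in> L2 \<Omega>"
  shows "integrable M (\<lambda>x. f x \<bullet> g x)"
proof (rule Bochner_Integration.integrable_bound)
  show "integrable M (\<lambda>x. (norm (f x))\<^sup>2 + (norm (g x))\<^sup>2)"
    using assms[THEN L2_square_integrable] by simp
  show "(\<lambda>x. f x \<bullet> g x) \<in> borel_measurable M"
    using assms[THEN L2_measurable] by measurable
  have "\<bar>f x \<bullet> g x\<bar> \<le> (norm (f x))\<^sup>2 + (norm (g x))\<^sup>2" for x
  proof -
    have "\<bar>f x \<bullet> g x\<bar> \<le> norm (f x) * norm (g x)" by (rule Cauchy_Schwarz_ineq2)
    also have "\<dots> \<le> (norm (f x))\<^sup>2 + (norm (g x))\<^sup>2"
    proof -
      have "2 * (norm (f x) * norm (g x)) \<le> (norm (f x))\<^sup>2 + (norm (g x))\<^sup>2"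
        using sum_squares_bound[of "norm (f x)" "norm (g x)"] by (simp only: mult.assoc)
      moreover have "0 \<le> norm (f x) * norm (g x)" by simp
      ultimately show ?thesis by linarith
    qed
    finally show ?thesis .
  qed
  then show "AE x in M. norm (f x \<bullet> g x) \<le> norm ((norm (f x))\<^sup>2 + (norm (g x))\<^sup>2)"
    by (intro AE_I2) simp
qed

lemma L2_mult_integrable:
  fixes f g :: "'a \<Rightarrow> real"
  shows "f \<in> L2 \<Omega> \<Longrightarrow> g \<in> L2 \<Omega> \<Longrightarrow> integrable M (\<lambda>x. f x * g x)"
  using L2_inner_integrable[of f g] by simp

lemma L2_bounded:
  fixes g :: "'a \<Rightarrow> 'b::euclidean_space"
  assumes "g \<in> borel_measurable M" "AE x in M. norm (g x) \<le> B"
  shows "g \<in> L2 \<Omega>"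
proof (rule L2I_bound[OF assms(1) integrable_const_domain])
  show "AE x in M. (norm (g x))\<^sup>2 \<le> B\<^sup>2"
    using assms(2) by eventually_elim (simp add: power_mono)
qed

lemma L2_const: "(\<lambda>x. c) \<in> L2 \<Omega>"
  by (rule L2_bounded[of _ "norm c"]) auto

lemma L2_integrable:
  fixes f :: "'a \<Rightarrow> real"
  shows "f \<in> L2 \<Omega> \<Longrightarrow> integrable M f"
  using L2_mult_integrable[OF _ L2_const[of 1], of f] by simp

lemma L2_component:
  fixes g :: "'a \<Rightarrow> 'a"
  assumes g: "g \<in> L2 \<Omega>" and i: "i \<in> Basis"
  shows "(\<lambda>x. g x \<bullet> i) \<in> L2 \<Omega>"
proof (rule L2I_bound[OF _ L2_square_integrable[OF g]])
  show "AE x in M. (norm (g x \<bullet> i))\<^sup>2 \<le> (norm (g x))\<^sup>2"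
    by (intro AE_I2 power_mono) (use Basis_le_norm[OF i] in auto)
qed (use L2_measurable[OF g] in measurable)

text \<open>The pointwise bound t \<le> e + t^2 / e plays the part of the Cauchy-Schwarz inequality:
  integrated over a set of finite measure, it turns a small L^2 norm into a small L^1 norm.\<close>

lemma integral_abs_small:
  assumes f: "f \<in> L2 \<Omega>" and le: "(LINT x|M. (norm (f x))\<^sup>2) \<le> e\<^sup>2" and e: "e > 0"
  shows "(LINT x|M. norm (f x)) \<le> e * (measure M \<Omega> + 1)"
proof -
  have m: "norm t \<le> e + (norm t)\<^sup>2 / e" for t :: 'b
  proof (cases "norm t \<le> e")
    case False
    then have "norm t * e \<le> norm t * norm t" by (intro mult_left_mono) auto
    then show ?thesis using e by (simp add: field_simps power2_eq_square add_nonneg_pos)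
        (smt (verit) e mult_pos_pos)
  qed (use e in \<open>simp add: add_increasing2\<close>)
  have i: "integrable M (\<lambda>x. e + (norm (f x))\<^sup>2 / e)"
    using L2_square_integrable[OF f] integrable_const_domain by simp
  have "integrable M (\<lambda>x. norm (f x))"
    by (rule Bochner_Integration.integrable_bound[OF i])
      (use L2_measurable[OF f] m e in \<open>auto simp: abs_of_nonneg\<close>)
  then have "(LINT x|M. norm (f x)) \<le> (LINT x|M. e + (norm (f x))\<^sup>2 / e)"
    using i m by (rule integral_mono)
  also have "\<dots> = e * measure M \<Omega> + (LINT x|M. (norm (f x))\<^sup>2) / e"
    using L2_square_integrable[OF f] integrable_const_domain by (simp add: mult.commute)
  also have "\<dots> \<le> e * measure M \<Omega> + e"
    using le e by (simp add: field_simps power2_eq_square)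
  finally show ?thesis by (simp add: algebra_simps)
qed

section \<open>Test functions and weak gradients\<close>

lemma test_function_facts:
  assumes "\<phi> \<in> test_functions \<Omega>"
  shows "smooth \<phi>" "\<phi> \<in> L2 \<Omega>" "grad \<phi> \<in> L2 \<Omega>"
    "\<phi> \<in> borel_measurable M" "grad \<phi> \<in> borel_measurable M"
    "\<exists>B>0. \<forall>x. \<bar>\<phi> x\<bar> \<le> B \<and> norm (grad \<phi> x) \<le> B"
proof -
  obtain K where K: "compact K" "K \<subseteq> \<Omega>" "\<And>x. x \<notin> K \<Longrightarrow> \<phi> x = 0" and s: "smooth \<phi>"
    using test_functionsD[OF assms] by blast
  show "smooth \<phi>" by fact
  have c: "continuous_on UNIV \<phi>" "continuous_on UNIV (grad \<phi>)"
    using Ck_imp_continuous[of 1 \<phi>] grad_continuous[of \<phi>] s by auto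
  show m: "\<phi> \<in> borel_measurable M" "grad \<phi> \<in> borel_measurable M"
    using c by (auto intro: borel_measurable_lebesgue_on_continuous)
  obtain B where B: "B > 0" "\<And>x. \<bar>\<phi> x\<bar> \<le> B"
    using compact_support_bounded[OF c(1) K(1,3)] by blast
  obtain L where L: "L > 0" "\<And>x. norm (grad \<phi> x) \<le> L"
    using compact_support_grad_bounded[OF smooth_1[OF s] K(1,3)] by blast
  show "\<phi> \<in> L2 \<Omega>" "grad \<phi> \<in> L2 \<Omega>"
    using m B(2) L(2) by (auto intro!: L2_bounded AE_I2)
  show "\<exists>B>0. \<forall>x. \<bar>\<phi> x\<bar> \<le> B \<and> norm (grad \<phi> x) \<le> B"
    using B L by (intro exI[of _ "max B L"]) (auto simp: le_max_iff_disj)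
qed

lemma test_partial_L2:
  assumes "\<phi> \<in> test_functions \<Omega>" "i \<in> Basis"
  shows "partial i \<phi> \<in> L2 \<Omega>"
  using L2_component[OF test_function_facts(3)[OF assms(1)] assms(2)] assms(2) by simp

lemma has_weak_gradD:
  assumes "has_weak_grad \<Omega> u g" "\<phi> \<in> test_functions \<Omega>" "i \<in> Basis"
  shows "(LINT x|M. u x * partial i \<phi> x) = - (LINT x|M. (g x \<bullet> i) * \<phi> x)"
  using assms by (simp add: has_weak_grad_def)

text \<open>Each component of the difference integrates to zero against all test functions, so the
  fundamental lemma applies. This is what gives the chosen representative \<open>weak_grad\<close> a
  meaning.\<close>

lemma weak_grad_unique:
  assumes g: "g \<in> L2 \<Omega>" "has_weak_grad \<Omega> u g" and g': "g' \<in> L2 \<Omega>" "has_weak_grad \<Omega> u g'"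
  shows "AE x in M. g x = g' x"
proof -
  have "AE x in M. g x \<bullet> i - g' x \<bullet> i = 0" if i: "i \<in> Basis" for i
  proof (rule fundamental_lemma[OF open_domain bounded_domain])
    note L = L2_component[OF g(1) i] L2_component[OF g'(1) i]
    show "integrable M (\<lambda>x. g x \<bullet> i - g' x \<bullet> i)"
      using L[THEN L2_integrable] by simp
    fix \<phi> assume p: "\<phi> \<in> test_functions \<Omega>"
    have "(LINT x|M. (g x \<bullet> i) * \<phi> x) = (LINT x|M. (g' x \<bullet> i) * \<phi> x)"
      using has_weak_gradD[OF g(2) p i] has_weak_gradD[OF g'(2) p i] by simp
    then show "(LINT x|M. (g x \<bullet> i - g' x \<bullet> i) * \<phi> x) = 0"
      using L[THEN L2_mult_integrable[OF _ test_function_facts(2)[OF p]]]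
      by (simp add: left_diff_distrib)
  qed
  then have "AE x in M. \<forall>i\<in>Basis. g x \<bullet> i - g' x \<bullet> i = 0"
    by (intro AE_finite_allI) auto
  then show ?thesis
    by eventually_elim (auto intro: euclidean_eqI)
qed

lemma H1D:
  assumes "u \<in> H1 \<Omega>"
  shows "u \<in> L2 \<Omega>" "weak_grad \<Omega> u \<in> L2 \<Omega>" "has_weak_grad \<Omega> u (weak_grad \<Omega> u)"
proof -
  obtain g where g: "g \<in> L2 \<Omega> \<and> has_weak_grad \<Omega> u g" and u: "u \<in> L2 \<Omega>"
    using assms by (auto simp: H1_def)
  have "weak_grad \<Omega> u \<in> L2 \<Omega> \<and> has_weak_grad \<Omega> u (weak_grad \<Omega> u)"
    unfolding weak_grad_def by (rule someI[of _ g]) (rule g)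
  then show "u \<in> L2 \<Omega>" "weak_grad \<Omega> u \<in> L2 \<Omega>" "has_weak_grad \<Omega> u (weak_grad \<Omega> u)"
    using u by auto
qed

text \<open>The way weak gradients are computed below: exhibiting one candidate also identifies the
  chosen representative almost everywhere.\<close>

lemma H1I:
  assumes "u \<in> L2 \<Omega>" "g \<in> L2 \<Omega>" "has_weak_grad \<Omega> u g"
  shows "u \<in> H1 \<Omega>" "AE x in M. weak_grad \<Omega> u x = g x"
proof -
  show u: "u \<in> H1 \<Omega>" using assms by (auto simp: H1_def)
  show "AE x in M. weak_grad \<Omega> u x = g x"
    using weak_grad_unique[OF H1D(2,3)[OF u] assms(2,3)] .
qed

lemma H1_add:
  assumes u: "u \<in> H1 \<Omega>" and v: "v \<in> H1 \<Omega>"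
  shows "(\<lambda>x. u x + v x) \<in> H1 \<Omega>"
    "AE x in M. weak_grad \<Omega> (\<lambda>x. u x + v x) x = weak_grad \<Omega> u x + weak_grad \<Omega> v x"
proof -
  note U = H1D[OF u] and V = H1D[OF v]
  have "has_weak_grad \<Omega> (\<lambda>x. u x + v x) (\<lambda>x. weak_grad \<Omega> u x + weak_grad \<Omega> v x)"
    unfolding has_weak_grad_def
  proof (intro ballI)
    fix \<phi> :: "'a \<Rightarrow> real" and i :: 'a assume p: "\<phi> \<in> test_functions \<Omega>" and i: "i \<in> Basis"
    note 1 = L2_mult_integrable[OF _ test_partial_L2[OF p i]]
    note 2 = L2_mult_integrable[OF L2_component[OF _ i] test_function_facts(2)[OF p]]
    show "(LINT x|M. (u x + v x) * partial i \<phi> x)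
        = - (LINT x|M. ((weak_grad \<Omega> u x + weak_grad \<Omega> v x) \<bullet> i) * \<phi> x)"
      using has_weak_gradD[OF U(3) p i] has_weak_gradD[OF V(3) p i]
        1[OF U(1)] 1[OF V(1)] 2[OF U(2)] 2[OF V(2)]
      by (simp add: distrib_right inner_add_left)
  qed
  from H1I[OF L2_add[OF U(1) V(1)] L2_add[OF U(2) V(2)] this]
  show "(\<lambda>x. u x + v x) \<in> H1 \<Omega>"
    "AE x in M. weak_grad \<Omega> (\<lambda>x. u x + v x) x = weak_grad \<Omega> u x + weak_grad \<Omega> v x" by auto
qed

lemma H1_cmult:
  assumes u: "u \<in> H1 \<Omega>"
  shows "(\<lambda>x. c * u x) \<in> H1 \<Omega>"
    "AE x in M. weak_grad \<Omega> (\<lambda>x. c * u x) x = c *\<^sub>R weak_grad \<Omega> u x"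
proof -
  note U = H1D[OF u]
  have "has_weak_grad \<Omega> (\<lambda>x. c * u x) (\<lambda>x. c *\<^sub>R weak_grad \<Omega> u x)"
    unfolding has_weak_grad_def
    using has_weak_gradD[OF U(3)] by (auto simp: mult.assoc)
  from H1I[OF L2_scaleR[OF U(1), of c, simplified] L2_scaleR[OF U(2)] this]
  show "(\<lambda>x. c * u x) \<in> H1 \<Omega>"
    "AE x in M. weak_grad \<Omega> (\<lambda>x. c * u x) x = c *\<^sub>R weak_grad \<Omega> u x" by auto
qed

lemma H1_diff:
  assumes u: "u \<in> H1 \<Omega>" and v: "v \<in> H1 \<Omega>"
  shows "(\<lambda>x. u x - v x) \<in> H1 \<Omega>"
    "AE x in M. weak_grad \<Omega> (\<lambda>x. u x - v x) x = weak_grad \<Omega> u x - weak_grad \<Omega> v x"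
proof -
  have eq: "(\<lambda>x. u x - v x) = (\<lambda>x. u x + (- 1) * v x)" by simp
  note C = H1_cmult[OF v, of "-1"]
  show "(\<lambda>x. u x - v x) \<in> H1 \<Omega>" unfolding eq by (rule H1_add(1)[OF u C(1)])
  show "AE x in M. weak_grad \<Omega> (\<lambda>x. u x - v x) x = weak_grad \<Omega> u x - weak_grad \<Omega> v x"
    unfolding eq using H1_add(2)[OF u C(1)] C(2) by eventually_elim simp
qed

lemma test_H1:
  assumes p: "\<phi> \<in> test_functions \<Omega>"
  shows "\<phi> \<in> H1 \<Omega>" "AE x in M. weak_grad \<Omega> \<phi> x = grad \<phi> x"
proof -
  have "has_weak_grad \<Omega> \<phi> (grad \<phi>)"
    unfolding has_weak_grad_def
  proof (intro ballI)
    fix \<psi> :: "'a \<Rightarrow> real" and i :: 'a assume q: "\<psi> \<in> test_functions \<Omega>" and i: "i \<in> Basis"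
    obtain K where K: "compact K" "K \<subseteq> \<Omega>" "\<And>x. x \<notin> K \<Longrightarrow> \<psi> x = 0" "smooth \<psi>"
      using test_functionsD[OF q] by blast
    from integral_by_parts[OF smooth_1[OF test_function_facts(1)[OF p]] smooth_1[OF K(4)]
        K(1-3) i sets_domain]
    show "(LINT x|M. \<phi> x * partial i \<psi> x) = - (LINT x|M. (grad \<phi> x \<bullet> i) * \<psi> x)"
      using i by simp
  qed
  from H1I[OF test_function_facts(2,3)[OF p] this]
  show "\<phi> \<in> H1 \<Omega>" "AE x in M. weak_grad \<Omega> \<phi> x = grad \<phi> x" by auto
qed

section \<open>The Sobolev norm\<close>

lemma H1_norm_square:
  "(H1_norm \<Omega> u)\<^sup>2 = (LINT x|M. (u x)\<^sup>2) + (LINT x|M. (norm (weak_grad \<Omega> u x))\<^sup>2)"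
  unfolding H1_norm_def by (simp add: integral_nonneg_AE)

lemma H1_norm_nonneg: "H1_norm \<Omega> u \<ge> 0"
  unfolding H1_norm_def by (simp add: integral_nonneg_AE)

lemma H1_norm_ge:
  "(LINT x|M. (u x)\<^sup>2) \<le> (H1_norm \<Omega> u)\<^sup>2"
  "(LINT x|M. (norm (weak_grad \<Omega> u x))\<^sup>2) \<le> (H1_norm \<Omega> u)\<^sup>2"
  unfolding H1_norm_square by (auto simp: integral_nonneg_AE)

text \<open>The sum is a separate function h because the chosen gradient of a sum agrees with the
  sum of the chosen gradients only almost everywhere.\<close>

lemma L2_norm_add_le:
  fixes f g :: "'a \<Rightarrow> 'b::euclidean_space"
  assumes f: "f \<in> L2 \<Omega>" and g: "g \<in> L2 \<Omega>" and h: "h \<in> L2 \<Omega>" "AE x in M. h x = f x + g x"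
  shows "(LINT x|M. (norm (h x))\<^sup>2) \<le> 2 * (LINT x|M. (norm (f x))\<^sup>2) + 2 * (LINT x|M. (norm (g x))\<^sup>2)"
proof -
  have "(LINT x|M. (norm (h x))\<^sup>2) \<le> (LINT x|M. 2 * (norm (f x))\<^sup>2 + 2 * (norm (g x))\<^sup>2)"
  proof (rule integral_mono_AE)
    show "AE x in M. (norm (h x))\<^sup>2 \<le> 2 * (norm (f x))\<^sup>2 + 2 * (norm (g x))\<^sup>2"
      using h(2) by eventually_elim (simp add: square_norm_add_le)
  qed (use L2_square_integrable[OF f] L2_square_integrable[OF g] L2_square_integrable[OF h(1)] in auto)
  then show ?thesis using L2_square_integrable[OF f] L2_square_integrable[OF g] by simp
qed

lemma H1_norm_add:
  assumes u: "u \<in> H1 \<Omega>" and v: "v \<in> H1 \<Omega>"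
  shows "(H1_norm \<Omega> (\<lambda>x. u x + v x))\<^sup>2 \<le> 2 * (H1_norm \<Omega> u)\<^sup>2 + 2 * (H1_norm \<Omega> v)\<^sup>2"
proof -
  have *: "a \<le> 2 * b + 2 * c \<Longrightarrow> d \<le> 2 * e + 2 * f \<Longrightarrow> a + d \<le> 2 * (b + e) + 2 * (c + f)"
    for a b c d e f :: real by simp
  show ?thesis
    unfolding H1_norm_square
    using L2_norm_add_le[OF H1D(1)[OF u] H1D(1)[OF v] H1D(1)[OF H1_add(1)[OF u v]] AE_I2[OF refl]]
      L2_norm_add_le[OF H1D(2)[OF u] H1D(2)[OF v] H1D(2)[OF H1_add(1)[OF u v]] H1_add(2)[OF u v]]
    unfolding real_norm_def power2_abs by (rule *)
qed

lemma H1_norm_cong_AE: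
  assumes u: "u \<in> H1 \<Omega>" and f: "f \<in> L2 \<Omega>" "AE x in M. u x = f x"
    and g: "g \<in> L2 \<Omega>" "AE x in M. weak_grad \<Omega> u x = g x"
  shows "(H1_norm \<Omega> u)\<^sup>2 = (LINT x|M. (f x)\<^sup>2) + (LINT x|M. (norm (g x))\<^sup>2)"
proof -
  note m = L2_measurable[OF H1D(1)[OF u]] L2_measurable[OF H1D(2)[OF u]]
    L2_measurable[OF f(1)] L2_measurable[OF g(1)]
  have "(LINT x|M. (u x)\<^sup>2) = (LINT x|M. (f x)\<^sup>2)"
  proof (rule integral_cong_AE)
    show "AE x in M. (u x)\<^sup>2 = (f x)\<^sup>2" using f(2) by eventually_elim simp
  qed (use m in auto)
  moreover have "(LINT x|M. (norm (weak_grad \<Omega> u x))\<^sup>2) = (LINT x|M. (norm (g x))\<^sup>2)"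
  proof (rule integral_cong_AE)
    show "AE x in M. (norm (weak_grad \<Omega> u x))\<^sup>2 = (norm (g x))\<^sup>2" using g(2) by eventually_elim simp
  qed (use m in auto)
  ultimately show ?thesis by (simp add: H1_norm_square)
qed

lemma H1_norm_cmult:
  assumes u: "u \<in> H1 \<Omega>"
  shows "H1_norm \<Omega> (\<lambda>x. c * u x) = \<bar>c\<bar> * H1_norm \<Omega> u"
proof -
  note C = H1_cmult[OF u, of c]
  have "(H1_norm \<Omega> (\<lambda>x. c * u x))\<^sup>2 = (\<bar>c\<bar> * H1_norm \<Omega> u)\<^sup>2"
    using H1_norm_cong_AE[OF C(1) H1D(1)[OF C(1)] AE_I2[OF refl] L2_scaleR[OF H1D(2)[OF u]] C(2)]
    by (simp add: power_mult_distrib H1_norm_square distrib_left)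
  then show ?thesis by (simp add: H1_norm_nonneg power2_eq_iff_nonneg)
qed

lemma H1_norm_eq_0:
  assumes u: "u \<in> H1 \<Omega>" and z: "H1_norm \<Omega> u = 0"
  shows "AE x in M. u x = 0" "AE x in M. weak_grad \<Omega> u x = 0"
proof -
  have "(LINT x|M. (norm (u x))\<^sup>2) = 0" "(LINT x|M. (norm (weak_grad \<Omega> u x))\<^sup>2) = 0"
    using H1_norm_ge[of u] z by (auto intro!: antisym integral_nonneg_AE)
  then show "AE x in M. u x = 0" "AE x in M. weak_grad \<Omega> u x = 0"
    using integral_nonneg_eq_0_iff_AE[OF L2_square_integrable[OF H1D(1)[OF u]]]
      integral_nonneg_eq_0_iff_AE[OF L2_square_integrable[OF H1D(2)[OF u]]] by auto
qed

text \<open>The zero field is a weak gradient of a null function, since every integral against it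
  vanishes. Null functions are thus invisible to anything bounded in the norm.\<close>

lemma H1_norm_AE_0:
  assumes u: "u \<in> H1 \<Omega>" and z: "AE x in M. u x = 0"
  shows "H1_norm \<Omega> u = 0"
proof -
  have "has_weak_grad \<Omega> u (\<lambda>x. 0)"
    unfolding has_weak_grad_def
  proof (intro ballI)
    fix \<phi> :: "'a \<Rightarrow> real" and i :: 'a
    have "(LINT x|M. u x * partial i \<phi> x) = 0"
      by (rule integral_eq_zero_AE) (use z in \<open>eventually_elim, simp\<close>)
    then show "(LINT x|M. u x * partial i \<phi> x) = - (LINT x|M. (0 \<bullet> i) * \<phi> x)" by simp
  qed
  from H1I(2)[OF H1D(1)[OF u] L2_const this]
  show ?thesis
    using H1_norm_cong_AE[OF u L2_const z L2_const[of 0]] by simp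
qed

section \<open>The closure of the test functions\<close>

lemma H10_H1: "u \<in> H10 \<Omega> \<Longrightarrow> u \<in> H1 \<Omega>"
  by (simp add: H10_def)

lemma H10_approx:
  "u \<in> H10 \<Omega> \<Longrightarrow> e > 0 \<Longrightarrow> \<exists>\<phi>\<in>test_functions \<Omega>. H1_norm \<Omega> (\<lambda>x. u x - \<phi> x) < e"
  by (simp add: H10_def)

text \<open>A limit of elements of \<open>H10\<close> is again a limit of test functions. The halves
  of e fit the factor 2 in the squared norm inequality: 2 (e/2)^2 + 2 (e/2)^2 = e^2.\<close>

lemma H10_closed:
  assumes u: "u \<in> H1 \<Omega>" and v: "\<And>e. e > 0 \<Longrightarrow> \<exists>v\<in>H10 \<Omega>. H1_norm \<Omega> (\<lambda>x. u x - v x) < e"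
  shows "u \<in> H10 \<Omega>"
  unfolding H10_def mem_Collect_eq
proof (intro conjI allI impI u)
  fix e :: real assume e: "e > 0"
  then obtain v where v: "v \<in> H10 \<Omega>" "H1_norm \<Omega> (\<lambda>x. u x - v x) < e / 2" using v[of "e / 2"] by auto
  obtain \<phi> where p: "\<phi> \<in> test_functions \<Omega>" "H1_norm \<Omega> (\<lambda>x. v x - \<phi> x) < e / 2"
    using H10_approx[OF v(1), of "e / 2"] e by auto
  have sq: "(H1_norm \<Omega> w)\<^sup>2 < (e / 2)\<^sup>2" if "H1_norm \<Omega> w < e / 2" for w
    using that H1_norm_nonneg by (intro power_strict_mono) auto
  have "(H1_norm \<Omega> (\<lambda>x. (u x - v x) + (v x - \<phi> x)))\<^sup>2
      \<le> 2 * (H1_norm \<Omega> (\<lambda>x. u x - v x))\<^sup>2 + 2 * (H1_norm \<Omega> (\<lambda>x. v x - \<phi> x))\<^sup>2"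
    by (intro H1_norm_add H1_diff u H10_H1 v test_H1 p)
  also have "\<dots> < e\<^sup>2"
    using sq[OF v(2)] sq[OF p(2)] by (simp add: power_divide)
  finally have "(H1_norm \<Omega> (\<lambda>x. u x - \<phi> x))\<^sup>2 < e\<^sup>2" by simp
  then have "H1_norm \<Omega> (\<lambda>x. u x - \<phi> x) < e"
    using e by (auto intro: power_less_imp_less_base)
  with p(1) show "\<exists>\<phi>\<in>test_functions \<Omega>. H1_norm \<Omega> (\<lambda>x. u x - \<phi> x) < e" by blast
qed

lemma zero_H1: "(\<lambda>x. 0) \<in> H1 \<Omega>"
  by (rule H1I(1)[OF L2_const L2_const[of 0]]) (simp add: has_weak_grad_def)

lemma test_H10: "\<phi> \<in> test_functions \<Omega> \<Longrightarrow> \<phi> \<in> H10 \<Omega>"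
  using test_H1(1) H1_norm_AE_0[OF zero_H1] by (auto simp: H10_def intro!: bexI[of _ \<phi>])

lemma H10_add:
  assumes u: "u \<in> H10 \<Omega>" and v: "v \<in> H10 \<Omega>"
  shows "(\<lambda>x. u x + v x) \<in> H10 \<Omega>"
proof (rule H10_closed)
  show "(\<lambda>x. u x + v x) \<in> H1 \<Omega>" by (intro H1_add H10_H1 u v)
  fix e :: real assume e: "e > 0"
  obtain \<phi> where p: "\<phi> \<in> test_functions \<Omega>" "H1_norm \<Omega> (\<lambda>x. u x - \<phi> x) < e / 2"
    using H10_approx[OF u, of "e / 2"] e by auto
  obtain \<psi> where q: "\<psi> \<in> test_functions \<Omega>" "H1_norm \<Omega> (\<lambda>x. v x - \<psi> x) < e / 2"
    using H10_approx[OF v, of "e / 2"] e by auto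
  have sq: "(H1_norm \<Omega> w)\<^sup>2 < (e / 2)\<^sup>2" if "H1_norm \<Omega> w < e / 2" for w
    using that H1_norm_nonneg by (intro power_strict_mono) auto
  have "(H1_norm \<Omega> (\<lambda>x. (u x - \<phi> x) + (v x - \<psi> x)))\<^sup>2
      \<le> 2 * (H1_norm \<Omega> (\<lambda>x. u x - \<phi> x))\<^sup>2 + 2 * (H1_norm \<Omega> (\<lambda>x. v x - \<psi> x))\<^sup>2"
    by (intro H1_norm_add H1_diff H10_H1 u v test_H1 p q)
  also have "\<dots> < e\<^sup>2"
    using sq[OF p(2)] sq[OF q(2)] by (simp add: power_divide)
  finally have "H1_norm \<Omega> (\<lambda>x. (u x - \<phi> x) + (v x - \<psi> x)) < e"
    using e by (auto intro: power_less_imp_less_base)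
  then have "H1_norm \<Omega> (\<lambda>x. (u x + v x) - (\<phi> x + \<psi> x)) < e"
    by (simp add: algebra_simps)
  then show "\<exists>w\<in>H10 \<Omega>. H1_norm \<Omega> (\<lambda>x. (u x + v x) - w x) < e"
    using test_H10[OF test_add[OF p(1) q(1)]] by (intro bexI[of _ "\<lambda>x. \<phi> x + \<psi> x"])
qed

lemma H10_cmult:
  assumes u: "u \<in> H10 \<Omega>"
  shows "(\<lambda>x. c * u x) \<in> H10 \<Omega>"
proof (rule H10_closed)
  show "(\<lambda>x. c * u x) \<in> H1 \<Omega>" by (intro H1_cmult H10_H1 u)
  fix e :: real assume e: "e > 0"
  obtain \<phi> where p: "\<phi> \<in> test_functions \<Omega>" "H1_norm \<Omega> (\<lambda>x. u x - \<phi> x) < e / (\<bar>c\<bar> + 1)"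
    using H10_approx[OF u, of "e / (\<bar>c\<bar> + 1)"] e by auto
  have "H1_norm \<Omega> (\<lambda>x. c * (u x - \<phi> x)) = \<bar>c\<bar> * H1_norm \<Omega> (\<lambda>x. u x - \<phi> x)"
    by (intro H1_norm_cmult H1_diff H10_H1 u test_H1 p)
  also have "\<dots> \<le> (\<bar>c\<bar> + 1) * H1_norm \<Omega> (\<lambda>x. u x - \<phi> x)"
    by (intro mult_right_mono H1_norm_nonneg) auto
  also have "\<dots> < e" using p(2) by (simp add: field_simps add_nonneg_pos)
  finally have "H1_norm \<Omega> (\<lambda>x. c * u x - \<phi> x * c) < e" by (simp add: algebra_simps)
  moreover have "(\<lambda>x. \<phi> x * c) \<in> test_functions \<Omega>"
    using test_mult_smooth[OF p(1)] Ck_const by blast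
  ultimately show "\<exists>w\<in>H10 \<Omega>. H1_norm \<Omega> (\<lambda>x. c * u x - w x) < e"
    using test_H10 by (intro bexI[of _ "\<lambda>x. \<phi> x * c"]) auto
qed

lemma H10_diff:
  assumes u: "u \<in> H10 \<Omega>" and v: "v \<in> H10 \<Omega>"
  shows "(\<lambda>x. u x - v x) \<in> H10 \<Omega>"
  using H10_add[OF u H10_cmult[OF v, of "-1"]] by simp

section \<open>The Poincare inequality\<close>

text \<open>In one coordinate direction e, the function \<open>x \<bullet> e\<close> has derivative
  1, so the integral of \<phi>^2 equals minus that of (x \<bullet> e) 2 \<phi> times the derivative
  of \<phi>. As the coordinate is bounded by R, half of the integral of \<phi>^2 can be absorbed on
  the left, which yields 4 R^2.\<close>

lemma poincare_test:
  assumes p: "\<phi> \<in> test_functions \<Omega>" and R: "\<And>x. x \<in> \<Omega> \<Longrightarrow> norm x \<le> R" "R > 0"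
  shows "(LINT x|M. (\<phi> x)\<^sup>2) \<le> 4 * R\<^sup>2 * (LINT x|M. (norm (grad \<phi> x))\<^sup>2)"
proof -
  obtain e :: 'a where e: "e \<in> Basis" using nonempty_Basis by blast
  obtain K where K: "compact K" "K \<subseteq> \<Omega>" "\<And>x. x \<notin> K \<Longrightarrow> \<phi> x = 0" "smooth \<phi>"
    using test_functionsD[OF p] by blast
  note s = smooth_1[OF K(4)]
  note L = test_function_facts(2,3)[OF p]
  have ip: "integrable M (\<lambda>x. (\<phi> x)\<^sup>2)" "integrable M (\<lambda>x. (norm (grad \<phi> x))\<^sup>2)"
    using L[THEN L2_square_integrable] by auto
  have pe: "partial e (\<lambda>x. x \<bullet> e) = (\<lambda>x. 1)"
  proof
    fix x :: 'a
    have "((\<lambda>x. x \<bullet> e) has_derivative (\<lambda>h. h \<bullet> e)) (at x)"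
      by (auto intro!: derivative_eq_intros)
    from partial_eq[OF this, of e] show "partial e (\<lambda>x. x \<bullet> e) x = 1"
      using e by simp
  qed
  have ps: "partial e (\<lambda>x. \<phi> x * \<phi> x) = (\<lambda>x. 2 * (\<phi> x * partial e \<phi> x))"
    using s by (intro ext) (simp add: partial_mult)
  have "(LINT x|M. (x \<bullet> e) * partial e (\<lambda>x. \<phi> x * \<phi> x) x)
      = - (LINT x|M. partial e (\<lambda>x. x \<bullet> e) x * (\<phi> x * \<phi> x))"
    by (rule integral_by_parts[OF Ck_inner Ck_mult[OF s s] K(1,2) _ e sets_domain]) (use K(3) in auto)
  then have "(LINT x|M. (\<phi> x)\<^sup>2) = - (LINT x|M. (x \<bullet> e) * (2 * (\<phi> x * partial e \<phi> x)))"
    unfolding pe ps by (simp add: power2_eq_square)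
  also have "\<dots> \<le> (LINT x|M. (\<phi> x)\<^sup>2 / 2 + 2 * R\<^sup>2 * (norm (grad \<phi> x))\<^sup>2)"
  proof (subst Bochner_Integration.integral_minus[symmetric], rule integral_mono_AE)
    have "integrable M (\<lambda>x. (\<phi> x * partial e \<phi> x) * (x \<bullet> e))"
    proof (rule integrable_bounded_mult[OF L2_mult_integrable[OF L(1) test_partial_L2[OF p e]]])
      show "(\<lambda>x. x \<bullet> e) \<in> borel_measurable M"
        by (intro borel_measurable_lebesgue_on_continuous continuous_intros)
      show "AE x in M. \<bar>x \<bullet> e\<bar> \<le> R"
        using R Basis_le_norm[OF e] by (intro AE_I2) (auto intro: order_trans)
    qed
    from integrable_mult_right[OF this, of "-2"]
    show "integrable M (\<lambda>x. - ((x \<bullet> e) * (2 * (\<phi> x * partial e \<phi> x))))"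
      by (simp add: mult_ac)
    show "integrable M (\<lambda>x. (\<phi> x)\<^sup>2 / 2 + 2 * R\<^sup>2 * (norm (grad \<phi> x))\<^sup>2)" using ip by simp
    show "AE x in M. - ((x \<bullet> e) * (2 * (\<phi> x * partial e \<phi> x))) \<le> (\<phi> x)\<^sup>2 / 2 + 2 * R\<^sup>2 * (norm (grad \<phi> x))\<^sup>2"
    proof (rule AE_I2)
      fix x assume "x \<in> space M"
      then have x: "x \<in> \<Omega>" by simp
      define t where "t = (x \<bullet> e) * partial e \<phi> x"
      have "\<bar>t\<bar> \<le> R * norm (grad \<phi> x)"
        unfolding t_def abs_mult
        using R(1)[OF x] Basis_le_norm[OF e, of x] Basis_le_norm[OF e, of "grad \<phi> x"] e R(2)
        by (intro mult_mono) auto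
      then have "\<bar>t\<bar>\<^sup>2 \<le> (R * norm (grad \<phi> x))\<^sup>2" by (intro power_mono) auto
      then have "t\<^sup>2 \<le> R\<^sup>2 * (norm (grad \<phi> x))\<^sup>2" by (simp add: power_mult_distrib)
      \<comment> \<open>Young's inequality, weighted so that \<phi>^2 appears with coefficient 1/2
        and can be absorbed.\<close>
      moreover have "0 \<le> (\<phi> x + 2 * t)\<^sup>2 / 2" by simp
      then have "- (2 * (\<phi> x * t)) \<le> (\<phi> x)\<^sup>2 / 2 + 2 * t\<^sup>2"
        by (simp add: power2_eq_square algebra_simps)
      ultimately show "- ((x \<bullet> e) * (2 * (\<phi> x * partial e \<phi> x))) \<le> (\<phi> x)\<^sup>2 / 2 + 2 * R\<^sup>2 * (norm (grad \<phi> x))\<^sup>2"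
        by (simp add: t_def mult_ac)
    qed
  qed
  also have "\<dots> = (LINT x|M. (\<phi> x)\<^sup>2) / 2 + 2 * R\<^sup>2 * (LINT x|M. (norm (grad \<phi> x))\<^sup>2)"
    using ip by simp
  finally show ?thesis by simp
qed

text \<open>Density of the test functions. The constant grows from 4 R^2 to 16 R^2 because the
  squared norm inequality is applied twice, once to u and once to the gradient of its
  approximation.\<close>

lemma poincare:
  obtains P where "P > 0"
    "\<And>u. u \<in> H10 \<Omega> \<Longrightarrow> (LINT x|M. (u x)\<^sup>2) \<le> P * (LINT x|M. (norm (weak_grad \<Omega> u x))\<^sup>2)"
proof -
  obtain R where R: "R > 0" "\<And>x. x \<in> \<Omega> \<Longrightarrow> norm x \<le> R"
    using bounded_domain by (auto simp: bounded_pos)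
  have "(LINT x|M. (u x)\<^sup>2) \<le> 16 * R\<^sup>2 * (LINT x|M. (norm (weak_grad \<Omega> u x))\<^sup>2)" if u: "u \<in> H10 \<Omega>" for u
  proof (rule field_le_epsilon)
    fix d :: real assume d: "d > 0"
    \<comment> \<open>Approximation within e produces the total error (16 R^2 + 2) e^2, which this
      choice makes equal to d.\<close>
    define e where "e = sqrt (d / (16 * R\<^sup>2 + 2))"
    have pos: "16 * R\<^sup>2 + 2 > 0" by (simp add: add_nonneg_pos)
    have e: "e > 0" "(16 * R\<^sup>2 + 2) * e\<^sup>2 = d" using d pos by (auto simp: e_def)
    obtain \<phi> where p: "\<phi> \<in> test_functions \<Omega>" "H1_norm \<Omega> (\<lambda>x. u x - \<phi> x) < e"
      using H10_approx[OF u e(1)] by auto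
    note u1 = H10_H1[OF u] and p1 = test_H1[OF p(1)]
    note d1 = H1_diff[OF u1 p1(1)]
    have "(H1_norm \<Omega> (\<lambda>x. u x - \<phi> x))\<^sup>2 \<le> e\<^sup>2"
      using p(2) H1_norm_nonneg by (intro power_mono) auto
    then have dl: "(LINT x|M. (u x - \<phi> x)\<^sup>2) \<le> e\<^sup>2"
      "(LINT x|M. (norm (weak_grad \<Omega> (\<lambda>x. u x - \<phi> x) x))\<^sup>2) \<le> e\<^sup>2"
      using H1_norm_ge[of "\<lambda>x. u x - \<phi> x"] by auto
    have 1: "(LINT x|M. (u x)\<^sup>2) \<le> 2 * (LINT x|M. (u x - \<phi> x)\<^sup>2) + 2 * (LINT x|M. (\<phi> x)\<^sup>2)"
      using L2_norm_add_le[OF H1D(1)[OF d1(1)] H1D(1)[OF p1(1)] H1D(1)[OF u1]]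
      by simp
    have ae: "AE x in M. grad \<phi> x = weak_grad \<Omega> u x + - 1 *\<^sub>R weak_grad \<Omega> (\<lambda>x. u x - \<phi> x) x"
      using p1(2) d1(2) by eventually_elim simp
    have 2: "(LINT x|M. (norm (grad \<phi> x))\<^sup>2) \<le> 2 * (LINT x|M. (norm (weak_grad \<Omega> u x))\<^sup>2)
        + 2 * (LINT x|M. (norm (weak_grad \<Omega> (\<lambda>x. u x - \<phi> x) x))\<^sup>2)"
      using L2_norm_add_le[OF H1D(2)[OF u1] L2_scaleR[OF H1D(2)[OF d1(1)]] test_function_facts(3)[OF p(1)] ae]
      by simp
    define X where "X = (LINT x|M. (norm (weak_grad \<Omega> u x))\<^sup>2)"
    have "(LINT x|M. (\<phi> x)\<^sup>2) \<le> 4 * R\<^sup>2 * (LINT x|M. (norm (grad \<phi> x))\<^sup>2)"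
      by (rule poincare_test[OF p(1) R(2,1)])
    also have "\<dots> \<le> 4 * R\<^sup>2 * (2 * X + 2 * e\<^sup>2)"
      using 2 dl(2) by (intro mult_left_mono) (auto simp: X_def)
    finally have "(LINT x|M. (u x)\<^sup>2) \<le> 16 * R\<^sup>2 * X + (16 * R\<^sup>2 + 2) * e\<^sup>2"
      using 1 dl(1) by (simp add: algebra_simps)
    then show "(LINT x|M. (u x)\<^sup>2) \<le> 16 * R\<^sup>2 * (LINT x|M. (norm (weak_grad \<Omega> u x))\<^sup>2) + d"
      by (simp add: X_def e(2))
  qed
  moreover have "16 * R\<^sup>2 > 0" using R by simp
  ultimately show ?thesis using that by blast
qed

section \<open>Multiplication by bounded functions with bounded weak gradient\<close>

text \<open>The function and its mollification are both bounded by D, so their squared difference is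
  at most 2 D times the difference itself, and an L^1 error becomes an L^2 error. The function w on
  the whole space plays the part of an extension of f.\<close>

lemma square_mollification_error:
  fixes w f :: "'a \<Rightarrow> real"
  assumes w: "integrable lebesgue w" "AE x in lebesgue. \<bar>w x\<bar> \<le> D" and D: "D \<ge> 0"
    and \<eta>: "mollifier e \<eta>"
    and d: "(LINT x|lebesgue. \<bar>conv w \<eta> x - w x\<bar>) \<le> d"
    and f: "f \<in> borel_measurable M" "\<And>x. x \<in> \<Omega> \<Longrightarrow> f x = w x"
  shows "(LINT x|M. (f x - conv w \<eta> x)\<^sup>2) \<le> 2 * D * d"
proof -
  have ic: "integrable lebesgue (\<lambda>x. 2 * D * \<bar>conv w \<eta> x - w x\<bar>)"
    using conv_L1_bound(1)[OF w(1) \<eta>] w(1) by auto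
  have icM: "integrable M (\<lambda>x. 2 * D * \<bar>conv w \<eta> x - w x\<bar>)"
    unfolding integral_lebesgue_on_indicator(2)[OF sets_domain]
    by (rule integrable_mult_indicator[OF sets_domain ic])
  have sq: "AE x in M. (f x - conv w \<eta> x)\<^sup>2 \<le> 2 * D * \<bar>conv w \<eta> x - w x\<bar>"
  proof -
    have "AE x in M. x \<in> \<Omega> \<and> \<bar>w x\<bar> \<le> D"
      using w(2) sets_domain by (subst AE_restrict_space_iff) (auto elim: eventually_mono)
    then show ?thesis
    proof eventually_elim
      case (elim x)
      have "\<bar>conv w \<eta> x - w x\<bar> \<le> 2 * D"
        using conv_bounded[OF \<eta> w, of x] elim by linarith
      then have "\<bar>conv w \<eta> x - w x\<bar> * \<bar>conv w \<eta> x - w x\<bar> \<le> 2 * D * \<bar>conv w \<eta> x - w x\<bar>"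
        by (intro mult_right_mono) auto
      then show ?case using f(2)[of x] elim by (simp add: power2_eq_square abs_mult[symmetric] algebra_simps)
    qed
  qed
  have "conv w \<eta> \<in> borel_measurable lebesgue"
    using conv_L1_bound(1)[OF w(1) \<eta>] by auto
  then have "conv w \<eta> \<in> borel_measurable M" by (rule measurable_restrict_space1)
  then have "integrable M (\<lambda>x. (f x - conv w \<eta> x)\<^sup>2)"
    using f(1) sq by (intro Bochner_Integration.integrable_bound[OF icM]) (auto elim: eventually_mono)
  then have "(LINT x|M. (f x - conv w \<eta> x)\<^sup>2) \<le> (LINT x|M. 2 * D * \<bar>conv w \<eta> x - w x\<bar>)"
    using icM sq by (rule integral_mono_AE)
  also have "\<dots> = (LINT x|lebesgue. indicator \<Omega> x *\<^sub>R (2 * D * \<bar>conv w \<eta> x - w x\<bar>))"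
    by (rule integral_lebesgue_on_indicator(1)[OF sets_domain])
  also have "\<dots> \<le> (LINT x|lebesgue. 2 * D * \<bar>conv w \<eta> x - w x\<bar>)"
  proof (rule integral_mono)
    show "integrable lebesgue (\<lambda>x. indicator \<Omega> x *\<^sub>R (2 * D * \<bar>conv w \<eta> x - w x\<bar>))"
      by (rule integrable_mult_indicator[OF sets_domain ic])
    show "indicator \<Omega> x *\<^sub>R (2 * D * \<bar>conv w \<eta> x - w x\<bar>) \<le> 2 * D * \<bar>conv w \<eta> x - w x\<bar>" for x
      using D by (auto simp: indicator_def)
  qed (rule ic)
  also have "\<dots> = 2 * D * (LINT x|lebesgue. \<bar>conv w \<eta> x - w x\<bar>)" by simp
  also have "\<dots> \<le> 2 * D * d" using D d by (intro mult_left_mono) auto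
  finally show ?thesis .
qed

section \<open>Multipliers that are bounded together with their weak gradient\<close>

context
  fixes s :: "'a \<Rightarrow> real" and B :: real
  assumes sH1: "s \<in> H1 \<Omega>" and sB: "AE x in M. \<bar>s x\<bar> \<le> B"
    and gB: "AE x in M. norm (weak_grad \<Omega> s x) \<le> B" and Bpos: "B > 0"
begin

lemma s_measurable: "s \<in> borel_measurable M" "weak_grad \<Omega> s \<in> borel_measurable M"
  using H1D[OF sH1] L2_measurable by auto

lemma mult_L2:
  assumes "v \<in> L2 \<Omega>" "g \<in> L2 \<Omega>"
  shows "(\<lambda>x. s x * v x) \<in> L2 \<Omega>" "(\<lambda>x. v x *\<^sub>R weak_grad \<Omega> s x + s x *\<^sub>R g x) \<in> L2 \<Omega>"
proof -
  show "(\<lambda>x. s x * v x) \<in> L2 \<Omega>"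
    using L2_mult_bounded[OF assms(1) s_measurable(1) sB] by simp
  show "(\<lambda>x. v x *\<^sub>R weak_grad \<Omega> s x + s x *\<^sub>R g x) \<in> L2 \<Omega>"
    by (rule L2_add[OF L2_bounded_mult[OF assms(1) s_measurable(2) gB]
          L2_mult_bounded[OF assms(2) s_measurable(1) sB]])
qed

text \<open>The product of two test functions is a test function, so the weak gradient of s may be
  tested with it; expanding the derivative by the product rule and moving one term across gives the
  product rule for the weak gradient.\<close>

lemma mult_test_weak_grad:
  assumes p: "\<phi> \<in> test_functions \<Omega>"
  shows "has_weak_grad \<Omega> (\<lambda>x. s x * \<phi> x) (\<lambda>x. \<phi> x *\<^sub>R weak_grad \<Omega> s x + s x *\<^sub>R grad \<phi> x)"
  unfolding has_weak_grad_def
proof (intro ballI)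
  fix \<psi> :: "'a \<Rightarrow> real" and i :: 'a assume q: "\<psi> \<in> test_functions \<Omega>" and i: "i \<in> Basis"
  have d: "\<phi> differentiable at x" "\<psi> differentiable at x" for x
    using test_function_facts(1)[OF p] test_function_facts(1)[OF q] Ck_1_differentiable by blast+
  have pq: "(\<lambda>x. \<phi> x * \<psi> x) \<in> test_functions \<Omega>"
    by (rule test_mult_smooth[OF p test_function_facts(1)[OF q]])
  have e: "partial i (\<lambda>x. \<phi> x * \<psi> x) = (\<lambda>x. \<phi> x * partial i \<psi> x + partial i \<phi> x * \<psi> x)"
    by (rule ext) (rule partial_mult[OF d])
  note Lp = test_function_facts(2)[OF p] and Lq = test_function_facts(2)[OF q]
  have smooth_test: "(\<lambda>x. partial i \<phi> x * \<psi> x) \<in> test_functions \<Omega>" "(\<lambda>x. \<phi> x * partial i \<psi> x) \<in> test_functions \<Omega>"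
    using test_mult_smooth[OF q smooth_partial[OF test_function_facts(1)[OF p] i]]
      test_mult_smooth[OF p smooth_partial[OF test_function_facts(1)[OF q] i]] by (simp_all add: mult.commute)
  have i1: "integrable M (\<lambda>x. s x * (\<phi> x * partial i \<psi> x))" "integrable M (\<lambda>x. s x * (partial i \<phi> x * \<psi> x))"
    by (intro L2_mult_integrable[OF H1D(1)[OF sH1]] test_function_facts(2) smooth_test)+
  have i2: "integrable M (\<lambda>x. (weak_grad \<Omega> s x \<bullet> i) * (\<phi> x * \<psi> x))"
    by (intro L2_mult_integrable[OF L2_component[OF H1D(2)[OF sH1] i]] test_function_facts(2) pq)
  have "(LINT x|M. s x * partial i (\<lambda>x. \<phi> x * \<psi> x) x) = - (LINT x|M. (weak_grad \<Omega> s x \<bullet> i) * (\<phi> x * \<psi> x))"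
    by (rule has_weak_gradD[OF H1D(3)[OF sH1] pq i])
  then have "(LINT x|M. s x * (\<phi> x * partial i \<psi> x)) + (LINT x|M. s x * (partial i \<phi> x * \<psi> x))
      = - (LINT x|M. (weak_grad \<Omega> s x \<bullet> i) * (\<phi> x * \<psi> x))"
    unfolding e using i1 by (simp add: distrib_left)
  moreover have "(LINT x|M. ((\<phi> x *\<^sub>R weak_grad \<Omega> s x + s x *\<^sub>R grad \<phi> x) \<bullet> i) * \<psi> x) =
      (LINT x|M. (weak_grad \<Omega> s x \<bullet> i) * (\<phi> x * \<psi> x) + s x * (partial i \<phi> x * \<psi> x))"
    using i by (intro Bochner_Integration.integral_cong) (auto simp: inner_add_left algebra_simps)
  ultimately show "(LINT x|M. s x * \<phi> x * partial i \<psi> x) =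
      - (LINT x|M. ((\<phi> x *\<^sub>R weak_grad \<Omega> s x + s x *\<^sub>R grad \<phi> x) \<bullet> i) * \<psi> x)"
    using i1 i2 by (simp add: mult.assoc)
qed

text \<open>The product is an \<open>H\<^sup>1\<close> function with compact support in \<open>\<Omega>\<close>; its mollifications are test
  functions, and as all functions are bounded, \<open>L\<^sup>1\<close> convergence gives \<open>L\<^sup>2\<close> convergence.\<close>

lemma mult_test_H10:
  assumes p: "\<phi> \<in> test_functions \<Omega>"
  shows "(\<lambda>x. s x * \<phi> x) \<in> H10 \<Omega>"
proof -
  obtain K where K: "compact K" "K \<subseteq> \<Omega>" "\<And>x. x \<notin> K \<Longrightarrow> \<phi> x = 0" "smooth \<phi>"
    using test_functionsD[OF p] by blast
  obtain C where C: "C > 0" "\<And>x. \<bar>\<phi> x\<bar> \<le> C" "\<And>x. norm (grad \<phi> x) \<le> C"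
    using test_function_facts(6)[OF p] by blast
  obtain R where R: "\<And>x. x \<in> K \<Longrightarrow> norm x \<le> R"
    using compact_imp_bounded[OF K(1)] by (auto simp: bounded_iff)
  obtain r where r: "r > 0" "(\<Union>x\<in>K. cball x r) \<subseteq> \<Omega>"
    using compact_subset_open_imp_cball_epsilon_subset[OF K(1) open_domain K(2)] by blast
  \<comment> \<open>The gradient of the product has two terms, each bounded by B * C.\<close>
  define D where "D = 2 * B * C"
  have D: "D > 0" using Bpos C by (simp add: D_def)
  define u where "u x = s x * \<phi> x" for x
  define g where "g x = \<phi> x *\<^sub>R weak_grad \<Omega> s x + s x *\<^sub>R grad \<phi> x" for x
  \<comment> \<open>Extension by zero, since mollification works on the whole space. The support in
    K keeps the extended gradient a weak gradient across the boundary, as the next claims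
    show.\<close>
  define w where "w x = indicator \<Omega> x *\<^sub>R u x" for x
  define gw where "gw i x = indicator \<Omega> x *\<^sub>R (g x \<bullet> i)" for i x
  have uL: "u \<in> L2 \<Omega>" and gL: "g \<in> L2 \<Omega>"
    unfolding u_def g_def using mult_L2[OF test_function_facts(2,3)[OF p]] by auto
  have wg: "has_weak_grad \<Omega> u g"
    unfolding u_def g_def by (rule mult_test_weak_grad[OF p])
  note H = H1I[OF uL gL wg]
  have iw: "integrable lebesgue w"
    unfolding w_def
    by (rule integral_lebesgue_on_indicator(2)[OF sets_domain, THEN iffD1, OF L2_integrable[OF uL]])
  have ig: "integrable lebesgue (gw i)" if "i \<in> Basis" for i
    unfolding gw_def
    by (rule integral_lebesgue_on_indicator(2)[OF sets_domain, THEN iffD1,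
          OF L2_integrable[OF L2_component[OF gL that]]])
  have gz: "x \<notin> K \<Longrightarrow> g x = 0" for x
  proof -
    assume x: "x \<notin> K"
    have "partial i \<phi> x = 0" for i
      by (rule partial_zero_outside[OF compact_imp_closed[OF K(1)] K(3) x])
    then show "g x = 0" using K(3)[OF x] by (simp add: g_def grad_def)
  qed
  have wz: "x \<notin> K \<Longrightarrow> w x = 0" and gwz: "x \<notin> K \<Longrightarrow> gw i x = 0" for x i
    using K(3)[of x] gz[of x] by (auto simp: w_def u_def gw_def)
  have bnd: "AE x in lebesgue. x \<in> \<Omega> \<longrightarrow> \<bar>u x\<bar> \<le> D \<and> norm (g x) \<le> D"
  proof -
    have "AE x in M. \<bar>s x\<bar> \<le> B \<and> norm (weak_grad \<Omega> s x) \<le> B" using sB gB by simp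
    then have "AE x in lebesgue. x \<in> \<Omega> \<longrightarrow> \<bar>s x\<bar> \<le> B \<and> norm (weak_grad \<Omega> s x) \<le> B"
      using sets_domain by (subst (asm) AE_restrict_space_iff) auto
    then show ?thesis
    proof eventually_elim
      case (elim x)
      show ?case
      proof
        assume "x \<in> \<Omega>"
        with elim have b: "\<bar>s x\<bar> \<le> B" "norm (weak_grad \<Omega> s x) \<le> B" by auto
        have 1: "\<bar>s x\<bar> * \<bar>\<phi> x\<bar> \<le> B * C" "\<bar>\<phi> x\<bar> * norm (weak_grad \<Omega> s x) \<le> C * B"
          "\<bar>s x\<bar> * norm (grad \<phi> x) \<le> B * C"
          using b C Bpos by (auto intro!: mult_mono)
        moreover have "B * C > 0" using Bpos C by simp
        ultimately have "\<bar>u x\<bar> \<le> D" by (simp add: u_def D_def abs_mult)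
        moreover have "norm (g x) \<le> D"
          using norm_triangle_ineq[of "\<phi> x *\<^sub>R weak_grad \<Omega> s x" "s x *\<^sub>R grad \<phi> x"] 1(2,3)
          by (simp add: g_def D_def mult.commute[of C B])
        ultimately show "\<bar>u x\<bar> \<le> D \<and> norm (g x) \<le> D" by simp
      qed
    qed
  qed
  have wb: "AE x in lebesgue. \<bar>w x\<bar> \<le> D"
    using bnd by eventually_elim (use D in \<open>auto simp: w_def indicator_def\<close>)
  have gwb: "AE x in lebesgue. \<bar>gw i x\<bar> \<le> D" if i: "i \<in> Basis" for i
    using bnd
  proof eventually_elim
    case (elim x)
    then show ?case using D Basis_le_norm[OF i, of "g x"] by (auto simp: gw_def indicator_def)
  qed
  have wR: "x \<notin> cball 0 R \<Longrightarrow> w x = 0" and gwR: "x \<notin> cball 0 R \<Longrightarrow> gw i x = 0" for x i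
    using wz[of x] gwz[of x i] R[of x] by auto
  \<comment> \<open>Mollification commutes with the weak gradient. Far from K both sides vanish;
    within distance e of K the ball of radius e around x stays in the domain because 2 * e \<le> r,
    so the reflected kernel is an admissible test function.\<close>
  have grad_conv: "partial i (conv w \<eta>) x = conv (gw i) \<eta> x"
    if e: "2 * e \<le> r" "e > 0" and \<eta>: "mollifier e \<eta>" and i: "i \<in> Basis" for e \<eta> i x
  proof -
    note \<eta>' = mollifierD[OF \<eta>]
    have pz: "z \<notin> cball 0 e \<Longrightarrow> partial i \<eta> z = 0" for z
      by (rule partial_zero_outside[OF closed_cball \<eta>'(3)])
    have pc: "partial i (conv w \<eta>) x = conv w (partial i \<eta>) x"
      using conv_partial[OF iw \<eta>'(1) compact_cball[of 0 e] \<eta>'(3) i] by simp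
    show ?thesis
    proof (cases "\<exists>y\<in>K. dist x y \<le> e")
      case False
      then have far: "\<And>y. y \<in> K \<Longrightarrow> e < dist x y" by force
      have "conv w (partial i \<eta>) x = 0"
        by (rule conv_zero_outside[of e "partial i \<eta>" K w x, OF pz wz far])
      moreover have "conv (gw i) \<eta> x = 0"
        by (rule conv_zero_outside[of e \<eta> K "gw i" x, OF \<eta>'(3) gwz far])
      ultimately show ?thesis using pc by simp
    next
      case True
      then obtain y where y: "y \<in> K" "dist x y \<le> e" by blast
      have "cball x e \<subseteq> cball y r"
      proof
        fix z assume "z \<in> cball x e"
        then show "z \<in> cball y r"
          using dist_triangle[of y z x] y(2) e(1) by (simp add: dist_commute)
      qed
      then have sub: "cball x e \<subseteq> \<Omega>" using y(1) r(2) by blast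
      \<comment> \<open>Reflecting the kernel changes the sign of its derivative, which cancels the
        sign in the definition of a weak gradient.\<close>
      define \<psi> where "\<psi> z = \<eta> (x - z)" for z
      have t: "\<psi> \<in> test_functions \<Omega>"
      proof (rule test_functionsI[OF _ compact_cball sub])
        show "smooth \<psi>" unfolding \<psi>_def using \<eta>'(1) Ck_reflect by blast
        show "z \<notin> cball x e \<Longrightarrow> \<psi> z = 0" for z
          unfolding \<psi>_def by (rule \<eta>'(3)) (simp add: dist_norm norm_minus_commute)
      qed
      have p\<psi>: "partial i \<psi> z = - partial i \<eta> (x - z)" for z
        unfolding \<psi>_def using \<eta>'(1) Ck_1_differentiable by (intro partial_reflect(2)) blast
      have "conv w (partial i \<eta>) x = (LINT z|M. u z * partial i \<eta> (x - z))"
        unfolding conv_def w_def integral_lebesgue_on_indicator(1)[OF sets_domain] by (simp add: mult.assoc)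
      also have "\<dots> = - (LINT z|M. u z * partial i \<psi> z)"
        by (simp add: p\<psi>)
      also have "\<dots> = (LINT z|M. (g z \<bullet> i) * \<psi> z)"
        using has_weak_gradD[OF wg t i] by simp
      also have "\<dots> = conv (gw i) \<eta> x"
        unfolding conv_def gw_def integral_lebesgue_on_indicator(1)[OF sets_domain] \<psi>_def
        by (simp add: mult.assoc)
      finally show ?thesis using pc by simp
    qed
  qed
  have "\<exists>\<theta>\<in>test_functions \<Omega>. H1_norm \<Omega> (\<lambda>x. u x - \<theta> x) < \<epsilon>" if \<epsilon>: "\<epsilon> > 0" for \<epsilon>
  proof -
    \<comment> \<open>One contribution from the function and one from each component of its
      gradient, each at most 2 * D * d; with d below they sum to half of \<epsilon>^2.\<close>
    define N where "N = real DIM('a) + 1"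
    have N: "N > 0" by (simp add: N_def)
    define d where "d = \<epsilon>\<^sup>2 / (4 * D * N)"
    have d: "d > 0" "N * (2 * D * d) < \<epsilon>\<^sup>2"
      using \<epsilon> D N by (auto simp: d_def field_simps)
    obtain e0 where e0: "e0 > 0" "\<And>e \<eta>. e < e0 \<Longrightarrow> mollifier e \<eta> \<Longrightarrow> (LINT x|lebesgue. \<bar>conv w \<eta> x - w x\<bar>) \<le> d"
      using conv_L1_approx_AE[where g=w and R=R, OF borel_measurable_integrable[OF iw] wb wR d(1) less_imp_le[OF D]]
      by blast
    have "\<exists>e0>0. \<forall>e \<eta>. e < e0 \<longrightarrow> mollifier e \<eta> \<longrightarrow> (LINT x|lebesgue. \<bar>conv (gw i) \<eta> x - gw i x\<bar>) \<le> d"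
      if i: "i \<in> Basis" for i
    proof -
      obtain e1 where "e1 > 0"
        "\<And>e \<eta>. e < e1 \<Longrightarrow> mollifier e \<eta> \<Longrightarrow> (LINT x|lebesgue. \<bar>conv (gw i) \<eta> x - gw i x\<bar>) \<le> d"
        using conv_L1_approx_AE[where g="gw i" and R=R, OF borel_measurable_integrable[OF ig[OF i]]
            gwb[OF i] gwR d(1) less_imp_le[OF D]] by blast
      then show ?thesis by blast
    qed
    then have "\<forall>i\<in>Basis. \<exists>e0>0. \<forall>e \<eta>. e < e0 \<longrightarrow> mollifier e \<eta> \<longrightarrow> (LINT x|lebesgue. \<bar>conv (gw i) \<eta> x - gw i x\<bar>) \<le> d"
      by blast
    from bchoice[OF this] obtain E where E: "\<And>i. i \<in> Basis \<Longrightarrow> E i > 0"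
      "\<And>i e \<eta>. i \<in> Basis \<Longrightarrow> e < E i \<Longrightarrow> mollifier e \<eta> \<Longrightarrow> (LINT x|lebesgue. \<bar>conv (gw i) \<eta> x - gw i x\<bar>) \<le> d"
      by blast
    \<comment> \<open>A single radius must serve the function, all components of its gradient, and
      the distance of K to the boundary.\<close>
    define m where "m = Min (insert r (insert e0 (E ` Basis)))"
    have m: "m > 0" "m \<le> r" "m \<le> e0" "\<And>i. i \<in> Basis \<Longrightarrow> m \<le> E i"
    proof -
      have fin: "finite (insert r (insert e0 (E ` Basis)))" by simp
      show "m > 0" unfolding m_def using r(1) e0(1) E(1) by (subst Min_gr_iff) auto
      show "m \<le> r" "m \<le> e0" "\<And>i. i \<in> Basis \<Longrightarrow> m \<le> E i"
        unfolding m_def by (rule Min_le[OF fin], simp)+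
    qed
    define e where "e = m / 2"
    have e: "e > 0" "2 * e \<le> r" "e < e0" "\<And>i. i \<in> Basis \<Longrightarrow> e < E i"
    proof -
      show "e > 0" "2 * e \<le> r" "e < e0" using m by (auto simp: e_def)
      show "e < E i" if "i \<in> Basis" for i using m(1) m(4)[OF that] by (simp add: e_def)
    qed
    obtain \<eta> :: "'a \<Rightarrow> real" where \<eta>: "mollifier e \<eta>" using mollifier_exists[OF e(1)] by blast
    define \<theta> where "\<theta> = conv w \<eta>"
    have "(\<Union>x\<in>K. cball x e) \<subseteq> \<Omega>"
    proof -
      have "cball x e \<subseteq> cball x r" for x :: 'a using e(1,2) by (intro subset_cball) simp
      then show ?thesis using r(2) by blast
    qed
    then have \<theta>: "\<theta> \<in> test_functions \<Omega>"
      unfolding \<theta>_def using test_function_conv[where K=K, OF iw wz K(1) _ \<eta>] by blast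
    note T = test_H1[OF \<theta>]
    have gc: "grad \<theta> x \<bullet> i = conv (gw i) \<eta> x" if "i \<in> Basis" for i x
      using grad_conv[OF e(2,1) \<eta> that] that by (simp add: \<theta>_def)
    have DL: "(\<lambda>x. u x - \<theta> x) \<in> H1 \<Omega>" by (rule H1_diff[OF H(1) T(1)])
    have gdL: "(\<lambda>x. g x - grad \<theta> x) \<in> L2 \<Omega>"
      by (rule L2_diff[OF gL test_function_facts(3)[OF \<theta>]])
    have ae: "AE x in M. weak_grad \<Omega> (\<lambda>x. u x - \<theta> x) x = g x - grad \<theta> x"
      using H1_diff(2)[OF H(1) T(1)] H(2) T(2) by eventually_elim simp
    have eq: "(H1_norm \<Omega> (\<lambda>x. u x - \<theta> x))\<^sup>2 = (LINT x|M. (u x - \<theta> x)\<^sup>2) + (LINT x|M. (norm (g x - grad \<theta> x))\<^sup>2)"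
      by (rule H1_norm_cong_AE[OF DL H1D(1)[OF DL] AE_I2[OF refl] gdL ae])
    have X: "(LINT x|M. (u x - \<theta> x)\<^sup>2) \<le> 2 * D * d"
      unfolding \<theta>_def
      by (rule square_mollification_error[OF iw wb _ \<eta> e0(2)[OF e(3) \<eta>] L2_measurable[OF uL]])
        (use D in \<open>auto simp: w_def\<close>)
    have "(norm (g x - grad \<theta> x))\<^sup>2 = (\<Sum>i\<in>Basis. (g x \<bullet> i - conv (gw i) \<eta> x)\<^sup>2)" for x
      unfolding power2_norm_eq_inner
      by (subst euclidean_inner) (simp add: inner_diff_left gc[symmetric] power2_eq_square)
    then have "(LINT x|M. (norm (g x - grad \<theta> x))\<^sup>2) = (LINT x|M. (\<Sum>i\<in>Basis. (g x \<bullet> i - conv (gw i) \<eta> x)\<^sup>2))"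
      by simp
    also have "\<dots> = (\<Sum>i\<in>Basis. LINT x|M. (g x \<bullet> i - conv (gw i) \<eta> x)\<^sup>2)"
    proof (rule Bochner_Integration.integral_sum)
      fix i :: 'a assume i: "i \<in> Basis"
      show "integrable M (\<lambda>x. (g x \<bullet> i - conv (gw i) \<eta> x)\<^sup>2)"
        using L2_square_integrable[OF L2_component[OF gdL i]] by (simp add: inner_diff_left gc[OF i, symmetric] i)
    qed
    also have "\<dots> \<le> (\<Sum>i\<in>(Basis::'a set). 2 * D * d)"
    proof (rule sum_mono)
      fix i :: 'a assume i: "i \<in> Basis"
      show "(LINT x|M. (g x \<bullet> i - conv (gw i) \<eta> x)\<^sup>2) \<le> 2 * D * d"
        by (rule square_mollification_error[OF ig[OF i] gwb[OF i] _ \<eta> E(2)[OF i e(4)[OF i] \<eta>]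
            L2_measurable[OF L2_component[OF gL i]]])
          (use D in \<open>auto simp: gw_def\<close>)
    qed
    finally have Y: "(LINT x|M. (norm (g x - grad \<theta> x))\<^sup>2) \<le> real DIM('a) * (2 * D * d)" by simp
    have "(H1_norm \<Omega> (\<lambda>x. u x - \<theta> x))\<^sup>2 \<le> N * (2 * D * d)"
      unfolding eq N_def distrib_right using add_mono[OF Y X] by (simp add: add.commute)
    then have "(H1_norm \<Omega> (\<lambda>x. u x - \<theta> x))\<^sup>2 < \<epsilon>\<^sup>2" using d(2) by linarith
    then have "H1_norm \<Omega> (\<lambda>x. u x - \<theta> x) < \<epsilon>"
      using \<epsilon> by (auto intro: power_less_imp_less_base)
    with \<theta> show ?thesis by blast
  qed
  then show ?thesis using H(1) by (simp add: H10_def u_def[abs_def])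
qed

text \<open>The defect X of the product rule is linear in the pair of function and gradient and
  bounded by their L^1 norms. It vanishes for test functions, so by density it vanishes on
  \<open>H10\<close>. Taking the gradient as an independent argument allows almost equal
  representatives to be exchanged.\<close>

lemma mult_H10_weak_grad:
  assumes v: "v \<in> H10 \<Omega>"
  shows "has_weak_grad \<Omega> (\<lambda>x. s x * v x) (\<lambda>x. v x *\<^sub>R weak_grad \<Omega> s x + s x *\<^sub>R weak_grad \<Omega> v x)"
  unfolding has_weak_grad_def
proof (intro ballI)
  fix \<psi> :: "'a \<Rightarrow> real" and i :: 'a assume q: "\<psi> \<in> test_functions \<Omega>" and i: "i \<in> Basis"
  note v1 = H10_H1[OF v]
  obtain C where C: "C > 0" "\<And>x. \<bar>\<psi> x\<bar> \<le> C" "\<And>x. norm (grad \<psi> x) \<le> C"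
    using test_function_facts(6)[OF q] by blast
  have C': "\<bar>partial i \<psi> x\<bar> \<le> C" for x
    using Basis_le_norm[OF i, of "grad \<psi> x"] C(3)[of x] i by simp
  define X where "X f g = (LINT x|M. s x * f x * partial i \<psi> x) +
    (LINT x|M. ((f x *\<^sub>R weak_grad \<Omega> s x + s x *\<^sub>R g x) \<bullet> i) * \<psi> x)" for f g
  note Lq = test_function_facts(2)[OF q] test_partial_L2[OF q i]
  have I: "integrable M (\<lambda>x. s x * f x * partial i \<psi> x)"
    "integrable M (\<lambda>x. ((f x *\<^sub>R weak_grad \<Omega> s x + s x *\<^sub>R g x) \<bullet> i) * \<psi> x)"
    if "f \<in> L2 \<Omega>" "g \<in> L2 \<Omega>" for f g
    using L2_mult_integrable[OF mult_L2(1)[OF that] Lq(2)]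
      L2_mult_integrable[OF L2_component[OF mult_L2(2)[OF that] i] Lq(1)] by auto
  have Xdiff: "X f g - X f' g' = X (\<lambda>x. f x - f' x) (\<lambda>x. g x - g' x)"
    if "f \<in> L2 \<Omega>" "g \<in> L2 \<Omega>" "f' \<in> L2 \<Omega>" "g' \<in> L2 \<Omega>" for f f' g g'
  proof -
    have "X (\<lambda>x. f x - f' x) (\<lambda>x. g x - g' x) = (LINT x|M. s x * f x * partial i \<psi> x - s x * f' x * partial i \<psi> x) +
      (LINT x|M. ((f x *\<^sub>R weak_grad \<Omega> s x + s x *\<^sub>R g x) \<bullet> i) * \<psi> x - ((f' x *\<^sub>R weak_grad \<Omega> s x + s x *\<^sub>R g' x) \<bullet> i) * \<psi> x)"
      unfolding X_def
      by (intro arg_cong2[where f="(+)"] Bochner_Integration.integral_cong)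
        (auto simp: inner_add_left inner_diff_left algebra_simps)
    then show ?thesis unfolding X_def using I[OF that(1,2)] I[OF that(3,4)] by simp
  qed
  have Xbound: "\<bar>X f g\<bar> \<le> B * C * (2 * (LINT x|M. norm (f x)) + (LINT x|M. norm (g x)))"
    if f: "f \<in> L2 \<Omega>" and g: "g \<in> L2 \<Omega>" for f g
  proof -
    have ng: "(\<lambda>x. norm (g x)) \<in> L2 \<Omega>"
      using g by (auto simp: L2_def)
    have int: "integrable M (\<lambda>x. norm (f x))" "integrable M (\<lambda>x. norm (g x))"
      using L2_integrable[OF f] L2_integrable[OF ng] by auto
    have 1: "\<bar>LINT x|M. s x * f x * partial i \<psi> x\<bar> \<le> (LINT x|M. B * C * norm (f x))"
    proof (rule integral_abs_bound[THEN order_trans], rule integral_mono_AE)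
      show "AE x in M. \<bar>s x * f x * partial i \<psi> x\<bar> \<le> B * C * norm (f x)"
        using sB
      proof eventually_elim
        case (elim x)
        have "\<bar>s x\<bar> * \<bar>partial i \<psi> x\<bar> * \<bar>f x\<bar> \<le> B * C * \<bar>f x\<bar>"
          using elim C' Bpos by (intro mult_right_mono mult_mono) auto
        then show ?case by (simp add: abs_mult mult_ac)
      qed
    qed (use I[OF f g] int in auto)
    have 2: "\<bar>LINT x|M. ((f x *\<^sub>R weak_grad \<Omega> s x + s x *\<^sub>R g x) \<bullet> i) * \<psi> x\<bar>
        \<le> (LINT x|M. B * C * (norm (f x) + norm (g x)))"
    proof (rule integral_abs_bound[THEN order_trans], rule integral_mono_AE)
      show "AE x in M. \<bar>((f x *\<^sub>R weak_grad \<Omega> s x + s x *\<^sub>R g x) \<bullet> i) * \<psi> x\<bar> \<le> B * C * (norm (f x) + norm (g x))"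
        using sB gB
      proof eventually_elim
        case (elim x)
        have "\<bar>(f x *\<^sub>R weak_grad \<Omega> s x + s x *\<^sub>R g x) \<bullet> i\<bar> \<le> norm (f x *\<^sub>R weak_grad \<Omega> s x + s x *\<^sub>R g x)"
          by (rule Basis_le_norm[OF i])
        also have "\<dots> \<le> norm (f x) * norm (weak_grad \<Omega> s x) + \<bar>s x\<bar> * norm (g x)"
          using norm_triangle_ineq[of "f x *\<^sub>R weak_grad \<Omega> s x" "s x *\<^sub>R g x"] by simp
        also have "\<dots> \<le> norm (f x) * B + B * norm (g x)"
          using elim by (intro add_mono mult_left_mono mult_right_mono) auto
        finally have "\<bar>(f x *\<^sub>R weak_grad \<Omega> s x + s x *\<^sub>R g x) \<bullet> i\<bar> \<le> B * (norm (f x) + norm (g x))"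
          by (simp add: algebra_simps)
        then have "\<bar>(f x *\<^sub>R weak_grad \<Omega> s x + s x *\<^sub>R g x) \<bullet> i\<bar> * \<bar>\<psi> x\<bar> \<le> B * (norm (f x) + norm (g x)) * C"
          using C(2)[of x] by (intro mult_mono) (auto simp: Bpos less_imp_le)
        then show ?case by (simp add: abs_mult mult_ac)
      qed
    qed (use I[OF f g] int in auto)
    show ?thesis using 1 2 int unfolding X_def by (simp add: algebra_simps)
  qed
  \<comment> \<open>In the bound on X the function counts twice and the gradient once, which
    accounts for the factor 3; the remaining measure term comes from passing from L^2 to
    L^1.\<close>
  define m where "m = B * C * 3 * (measure M \<Omega> + 1)"
  have m: "m > 0" using Bpos C by (simp add: m_def add_nonneg_pos)
  have "\<bar>X v (weak_grad \<Omega> v)\<bar> \<le> 0 + t" if t: "t > 0" for t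
  proof -
    define e where "e = t / m"
    have e: "e > 0" "e * m = t" using t m by (auto simp: e_def)
    obtain \<phi> where p: "\<phi> \<in> test_functions \<Omega>" "H1_norm \<Omega> (\<lambda>x. v x - \<phi> x) < e"
      using H10_approx[OF v e(1)] by auto
    note T = test_H1[OF p(1)]
    define f where "f x = v x - \<phi> x" for x
    define g where "g x = weak_grad \<Omega> v x - grad \<phi> x" for x
    have fH: "f \<in> H1 \<Omega>" unfolding f_def by (rule H1_diff[OF v1 T(1)])
    have fL: "f \<in> L2 \<Omega>" by (rule H1D(1)[OF fH])
    have gL: "g \<in> L2 \<Omega>" unfolding g_def by (rule L2_diff[OF H1D(2)[OF v1] test_function_facts(3)[OF p(1)]])
    have ae: "AE x in M. weak_grad \<Omega> f x = g x"
      unfolding f_def g_def using H1_diff(2)[OF v1 T(1)] T(2) by eventually_elim simp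
    have "(H1_norm \<Omega> f)\<^sup>2 \<le> e\<^sup>2"
      using p(2) H1_norm_nonneg unfolding f_def by (intro power_mono) auto
    then have "(LINT x|M. (f x)\<^sup>2) + (LINT x|M. (norm (g x))\<^sup>2) \<le> e\<^sup>2"
      using H1_norm_cong_AE[OF fH fL AE_I2[OF refl] gL ae] by simp
    moreover have "0 \<le> (LINT x|M. (f x)\<^sup>2)" "0 \<le> (LINT x|M. (norm (g x))\<^sup>2)"
      by (auto intro: integral_nonneg_AE)
    moreover have "a + b \<le> c \<Longrightarrow> 0 \<le> a \<Longrightarrow> 0 \<le> b \<Longrightarrow> a \<le> c \<and> b \<le> c" for a b c :: real by simp
    ultimately have "(LINT x|M. (f x)\<^sup>2) \<le> e\<^sup>2 \<and> (LINT x|M. (norm (g x))\<^sup>2) \<le> e\<^sup>2" by blast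
    then have le: "(LINT x|M. (norm (f x))\<^sup>2) \<le> e\<^sup>2" "(LINT x|M. (norm (g x))\<^sup>2) \<le> e\<^sup>2" by auto
    have "X \<phi> (grad \<phi>) = 0"
      unfolding X_def using has_weak_gradD[OF mult_test_weak_grad[OF p(1)] q i] by simp
    then have "X v (weak_grad \<Omega> v) = X f g"
      using Xdiff[OF H1D(1,2)[OF v1] test_function_facts(2,3)[OF p(1)]]
      by (simp add: f_def[abs_def] g_def[abs_def])
    also have "\<bar>\<dots>\<bar> \<le> B * C * (2 * (LINT x|M. norm (f x)) + (LINT x|M. norm (g x)))"
      by (rule Xbound[OF fL gL])
    also have "\<dots> \<le> B * C * (2 * (e * (measure M \<Omega> + 1)) + e * (measure M \<Omega> + 1))"
      using Bpos C integral_abs_small[OF fL le(1) e(1)] integral_abs_small[OF gL le(2) e(1)]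
      by (intro mult_left_mono add_mono) auto
    also have "\<dots> = e * m" by (simp add: m_def algebra_simps)
    finally show ?thesis using e(2) by simp
  qed
  then have "\<bar>X v (weak_grad \<Omega> v)\<bar> \<le> 0" by (rule field_le_epsilon)
  then show "(LINT x|M. s x * v x * partial i \<psi> x) =
      - (LINT x|M. ((v x *\<^sub>R weak_grad \<Omega> s x + s x *\<^sub>R weak_grad \<Omega> v x) \<bullet> i) * \<psi> x)"
    by (simp add: X_def)
qed

text \<open>The product contributes B^2 times the square of v, its gradient at most 2 B^2 times the
  squares of v and of the gradient of v. The resulting coefficients 3 B^2 and 2 B^2 are rounded up
  to 4 B^2, the square of 2 B.\<close>

lemma mult_H10_norm:
  assumes v: "v \<in> H10 \<Omega>"
  shows "(\<lambda>x. s x * v x) \<in> H1 \<Omega>" "H1_norm \<Omega> (\<lambda>x. s x * v x) \<le> 2 * B * H1_norm \<Omega> v"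
proof -
  note v1 = H10_H1[OF v]
  note L = H1D(1,2)[OF v1]
  note H = H1I[OF mult_L2[OF L] mult_H10_weak_grad[OF v]]
  show sv: "(\<lambda>x. s x * v x) \<in> H1 \<Omega>" by (rule H(1))
  have L2v: "integrable M (\<lambda>x. (v x)\<^sup>2)" "integrable M (\<lambda>x. (norm (weak_grad \<Omega> v x))\<^sup>2)"
    using L[THEN L2_square_integrable] by auto
  have sq: "a\<^sup>2 * b\<^sup>2 \<le> B\<^sup>2 * b\<^sup>2" if "\<bar>a\<bar> \<le> B" for a b :: real
    using power_mono[OF that, of 2] by (intro mult_right_mono) auto
  have 1: "(LINT x|M. (s x * v x)\<^sup>2) \<le> (LINT x|M. B\<^sup>2 * (v x)\<^sup>2)"
  proof (rule integral_mono_AE)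
    show "AE x in M. (s x * v x)\<^sup>2 \<le> B\<^sup>2 * (v x)\<^sup>2"
      using sB by eventually_elim (simp add: power_mult_distrib sq)
  qed (use L2_square_integrable[OF mult_L2(1)[OF L]] L2v in auto)
  have 2: "(LINT x|M. (norm (weak_grad \<Omega> (\<lambda>x. s x * v x) x))\<^sup>2)
      \<le> (LINT x|M. 2 * B\<^sup>2 * (v x)\<^sup>2 + 2 * B\<^sup>2 * (norm (weak_grad \<Omega> v x))\<^sup>2)"
  proof (rule integral_mono_AE)
    show "AE x in M. (norm (weak_grad \<Omega> (\<lambda>x. s x * v x) x))\<^sup>2
        \<le> 2 * B\<^sup>2 * (v x)\<^sup>2 + 2 * B\<^sup>2 * (norm (weak_grad \<Omega> v x))\<^sup>2"
      using H(2) sB gB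
    proof eventually_elim
      case (elim x)
      have "(norm (v x *\<^sub>R weak_grad \<Omega> s x + s x *\<^sub>R weak_grad \<Omega> v x))\<^sup>2 \<le>
          2 * (norm (v x *\<^sub>R weak_grad \<Omega> s x))\<^sup>2 + 2 * (norm (s x *\<^sub>R weak_grad \<Omega> v x))\<^sup>2"
        by (rule square_norm_add_le)
      then show ?case
        using elim sq[of "norm (weak_grad \<Omega> s x)" "v x"] sq[of "s x" "norm (weak_grad \<Omega> v x)"]
        by (simp add: power_mult_distrib algebra_simps)
    qed
  qed (use L2_square_integrable[OF H1D(2)[OF sv]] L2v in auto)
  have "(H1_norm \<Omega> (\<lambda>x. s x * v x))\<^sup>2 \<le> 3 * B\<^sup>2 * (LINT x|M. (v x)\<^sup>2) + 2 * B\<^sup>2 * (LINT x|M. (norm (weak_grad \<Omega> v x))\<^sup>2)"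
    using 1 2 L2v by (simp add: H1_norm_square)
  also have "\<dots> \<le> 4 * B\<^sup>2 * (LINT x|M. (v x)\<^sup>2) + 4 * B\<^sup>2 * (LINT x|M. (norm (weak_grad \<Omega> v x))\<^sup>2)"
    by (intro add_mono mult_right_mono integral_nonneg_AE) auto
  also have "\<dots> = (2 * B * H1_norm \<Omega> v)\<^sup>2"
    by (simp add: power_mult_distrib H1_norm_square distrib_left)
  finally show "H1_norm \<Omega> (\<lambda>x. s x * v x) \<le> 2 * B * H1_norm \<Omega> v"
    by (rule power2_le_imp_le) (simp add: Bpos less_imp_le H1_norm_nonneg)
qed

text \<open>Multiplication is bounded in the norm and sends test functions into \<open>H10\<close>,
  which is closed; the general case follows by density.\<close>

lemma mult_H10:
  assumes v: "v \<in> H10 \<Omega>"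
  shows "(\<lambda>x. s x * v x) \<in> H10 \<Omega>"
proof (rule H10_closed[OF mult_H10_norm(1)[OF v]])
  fix e :: real assume e: "e > 0"
  obtain \<phi> where p: "\<phi> \<in> test_functions \<Omega>" "H1_norm \<Omega> (\<lambda>x. v x - \<phi> x) < e / (2 * B)"
    using H10_approx[OF v, of "e / (2 * B)"] e Bpos by auto
  have "H1_norm \<Omega> (\<lambda>x. s x * (v x - \<phi> x)) \<le> 2 * B * H1_norm \<Omega> (\<lambda>x. v x - \<phi> x)"
    by (rule mult_H10_norm(2)[OF H10_diff[OF v test_H10[OF p(1)]]])
  also have "\<dots> < e" using p(2) Bpos by (simp add: field_simps)
  finally have "H1_norm \<Omega> (\<lambda>x. s x * v x - s x * \<phi> x) < e" by (simp add: right_diff_distrib)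
  with mult_test_H10[OF p(1)] show "\<exists>w\<in>H10 \<Omega>. H1_norm \<Omega> (\<lambda>x. s x * v x - w x) < e"
    by (intro bexI[of _ "\<lambda>x. s x * \<phi> x"])
qed

end

section \<open>Finite element functions\<close>

text \<open>Test functions supported in the open part of a cell see only p, so classical integration
  by parts and the fundamental lemma identify the weak gradient there with the gradient of p. Since
  p is C^1 up to and beyond the boundary of the compact cell, both are bounded on it.\<close>

lemma piecewise_C1_bounded:
  assumes s: "s \<in> H1 \<Omega>" and K: "compact K"
    and p: "Ck 1 p" "AE x in lebesgue_on (interior K \<inter> \<Omega>). s x = p x"
  shows "\<exists>B. AE x in lebesgue. x \<in> interior K \<inter> \<Omega> \<longrightarrow> \<bar>s x\<bar> \<le> B \<and> norm (weak_grad \<Omega> s x) \<le> B"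
proof -
  define G where "G = interior K \<inter> \<Omega>"
  have G: "open G" "bounded G" "G \<subseteq> \<Omega>" "G \<subseteq> K"
    using open_domain bounded_domain interior_subset[of K] by (auto simp: G_def intro: bounded_subset)
  have sG: "G \<in> sets lebesgue" using G(1) by simp
  note S = H1D[OF s]
  define g where "g = weak_grad \<Omega> s"
  have gL: "g \<in> L2 \<Omega>" using S(2) by (simp add: g_def)
  have restrict: "integrable (lebesgue_on G) f" if "integrable M f" for f :: "'a \<Rightarrow> real"
  proof -
    have "integrable lebesgue (\<lambda>x. indicator G x *\<^sub>R (indicator \<Omega> x *\<^sub>R f x))"
      by (rule integrable_mult_indicator[OF sG integral_lebesgue_on_indicator(2)[OF sets_domain, THEN iffD1, OF that]])
    also have "(\<lambda>x. indicator G x *\<^sub>R (indicator \<Omega> x *\<^sub>R f x)) = (\<lambda>x. indicator G x *\<^sub>R f x)"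
      using G(3) by (auto simp: indicator_def fun_eq_iff)
    finally show ?thesis by (subst integral_lebesgue_on_indicator(2)[OF sG])
  qed
  have "bounded (p ` K)" "bounded (grad p ` K)"
    using K Ck_imp_continuous[OF p(1)] grad_continuous[OF p(1)]
    by (meson compact_continuous_image compact_imp_bounded continuous_on_subset subset_UNIV)+
  then obtain B1 B2 where B: "\<And>x. x \<in> K \<Longrightarrow> \<bar>p x\<bar> \<le> B1" "\<And>x. x \<in> K \<Longrightarrow> norm (grad p x) \<le> B2"
    by (auto simp: bounded_iff)
  have "AE x in lebesgue_on G. g x \<bullet> i - partial i p x = 0" if i: "i \<in> Basis" for i
  proof (rule fundamental_lemma[OF G(1,2)])
    have ig: "integrable (lebesgue_on G) (\<lambda>x. g x \<bullet> i)"
      by (rule restrict[OF L2_integrable[OF L2_component[OF gL i]]])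
    have bp: "\<bar>partial i p x\<bar> \<le> B2" if "x \<in> K" for x
      using Basis_le_norm[OF i, of "grad p x"] B(2)[OF that] i by simp
    have "bounded_domain G" using G by unfold_locales
    then have c: "integrable (lebesgue_on G) (\<lambda>x. 1 :: real)"
      by (rule bounded_domain.integrable_const_domain)
    have mp: "partial i p \<in> borel_measurable (lebesgue_on G)"
      by (rule borel_measurable_lebesgue_on_continuous[OF Ck_1_partial_continuous[OF p(1) i]])
    have ip: "integrable (lebesgue_on G) (\<lambda>x. partial i p x)"
    proof -
      have "AE x in lebesgue_on G. \<bar>partial i p x\<bar> \<le> B2"
        using bp G(4) by (intro AE_I2) auto
      from integrable_bounded_mult[OF c mp this] show ?thesis by simp
    qed
    show "integrable (lebesgue_on G) (\<lambda>x. g x \<bullet> i - partial i p x)"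
      using ig ip by simp
    fix \<phi> assume t: "\<phi> \<in> test_functions G"
    obtain L where L: "compact L" "L \<subseteq> G" "\<And>x. x \<notin> L \<Longrightarrow> \<phi> x = 0" "smooth \<phi>"
      using test_functionsD[OF t] by blast
    have t': "\<phi> \<in> test_functions \<Omega>"
      by (rule test_functionsI[OF L(4,1) order_trans[OF L(2) G(3)] L(3)])
    have z: "\<phi> x = 0" "partial i \<phi> x = 0" if "x \<notin> G" for x
    proof -
      have x: "x \<notin> L" using L(2) that by blast
      show "\<phi> x = 0" by (rule L(3)[OF x])
      show "partial i \<phi> x = 0"
        by (rule partial_zero_outside[OF compact_imp_closed[OF L(1)] L(3) x])
    qed
    \<comment> \<open>A factor vanishing off the smaller set makes the integrals over the domain and
      over the cell part coincide, which localises the defining identity of the weak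
      gradient.\<close>
    have swap: "(LINT x|M. f x * h x) = (LINT x|lebesgue_on G. f x * h x)" if "\<And>x. x \<notin> G \<Longrightarrow> h x = 0"
      for f h :: "'a \<Rightarrow> real"
    proof -
      have "f x * h x = 0" if "x \<notin> \<Omega>" for x using \<open>\<And>x. x \<notin> G \<Longrightarrow> h x = 0\<close>[of x] G(3) that by auto
      moreover have "f x * h x = 0" if "x \<notin> G" for x using \<open>\<And>x. x \<notin> G \<Longrightarrow> h x = 0\<close>[OF that] by simp
      ultimately show ?thesis
        using lebesgue_on_eq_lebesgue(1)[OF sets_domain, of "\<lambda>x. f x * h x"]
          lebesgue_on_eq_lebesgue(1)[OF sG, of "\<lambda>x. f x * h x"] by presburger
    qed
    have "- (LINT x|lebesgue_on G. (g x \<bullet> i) * \<phi> x) = (LINT x|lebesgue_on G. s x * partial i \<phi> x)"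
      using has_weak_gradD[OF S(3) t' i] z by (simp add: swap[symmetric] g_def)
    also have "\<dots> = (LINT x|lebesgue_on G. p x * partial i \<phi> x)"
    proof (rule integral_cong_AE)
      show "AE x in lebesgue_on G. s x * partial i \<phi> x = p x * partial i \<phi> x"
        using p(2) unfolding G_def by eventually_elim simp
      have "s \<in> borel_measurable (lebesgue_on G)"
        using restrict[OF L2_integrable[OF S(1)]] by auto
      moreover have "p \<in> borel_measurable (lebesgue_on G)" "partial i \<phi> \<in> borel_measurable (lebesgue_on G)"
        using Ck_imp_continuous[OF p(1)] Ck_1_partial_continuous[OF smooth_1[OF L(4)] i]
        by (auto intro: borel_measurable_lebesgue_on_continuous)
      ultimately show "(\<lambda>x. s x * partial i \<phi> x) \<in> borel_measurable (lebesgue_on G)"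
        "(\<lambda>x. p x * partial i \<phi> x) \<in> borel_measurable (lebesgue_on G)" by auto
    qed
    also have "\<dots> = - (LINT x|lebesgue_on G. partial i p x * \<phi> x)"
      by (rule integral_by_parts[OF p(1) smooth_1[OF L(4)] L(1-3) i sG])
    finally have eq: "(LINT x|lebesgue_on G. (g x \<bullet> i) * \<phi> x) = (LINT x|lebesgue_on G. partial i p x * \<phi> x)"
      by simp
    obtain C where C: "\<And>x. \<bar>\<phi> x\<bar> \<le> C" using test_function_facts(6)[OF t'] by blast
    have mphi: "\<phi> \<in> borel_measurable (lebesgue_on G)"
      by (rule borel_measurable_lebesgue_on_continuous[OF Ck_imp_continuous[OF smooth_1[OF L(4)]]])
    have "integrable (lebesgue_on G) (\<lambda>x. (g x \<bullet> i) * \<phi> x)" "integrable (lebesgue_on G) (\<lambda>x. partial i p x * \<phi> x)"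
      using C by (intro integrable_bounded_mult[OF ig mphi] integrable_bounded_mult[OF ip mphi] AE_I2; blast)+
    then show "(LINT x|lebesgue_on G. (g x \<bullet> i - partial i p x) * \<phi> x) = 0"
      using eq by (simp add: left_diff_distrib)
  qed
  then have "AE x in lebesgue_on G. \<forall>i\<in>Basis. g x \<bullet> i - partial i p x = 0"
    by (intro AE_finite_allI) auto
  then have "AE x in lebesgue_on G. s x = p x \<and> g x = grad p x"
    using p(2)[folded G_def] by eventually_elim (auto intro: euclidean_eqI)
  then have "AE x in lebesgue. x \<in> G \<longrightarrow> s x = p x \<and> g x = grad p x"
    using sG by (subst (asm) AE_restrict_space_iff) auto
  then have "AE x in lebesgue. x \<in> G \<longrightarrow> \<bar>s x\<bar> \<le> max B1 B2 \<and> norm (g x) \<le> max B1 B2"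
    by eventually_elim (use B G(4) in \<open>auto simp: le_max_iff_disj\<close>)
  then show ?thesis unfolding G_def g_def by blast
qed

text \<open>Finitely many cells cover the domain and their frontiers are negligible, so almost every
  point lies in the interior of some cell and the maximum of the cell bounds works.\<close>

lemma fe_function_bounded:
  assumes V: "fe_space \<Omega> h V" and s: "s \<in> V"
  obtains B where "B > 0" "AE x in M. \<bar>s x\<bar> \<le> B" "AE x in M. norm (weak_grad \<Omega> s x) \<le> B"
proof -
  obtain T where T: "mesh \<Omega> h T"
    and pc: "\<And>v K. v \<in> V \<Longrightarrow> K \<in> T \<Longrightarrow> \<exists>p. Ck 1 p \<and> (AE x in lebesgue_on (interior K \<inter> \<Omega>). v x = p x)"
    using V unfolding fe_space_def by blast
  have s1: "s \<in> H1 \<Omega>" using V s unfolding fe_space_def by blast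
  have fin: "finite T" and cov: "\<Omega> \<subseteq> \<Union> T"
    and cell: "\<And>K. K \<in> T \<Longrightarrow> compact K" "\<And>K. K \<in> T \<Longrightarrow> negligible (frontier K)"
    using T unfolding mesh_def by auto
  have "\<forall>K\<in>T. \<exists>B. AE x in lebesgue. x \<in> interior K \<inter> \<Omega> \<longrightarrow> \<bar>s x\<bar> \<le> B \<and> norm (weak_grad \<Omega> s x) \<le> B"
  proof
    fix K assume K: "K \<in> T"
    obtain p where "Ck 1 p" "AE x in lebesgue_on (interior K \<inter> \<Omega>). s x = p x" using pc[OF s K] by blast
    from piecewise_C1_bounded[OF s1 cell(1)[OF K] this]
    show "\<exists>B. AE x in lebesgue. x \<in> interior K \<inter> \<Omega> \<longrightarrow> \<bar>s x\<bar> \<le> B \<and> norm (weak_grad \<Omega> s x) \<le> B" .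
  qed
  from bchoice[OF this] obtain b where b:
    "\<And>K. K \<in> T \<Longrightarrow> AE x in lebesgue. x \<in> interior K \<inter> \<Omega> \<longrightarrow> \<bar>s x\<bar> \<le> b K \<and> norm (weak_grad \<Omega> s x) \<le> b K"
    by blast
  \<comment> \<open>The inserted 1 makes the bound positive.\<close>
  define B where "B = Max (insert 1 (b ` T))"
  have B: "B > 0" "\<And>K. K \<in> T \<Longrightarrow> b K \<le> B"
    unfolding B_def using fin by (auto simp: Max_gr_iff)
  have "AE x in lebesgue. \<forall>K\<in>T. x \<in> interior K \<inter> \<Omega> \<longrightarrow> \<bar>s x\<bar> \<le> b K \<and> norm (weak_grad \<Omega> s x) \<le> b K"
    using fin b by (intro AE_finite_allI) auto
  moreover have "AE x in lebesgue. \<forall>K\<in>T. x \<notin> frontier K"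
    using fin cell(2) by (intro AE_finite_allI) (auto simp: negligible_iff_null_sets AE_not_in)
  ultimately have "AE x in lebesgue. x \<in> \<Omega> \<longrightarrow> \<bar>s x\<bar> \<le> B \<and> norm (weak_grad \<Omega> s x) \<le> B"
  proof eventually_elim
    case (elim x)
    show ?case
    proof
      assume x: "x \<in> \<Omega>"
      then obtain K where K: "K \<in> T" "x \<in> K" using cov by blast
      then have "x \<in> interior K"
        using elim(2) compact_imp_closed[OF cell(1)[OF K(1)]] by (auto simp: frontier_def)
      then show "\<bar>s x\<bar> \<le> B \<and> norm (weak_grad \<Omega> s x) \<le> B"
        using elim(1) K(1) x B(2)[OF K(1)] by force
    qed
  qed
  then have "AE x in M. \<bar>s x\<bar> \<le> B \<and> norm (weak_grad \<Omega> s x) \<le> B"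
    using sets_domain by (subst AE_restrict_space_iff) auto
  then show ?thesis using that B(1) by auto
qed

end

section \<open>The discrete problem\<close>

text \<open>
  The Lax--Milgram lemma for finite spanning sets, by induction on the spanning set: after removing
  from the new vector \<open>w\<close> its component \<open>z\<close> with \<open>a z v = a w v\<close>, the remaining equation is
  one-dimensional.
\<close>

lemma galerkin_solvable:
  fixes a :: "('a \<Rightarrow> real) \<Rightarrow> ('a \<Rightarrow> real) \<Rightarrow> real" and F :: "('a \<Rightarrow> real) \<Rightarrow> real"
  assumes zero: "(\<lambda>x. 0) \<in> U"
    and add: "\<And>u v. u \<in> U \<Longrightarrow> v \<in> U \<Longrightarrow> (\<lambda>x. u x + v x) \<in> U"
    and scale: "\<And>u c. u \<in> U \<Longrightarrow> (\<lambda>x. c * u x) \<in> U"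
    and a_left: "\<And>u v w c. u \<in> U \<Longrightarrow> v \<in> U \<Longrightarrow> w \<in> U \<Longrightarrow> a (\<lambda>x. u x + c * v x) w = a u w + c * a v w"
    and a_right: "\<And>u v w c. u \<in> U \<Longrightarrow> v \<in> U \<Longrightarrow> w \<in> U \<Longrightarrow> a w (\<lambda>x. u x + c * v x) = a w u + c * a w v"
    and degenerate: "\<And>u v. u \<in> U \<Longrightarrow> v \<in> U \<Longrightarrow> a u u = 0 \<Longrightarrow> a v u = 0"
    and B: "finite B" "B \<subseteq> U"
    and F_lin: "\<And>u v c. u \<in> U \<Longrightarrow> v \<in> U \<Longrightarrow> F (\<lambda>x. u x + c * v x) = F u + c * F v"
    and F_degenerate: "\<And>u. u \<in> U \<Longrightarrow> a u u = 0 \<Longrightarrow> F u = 0"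
  shows "\<exists>u c. u = (\<lambda>x. \<Sum>w\<in>B. c w * w x) \<and> u \<in> U \<and> (\<forall>v\<in>B. a u v = F v)"
  using B F_lin F_degenerate
proof (induction B arbitrary: F rule: finite_induct)
  case empty
  then show ?case using zero by simp
next
  case (insert w B)
  have w: "w \<in> U" and BU: "B \<subseteq> U" using insert.prems by auto
  note F_lin' = insert.prems(2)
  obtain u0 c0 where u0: "u0 = (\<lambda>x. \<Sum>w\<in>B. c0 w * w x)" "u0 \<in> U" "\<And>v. v \<in> B \<Longrightarrow> a u0 v = F v"
  proof -
    have "\<exists>u c. u = (\<lambda>x. \<Sum>w\<in>B. c w * w x) \<and> u \<in> U \<and> (\<forall>v\<in>B. a u v = F v)"
      by (rule insert.IH[OF BU]) (simp_all add: insert.prems(2,3))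
    then show ?thesis using that by blast
  qed
  \<comment> \<open>The induction hypothesis again, now with the functional \<open>a w\<close> in
    place of F; this is why F is generalised.\<close>
  obtain z cz where z: "z = (\<lambda>x. \<Sum>w\<in>B. cz w * w x)" "z \<in> U" "\<And>v. v \<in> B \<Longrightarrow> a z v = a w v"
  proof -
    have "\<exists>u c. u = (\<lambda>x. \<Sum>w\<in>B. c w * w x) \<and> u \<in> U \<and> (\<forall>v\<in>B. a u v = a w v)"
      by (rule insert.IH[OF BU]) (simp_all add: a_right w degenerate)
    then show ?thesis using that by blast
  qed
  \<comment> \<open>Since \<open>a\<close> need not be symmetric, orthogonality is one-sided:
    \<open>a w' v = 0\<close> for v in B. Adding multiples of w' to u0 thus preserves the equations
    already solved.\<close>
  define w' where "w' x = w x + (- 1) * z x" for x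
  have w': "w' \<in> U" unfolding w'_def using add[OF w scale[OF z(2), of "-1"]] .
  have a_lin: "a u v = (\<Sum>w\<in>B. d w * a u w)" if "v = (\<lambda>x. \<Sum>w\<in>B. d w * w x)" "u \<in> U" for u v d
  proof -
    have "(\<lambda>x. \<Sum>w\<in>A. d w * w x) \<in> U \<and> a u (\<lambda>x. \<Sum>w\<in>A. d w * w x) = (\<Sum>w\<in>A. d w * a u w)"
      if "finite A" "A \<subseteq> U" for A
      using that
    proof (induction A rule: finite_induct)
      case empty
      have "a u (\<lambda>x. 0 + 1 * 0) = a u (\<lambda>x. 0) + 1 * a u (\<lambda>x. 0)"
        by (rule a_right[OF zero zero \<open>u \<in> U\<close>])
      then show ?case using zero by simp
    next
      case (insert y A)
      then have y: "y \<in> U" and A: "(\<lambda>x. \<Sum>w\<in>A. d w * w x) \<in> U"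
        "a u (\<lambda>x. \<Sum>w\<in>A. d w * w x) = (\<Sum>w\<in>A. d w * a u w)" by auto
      show ?case
        using a_right[OF A(1) y \<open>u \<in> U\<close>, of "d y"] add[OF A(1) scale[OF y, of "d y"]] A(2) insert(1,2)
        by (simp add: add.commute)
    qed
    then show ?thesis using that(1) insert.hyps(1) BU by blast
  qed
  have w'B: "a w' v = 0" if "v \<in> B" for v
    unfolding w'_def using a_left[OF w z(2), of v "-1"] z(3)[OF that] that BU by auto
  have w'z: "a w' z = 0"
    using a_lin[OF z(1) w'] w'B by simp
  have w'w: "a w' w' = a w' w"
    using a_right[OF w z(2) w', of "-1"] w'z by (simp add: w'_def[abs_def])
  \<comment> \<open>If w' is degenerate, then w and z are indistinguishable both for
    \<open>a u0\<close> and for F, so the equation at w follows from those on B and t = 0 serves.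
    Otherwise t solves a scalar equation. The first case arises when the spanning set is dependent
    up to null functions.\<close>
  obtain t where t: "a u0 w + t * a w' w = F w"
  proof (cases "a w' w' = 0")
    case False
    then show ?thesis using w'w that[of "(F w - a u0 w) / a w' w"] by simp
  next
    case True
    have "a u0 w' = 0" "F w' = 0"
      using degenerate[OF w' u0(2) True] insert.prems(3)[OF w' True] by auto
    then have "a u0 w = a u0 z" "F w = F z"
      using a_right[OF w z(2) u0(2), of "-1"] insert.prems(2)[OF w z(2), of "-1"]
      by (auto simp: w'_def[abs_def])
    moreover have "a u0 z = F z"
    proof -
      have "F (\<lambda>x. \<Sum>w\<in>A. cz w * w x) = (\<Sum>w\<in>A. cz w * F w) \<and> (\<lambda>x. \<Sum>w\<in>A. cz w * w x) \<in> U"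
        if "finite A" "A \<subseteq> U" for A
        using that
      proof (induction A rule: finite_induct)
        case empty
        have "F (\<lambda>x. 0 + 1 * 0) = F (\<lambda>x. 0) + 1 * F (\<lambda>x. 0)"
          by (rule F_lin'[OF zero zero])
        then show ?case using zero by simp
      next
        case (insert y A)
        then have y: "y \<in> U" and A: "(\<lambda>x. \<Sum>w\<in>A. cz w * w x) \<in> U"
          "F (\<lambda>x. \<Sum>w\<in>A. cz w * w x) = (\<Sum>w\<in>A. cz w * F w)" by auto
        show ?case
          using F_lin'[OF A(1) y, of "cz y"] add[OF A(1) scale[OF y, of "cz y"]] A(2) insert(1,2)
          by (simp add: add.commute)
      qed
      then have "F z = (\<Sum>w\<in>B. cz w * F w)" using z(1) insert.hyps(1) BU by blast
      then show ?thesis using a_lin[OF z(1) u0(2)] u0(3) by simp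
    qed
    ultimately show ?thesis using that[of 0] True w'w by simp
  qed
  define u where "u x = u0 x + t * w' x" for x
  \<comment> \<open>Coefficients of u0 + t (w - z), read off with respect to the enlarged spanning
    set.\<close>
  define c where "c y = (if y = w then t else c0 y - t * cz y)" for y
  have uU: "u \<in> U" unfolding u_def using add[OF u0(2) scale[OF w']] .
  have a_u: "a u v = a u0 v + t * a w' v" if "v \<in> U" for v
    unfolding u_def by (rule a_left[OF u0(2) w' that])
  have "u = (\<lambda>x. \<Sum>y\<in>insert w B. c y * y x)"
  proof
    fix x
    have "(\<Sum>y\<in>insert w B. c y * y x) = t * w x + (\<Sum>y\<in>B. (c0 y - t * cz y) * y x)"
      using insert.hyps by (auto simp: c_def intro!: sum.cong)
    also have "\<dots> = t * w x + u0 x - t * z x"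
      by (simp add: u0(1) z(1) left_diff_distrib sum_subtractf sum_distrib_left mult.assoc)
    finally show "u x = (\<Sum>y\<in>insert w B. c y * y x)" by (simp add: u_def w'_def algebra_simps)
  qed
  moreover have "\<forall>v\<in>insert w B. a u v = F v"
    using t a_u[OF w] a_u u0(3) w'B BU by (auto simp: subset_iff)
  ultimately show ?case using uU by blast
qed

section \<open>Null functions and the dual norm\<close>

context bounded_domain
begin

lemma zero_H10: "(\<lambda>x. 0) \<in> H10 \<Omega>"
  by (intro test_H10 test_functionsI[of _ "{}"]) (auto intro: Ck_const)

lemma H1_combination:
  assumes u: "u \<in> H1 \<Omega>" and v: "v \<in> H1 \<Omega>"
  shows "(\<lambda>x. u x + k * v x) \<in> H1 \<Omega>"
    "(\<lambda>x. weak_grad \<Omega> u x + k *\<^sub>R weak_grad \<Omega> v x) \<in> L2 \<Omega>"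
    "AE x in M. weak_grad \<Omega> (\<lambda>x. u x + k * v x) x = weak_grad \<Omega> u x + k *\<^sub>R weak_grad \<Omega> v x"
proof -
  note C = H1_cmult[OF v, of k]
  show "(\<lambda>x. u x + k * v x) \<in> H1 \<Omega>" by (rule H1_add(1)[OF u C(1)])
  show "(\<lambda>x. weak_grad \<Omega> u x + k *\<^sub>R weak_grad \<Omega> v x) \<in> L2 \<Omega>"
    by (rule L2_add[OF H1D(2)[OF u] L2_scaleR[OF H1D(2)[OF v]]])
  show "AE x in M. weak_grad \<Omega> (\<lambda>x. u x + k * v x) x = weak_grad \<Omega> u x + k *\<^sub>R weak_grad \<Omega> v x"
    using H1_add(2)[OF u C(1)] C(2) by eventually_elim simp
qed

text \<open>A vanishing norm forces both the function and its gradient to vanish almost everywhere,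
  hence the integrand too. This is the degeneracy condition that the algebraic solver asks
  for.\<close>

lemma a_ss_null:
  assumes u: "u \<in> H1 \<Omega>" and v: "v \<in> H1 \<Omega>" and z: "H1_norm \<Omega> u = 0"
  shows "a_ss \<Omega> b s v u = 0"
  unfolding a_ss_def
proof (rule integral_eq_zero_AE)
  show "AE x in M. s x * (weak_grad \<Omega> v x \<bullet> weak_grad \<Omega> u x) +
      flux \<Omega> b s x \<bullet> ((u x *\<^sub>R weak_grad \<Omega> v x - v x *\<^sub>R weak_grad \<Omega> u x) /\<^sub>R 2) = 0"
    using H1_norm_eq_0[OF u z] by eventually_elim simp
qed

text \<open>Without an upper bound the real supremum in \<open>Hneg1_norm\<close> would carry no
  information.\<close>

lemma Hneg1_bdd:
  assumes f: "f \<in> Hneg1 \<Omega>"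
  shows "bdd_above ((\<lambda>v. \<bar>f v\<bar>) ` {v \<in> H10 \<Omega>. H1_norm \<Omega> v \<le> 1})"
proof -
  obtain K where K: "\<And>u. u \<in> H10 \<Omega> \<Longrightarrow> \<bar>f u\<bar> \<le> K * H1_norm \<Omega> u"
    using f unfolding Hneg1_def by blast
  show ?thesis
  proof (rule bdd_aboveI2)
    fix w assume "w \<in> {v \<in> H10 \<Omega>. H1_norm \<Omega> v \<le> 1}"
    then have w: "w \<in> H10 \<Omega>" "H1_norm \<Omega> w \<le> 1" by auto
    have "K * H1_norm \<Omega> w \<le> \<bar>K\<bar> * 1"
      using w(2) H1_norm_nonneg[of w] by (intro mult_mono) auto
    then show "\<bar>f w\<bar> \<le> \<bar>K\<bar>" using K[OF w(1)] by simp
  qed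
qed

lemma Hneg1_norm_nonneg:
  assumes f: "f \<in> Hneg1 \<Omega>"
  shows "Hneg1_norm \<Omega> f \<ge> 0"
proof -
  have "(\<lambda>x. 0) \<in> {v \<in> H10 \<Omega>. H1_norm \<Omega> v \<le> 1}"
    using zero_H10 H1_norm_AE_0[OF zero_H1] by simp
  then have "\<bar>f (\<lambda>x. 0)\<bar> \<le> Hneg1_norm \<Omega> f"
    unfolding Hneg1_norm_def using Hneg1_bdd[OF f] by (rule cSUP_upper)
  then show ?thesis by simp
qed

text \<open>Normalise v and use homogeneity. Functions of norm zero cannot be normalised; for them
  the bound in the definition of the dual gives the claim directly.\<close>

lemma Hneg1_bound:
  assumes f: "f \<in> Hneg1 \<Omega>" and v: "v \<in> H10 \<Omega>"
  shows "\<bar>f v\<bar> \<le> Hneg1_norm \<Omega> f * H1_norm \<Omega> v"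
proof -
  obtain K where K: "\<And>u. u \<in> H10 \<Omega> \<Longrightarrow> \<bar>f u\<bar> \<le> K * H1_norm \<Omega> u"
    using f unfolding Hneg1_def by blast
  have sc: "f (\<lambda>x. k * u x) = k * f u" if "u \<in> H10 \<Omega>" for k u
    using f that by (auto simp: Hneg1_def)
  show ?thesis
  proof (cases "H1_norm \<Omega> v = 0")
    case True
    then show ?thesis using K[OF v] by simp
  next
    case False
    then have n: "H1_norm \<Omega> v > 0" using H1_norm_nonneg[of v] by simp
    define u where "u x = inverse (H1_norm \<Omega> v) * v x" for x
    have uH: "u \<in> H10 \<Omega>" unfolding u_def by (rule H10_cmult[OF v])
    have "H1_norm \<Omega> u = 1"
      unfolding u_def using H1_norm_cmult[OF H10_H1[OF v], of "inverse (H1_norm \<Omega> v)"] n by simp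
    then have "\<bar>f u\<bar> \<le> Hneg1_norm \<Omega> f"
      unfolding Hneg1_norm_def using uH by (intro cSUP_upper Hneg1_bdd[OF f]) auto
    moreover have "f u = inverse (H1_norm \<Omega> v) * f v" unfolding u_def by (rule sc[OF v])
    ultimately show ?thesis using n by (simp add: abs_mult field_simps)
  qed
qed

section \<open>The skew-symmetric form for a bounded weight with a positive lower bound\<close>

context
  fixes s :: "'a \<Rightarrow> real" and b :: "'a \<Rightarrow> 'a" and B c :: real
  assumes sH1: "s \<in> H1 \<Omega>" and sB: "AE x in M. \<bar>s x\<bar> \<le> B"
    and gB: "AE x in M. norm (weak_grad \<Omega> s x) \<le> B" and Bpos: "B > 0"
    and b: "b \<in> Linf \<Omega>" and c: "c > 0" "AE x in M. c \<le> s x"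
begin

text \<open>A bounded flux is what makes the products of a function, the flux and a gradient
  integrable when function and gradient are only square integrable.\<close>

lemma flux_bounded:
  "flux \<Omega> b s \<in> borel_measurable M" "\<exists>D. AE x in M. norm (flux \<Omega> b s x) \<le> D"
proof -
  obtain N where bm: "b \<in> borel_measurable M" and N: "AE x in M. norm (b x) \<le> N"
    using b by (auto simp: Linf_def)
  show "flux \<Omega> b s \<in> borel_measurable M"
    unfolding flux_def using bm L2_measurable[OF H1D(1)[OF sH1]] L2_measurable[OF H1D(2)[OF sH1]]
    by measurable
  have "AE x in M. norm (flux \<Omega> b s x) \<le> B + B * N"
    using N sB gB
  proof eventually_elim
    case (elim x)
    have "norm (flux \<Omega> b s x) \<le> norm (weak_grad \<Omega> s x) + \<bar>s x\<bar> * norm (b x)"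
      unfolding flux_def using norm_triangle_ineq[of "weak_grad \<Omega> s x" "s x *\<^sub>R b x"] by simp
    also have "\<dots> \<le> B + B * N" using elim Bpos by (intro add_mono mult_mono) auto
    finally show ?case .
  qed
  then show "\<exists>D. AE x in M. norm (flux \<Omega> b s x) \<le> D" by blast
qed

text \<open>Gradients are arguments of their own, so that chosen weak gradients can be replaced by
  almost equal representatives; in this form bilinearity is a pointwise identity.\<close>

definition ss_integrand :: "('a \<Rightarrow> real) \<Rightarrow> ('a \<Rightarrow> 'a) \<Rightarrow> ('a \<Rightarrow> real) \<Rightarrow> ('a \<Rightarrow> 'a) \<Rightarrow> 'a \<Rightarrow> real" where
  "ss_integrand u g v h x = s x * (g x \<bullet> h x) + flux \<Omega> b s x \<bullet> ((v x *\<^sub>R g x - u x *\<^sub>R h x) /\<^sub>R 2)"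

lemma ss_integrand_integrable:
  assumes u: "u \<in> L2 \<Omega>" and g: "g \<in> L2 \<Omega>" and v: "v \<in> L2 \<Omega>" and h: "h \<in> L2 \<Omega>"
  shows "integrable M (ss_integrand u g v h)"
proof -
  obtain D where D: "AE x in M. norm (flux \<Omega> b s x) \<le> D" using flux_bounded(2) by blast
  have 1: "integrable M (\<lambda>x. s x * (g x \<bullet> h x))"
    using integrable_bounded_mult[OF L2_inner_integrable[OF g h] L2_measurable[OF H1D(1)[OF sH1]] sB]
    by (simp add: mult.commute)
  have 2: "integrable M (\<lambda>x. v x * (flux \<Omega> b s x \<bullet> g x))" "integrable M (\<lambda>x. u x * (flux \<Omega> b s x \<bullet> h x))"
    using L2_inner_integrable[OF L2_bounded_mult[OF v flux_bounded(1) D] g]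
      L2_inner_integrable[OF L2_bounded_mult[OF u flux_bounded(1) D] h] by auto
  have eq: "ss_integrand u g v h = (\<lambda>x. s x * (g x \<bullet> h x) +
      (v x * (flux \<Omega> b s x \<bullet> g x) - u x * (flux \<Omega> b s x \<bullet> h x)) / 2)"
    by (auto simp: ss_integrand_def inner_diff_right)
  show ?thesis
    unfolding eq
    by (rule Bochner_Integration.integrable_add[OF 1 integrable_divide_zero[OF Bochner_Integration.integrable_diff[OF 2]]])
qed

lemma a_ss_eq:
  assumes u: "u \<in> H1 \<Omega>" and v: "v \<in> H1 \<Omega>"
    and g: "g \<in> L2 \<Omega>" "AE x in M. weak_grad \<Omega> u x = g x"
    and h: "h \<in> L2 \<Omega>" "AE x in M. weak_grad \<Omega> v x = h x"
  shows "a_ss \<Omega> b s u v = integral\<^sup>L M (ss_integrand u g v h)"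
  unfolding a_ss_def
proof (rule integral_cong_AE)
  show "AE x in M. s x * (weak_grad \<Omega> u x \<bullet> weak_grad \<Omega> v x) +
      flux \<Omega> b s x \<bullet> ((v x *\<^sub>R weak_grad \<Omega> u x - u x *\<^sub>R weak_grad \<Omega> v x) /\<^sub>R 2) = ss_integrand u g v h x"
    using g(2) h(2) by eventually_elim (simp add: ss_integrand_def)
  show "ss_integrand u g v h \<in> borel_measurable M"
    using ss_integrand_integrable[OF H1D(1)[OF u] g(1) H1D(1)[OF v] h(1)] by auto
  have "ss_integrand u (weak_grad \<Omega> u) v (weak_grad \<Omega> v) \<in> borel_measurable M"
    using ss_integrand_integrable[OF H1D(1,2)[OF u] H1D(1,2)[OF v]] by auto
  then show "(\<lambda>x. s x * (weak_grad \<Omega> u x \<bullet> weak_grad \<Omega> v x) +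
      flux \<Omega> b s x \<bullet> ((v x *\<^sub>R weak_grad \<Omega> u x - u x *\<^sub>R weak_grad \<Omega> v x) /\<^sub>R 2)) \<in> borel_measurable M"
    by (simp add: ss_integrand_def[abs_def])
qed

lemma a_ss_linear:
  assumes u: "u \<in> H1 \<Omega>" and v: "v \<in> H1 \<Omega>" and w: "w \<in> H1 \<Omega>"
  shows "a_ss \<Omega> b s (\<lambda>x. u x + k * v x) w = a_ss \<Omega> b s u w + k * a_ss \<Omega> b s v w"
    and "a_ss \<Omega> b s w (\<lambda>x. u x + k * v x) = a_ss \<Omega> b s w u + k * a_ss \<Omega> b s w v"
proof -
  note U = H1D(1,2)[OF u] and V = H1D(1,2)[OF v] and W = H1D(1,2)[OF w]
  note C = H1_combination[OF u v, of k]
  note r = a_ss_eq[OF _ _ _ AE_I2[OF refl] _ AE_I2[OF refl]]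
  note I = ss_integrand_integrable
  have "a_ss \<Omega> b s (\<lambda>x. u x + k * v x) w = (LINT x|M. ss_integrand u (weak_grad \<Omega> u) w (weak_grad \<Omega> w) x
      + k * ss_integrand v (weak_grad \<Omega> v) w (weak_grad \<Omega> w) x)"
    unfolding a_ss_eq[OF C(1) w C(2,3) W(2) AE_I2[OF refl]]
    by (intro Bochner_Integration.integral_cong)
      (auto simp: ss_integrand_def inner_add_left inner_add_right inner_diff_right algebra_simps)
  then show "a_ss \<Omega> b s (\<lambda>x. u x + k * v x) w = a_ss \<Omega> b s u w + k * a_ss \<Omega> b s v w"
    using I[OF U W] I[OF V W] by (simp add: r[OF u w U(2) W(2)] r[OF v w V(2) W(2)])
  have "a_ss \<Omega> b s w (\<lambda>x. u x + k * v x) = (LINT x|M. ss_integrand w (weak_grad \<Omega> w) u (weak_grad \<Omega> u) x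
      + k * ss_integrand w (weak_grad \<Omega> w) v (weak_grad \<Omega> v) x)"
    unfolding a_ss_eq[OF w C(1) W(2) AE_I2[OF refl] C(2,3)]
    by (intro Bochner_Integration.integral_cong)
      (auto simp: ss_integrand_def inner_add_left inner_add_right inner_diff_right algebra_simps)
  then show "a_ss \<Omega> b s w (\<lambda>x. u x + k * v x) = a_ss \<Omega> b s w u + k * a_ss \<Omega> b s w v"
    using I[OF W U] I[OF W V] by (simp add: r[OF w u W(2) U(2)] r[OF w v W(2) V(2)])
qed

text \<open>The diagonal of the form is at least c times the squared L^2 norm of the gradient, and
  by the Poincare inequality the full squared norm is at most P + 1 times the latter; hence the
  constant c / (P + 1).\<close>

lemma a_ss_coercive: "coercive_on (H10 \<Omega>) (H1_norm \<Omega>) (a_ss \<Omega> b s)"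
proof -
  obtain P where P: "P > 0"
    "\<And>u. u \<in> H10 \<Omega> \<Longrightarrow> (LINT x|M. (u x)\<^sup>2) \<le> P * (LINT x|M. (norm (weak_grad \<Omega> u x))\<^sup>2)"
    using poincare by blast
  have "c / (P + 1) * (H1_norm \<Omega> u)\<^sup>2 \<le> a_ss \<Omega> b s u u" if u: "u \<in> H10 \<Omega>" for u
  proof -
    define I where "I = (LINT x|M. (norm (weak_grad \<Omega> u x))\<^sup>2)"
    note g = H1D(2)[OF H10_H1[OF u]]
    have eq: "a_ss \<Omega> b s u u = (LINT x|M. s x * (norm (weak_grad \<Omega> u x))\<^sup>2)"
      unfolding a_ss_def by (simp add: power2_norm_eq_inner)
    have i: "integrable M (\<lambda>x. s x * (norm (weak_grad \<Omega> u x))\<^sup>2)"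
      using integrable_bounded_mult[OF L2_square_integrable[OF g] L2_measurable[OF H1D(1)[OF sH1]] sB]
      by (simp add: mult.commute)
    have "c * I = (LINT x|M. c * (norm (weak_grad \<Omega> u x))\<^sup>2)" by (simp add: I_def)
    also have "\<dots> \<le> a_ss \<Omega> b s u u"
      unfolding eq
    proof (rule integral_mono_AE)
      show "AE x in M. c * (norm (weak_grad \<Omega> u x))\<^sup>2 \<le> s x * (norm (weak_grad \<Omega> u x))\<^sup>2"
        using c(2) by eventually_elim (simp add: mult_right_mono)
    qed (use i L2_square_integrable[OF g] in auto)
    finally have "c * I \<le> a_ss \<Omega> b s u u" .
    moreover have "(H1_norm \<Omega> u)\<^sup>2 \<le> (P + 1) * I"
      using P(2)[OF u] by (simp add: H1_norm_square I_def algebra_simps)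
    then have "c / (P + 1) * (H1_norm \<Omega> u)\<^sup>2 \<le> c / (P + 1) * ((P + 1) * I)"
      using c(1) P(1) by (intro mult_left_mono) auto
    moreover have "c / (P + 1) * ((P + 1) * I) = c * I" using P(1) by simp
    ultimately show ?thesis by linarith
  qed
  then show ?thesis
    unfolding coercive_on_def using c(1) P(1) by (intro exI[of _ "c / (P + 1)"]) auto
qed

text \<open>Testing with the solution itself gives \<alpha> times its squared norm on one side and f
  at s u on the other, and multiplication by s costs a factor 2 B. The coercivity constant is fixed
  on all of \<open>H10\<close> beforehand, so the bound is the same for every U.\<close>

lemma discrete_well_posed:
  assumes \<alpha>: "\<alpha> > 0" "\<And>u. u \<in> H10 \<Omega> \<Longrightarrow> \<alpha> * (H1_norm \<Omega> u)\<^sup>2 \<le> a_ss \<Omega> b s u u"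
    and U: "finite_dim_space \<Omega> U" "U \<subseteq> H10 \<Omega>"
  shows "well_posed \<Omega> b s U (2 * B / \<alpha>)"
  unfolding well_posed_def
proof
  fix f assume f: "f \<in> Hneg1 \<Omega>"
  define F where "F v = f (\<lambda>x. s x * v x)" for v
  note zero = U(1)[unfolded finite_dim_space_def, THEN conjunct1]
  have add: "(\<lambda>x. u x + v x) \<in> U" if "u \<in> U" "v \<in> U" for u v
    using U(1) that unfolding finite_dim_space_def by blast
  have scale: "(\<lambda>x. k * u x) \<in> U" if "u \<in> U" for u k
    using U(1) that unfolding finite_dim_space_def by blast
  obtain S where S: "finite S" "S \<subseteq> U"
    "\<And>v. v \<in> U \<Longrightarrow> \<exists>c. AE x in M. v x = (\<Sum>w\<in>S. c w * w x)"
    using U(1) unfolding finite_dim_space_def by blast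
  have H10: "u \<in> H10 \<Omega>" and H1: "u \<in> H1 \<Omega>" if "u \<in> U" for u
    using that U(2) H10_H1 by auto
  have sv: "(\<lambda>x. s x * v x) \<in> H10 \<Omega>" if "v \<in> H10 \<Omega>" for v
    by (rule mult_H10[OF sH1 sB gB Bpos that])
  have F_bound: "\<bar>F v\<bar> \<le> Hneg1_norm \<Omega> f * (2 * B * H1_norm \<Omega> v)" if v: "v \<in> H10 \<Omega>" for v
    unfolding F_def
    by (rule order_trans[OF Hneg1_bound[OF f sv[OF v]]
          mult_left_mono[OF mult_H10_norm(2)[OF sH1 sB gB Bpos v] Hneg1_norm_nonneg[OF f]]])
  have F_lin: "F (\<lambda>x. u x + k * v x) = F u + k * F v" if "u \<in> U" "v \<in> U" for u v k
  proof -
    have "(\<lambda>x. s x * (u x + k * v x)) = (\<lambda>x. s x * u x + k * (s x * v x))"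
      by (simp add: algebra_simps)
    then show ?thesis
      using f sv[OF H10[OF that(1)]] sv[OF H10[OF that(2)]] H10_cmult[OF sv[OF H10[OF that(2)]], of k]
      unfolding F_def Hneg1_def by simp
  qed
  have null: "H1_norm \<Omega> u = 0" if "u \<in> U" "a_ss \<Omega> b s u u = 0" for u
  proof -
    have "\<alpha> * (H1_norm \<Omega> u)\<^sup>2 \<le> 0" using \<alpha>(2)[OF H10[OF that(1)]] that(2) by simp
    then show ?thesis using \<alpha>(1) by (simp add: mult_le_0_iff)
  qed
  have F_null: "F u = 0" if "u \<in> U" "H1_norm \<Omega> u = 0" for u
    using F_bound[OF H10[OF that(1)]] that(2) by simp
  obtain u where u: "u \<in> U" "\<And>v. v \<in> S \<Longrightarrow> a_ss \<Omega> b s u v = F v"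
    using galerkin_solvable[where a="a_ss \<Omega> b s" and U=U and B=S and F=F,
        OF zero add scale a_ss_linear(1)[OF H1 H1 H1] a_ss_linear(2)[OF H1 H1 H1] a_ss_null[OF H1 H1 null]
        S(1,2) F_lin F_null[OF _ null]] by blast
  \<comment> \<open>The equations hold so far only on the spanning set. A general v is a combination
    of it up to a null function, which neither the form nor F can detect.\<close>
  have sol: "a_ss \<Omega> b s u v = F v" if v: "v \<in> U" for v
  proof -
    obtain k where k: "AE x in M. v x = (\<Sum>w\<in>S. k w * w x)" using S(3)[OF v] by blast
    have lin: "(\<lambda>x. \<Sum>w\<in>A. k w * w x) \<in> U \<and> a_ss \<Omega> b s u (\<lambda>x. \<Sum>w\<in>A. k w * w x) = F (\<lambda>x. \<Sum>w\<in>A. k w * w x)"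
      if "finite A" "A \<subseteq> S" for A
      using that
    proof (induction A rule: finite_induct)
      case empty
      have "H1_norm \<Omega> (\<lambda>x. 0) = 0" by (rule H1_norm_AE_0[OF zero_H1]) simp
      then show ?case
        using zero F_null[OF zero] a_ss_null[OF zero_H1 H1[OF u(1)]] by simp
    next
      case (insert y A)
      then have y: "y \<in> S" "y \<in> U" and A: "(\<lambda>x. \<Sum>w\<in>A. k w * w x) \<in> U"
        "a_ss \<Omega> b s u (\<lambda>x. \<Sum>w\<in>A. k w * w x) = F (\<lambda>x. \<Sum>w\<in>A. k w * w x)"
        using S(2) by auto
      have eq: "(\<lambda>x. \<Sum>w\<in>insert y A. k w * w x) = (\<lambda>x. (\<Sum>w\<in>A. k w * w x) + k y * y x)"
        using insert(1,2) by (simp add: add.commute)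
      show ?case
        unfolding eq a_ss_linear(2)[OF H1[OF A(1)] H1[OF y(2)] H1[OF u(1)]] F_lin[OF A(1) y(2)]
        using add[OF A(1) scale[OF y(2)]] A(2) u(2)[OF y(1)] by simp
    qed
    define z where "z x = (\<Sum>w\<in>S. k w * w x)" for x
    have z: "z \<in> U" "a_ss \<Omega> b s u z = F z" unfolding z_def using lin[OF S(1)] by auto
    define r where "r x = v x + (- 1) * z x" for x
    have rU: "r \<in> U" unfolding r_def by (rule add[OF v scale[OF z(1)]])
    have "AE x in M. r x = 0" using k by eventually_elim (simp add: r_def z_def)
    then have r0: "H1_norm \<Omega> r = 0" by (rule H1_norm_AE_0[OF H1[OF rU]])
    have "a_ss \<Omega> b s u v - a_ss \<Omega> b s u z = 0" "F v - F z = 0"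
      using a_ss_null[OF H1[OF rU] H1[OF u(1)] r0] F_null[OF rU r0]
        a_ss_linear(2)[OF H1[OF v] H1[OF z(1)] H1[OF u(1)], of "-1"] F_lin[OF v z(1), of "-1"]
      by (simp_all add: r_def[abs_def])
    then show ?thesis using z(2) by simp
  qed
  have solu: "discrete_solution \<Omega> b s U f u"
    unfolding discrete_solution_def using u(1) sol by (simp add: F_def)
  moreover have "AE x in M. w x = u x" if w: "discrete_solution \<Omega> b s U f w" for w
  proof -
    have wU: "w \<in> U" and wF: "\<And>v. v \<in> U \<Longrightarrow> a_ss \<Omega> b s w v = F v"
      using w by (auto simp: discrete_solution_def F_def)
    define r where "r x = w x + (- 1) * u x" for x
    have rU: "r \<in> U" unfolding r_def by (rule add[OF wU scale[OF u(1)]])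
    \<comment> \<open>Both solutions satisfy the same equation at their difference r, so r has zero
      energy and hence zero norm.\<close>
    have "a_ss \<Omega> b s r r = a_ss \<Omega> b s w r + (- 1) * a_ss \<Omega> b s u r"
      unfolding r_def[abs_def] by (rule a_ss_linear(1)[OF H1[OF wU] H1[OF u(1)] H1[OF rU[unfolded r_def[abs_def]]]])
    then have "a_ss \<Omega> b s r r = 0" using wF[OF rU] sol[OF rU] by simp
    from H1_norm_eq_0(1)[OF H1[OF rU] null[OF rU this]]
    show ?thesis by eventually_elim (simp add: r_def)
  qed
  moreover have "H1_norm \<Omega> u \<le> 2 * B / \<alpha> * Hneg1_norm \<Omega> f"
  proof (cases "H1_norm \<Omega> u = 0")
    case True
    then show ?thesis using Hneg1_norm_nonneg[OF f] \<alpha>(1) Bpos by simp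
  next
    case False
    then have n: "H1_norm \<Omega> u > 0" using H1_norm_nonneg[of u] by simp
    have "\<alpha> * (H1_norm \<Omega> u)\<^sup>2 \<le> F u" using \<alpha>(2)[OF H10[OF u(1)]] sol[OF u(1)] by simp
    also have "\<dots> \<le> Hneg1_norm \<Omega> f * (2 * B * H1_norm \<Omega> u)" using F_bound[OF H10[OF u(1)]] by simp
    finally have "H1_norm \<Omega> u * (\<alpha> * H1_norm \<Omega> u) \<le> H1_norm \<Omega> u * (2 * B * Hneg1_norm \<Omega> f)"
      by (simp add: power2_eq_square mult_ac)
    then have "\<alpha> * H1_norm \<Omega> u \<le> 2 * B * Hneg1_norm \<Omega> f" using n by simp
    then show ?thesis using \<alpha>(1) by (simp add: field_simps)
  qed
  ultimately show "\<exists>u. discrete_solution \<Omega> b s U f u \<and>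
      (\<forall>w. discrete_solution \<Omega> b s U f w \<longrightarrow> (AE x in M. w x = u x)) \<and>
      H1_norm \<Omega> u \<le> 2 * B / \<alpha> * Hneg1_norm \<Omega> f"
    by blast
qed

end

end

theorem proposition12:
  fixes \<Omega> :: "'a::euclidean_space set"
    and b :: "'a \<Rightarrow> 'a"
    and \<sigma> \<sigma>h :: "'a \<Rightarrow> real"
    and h :: real
    and Vh :: "('a \<Rightarrow> real) set"
  assumes "DIM('a) \<ge> 2"
    and "open \<Omega>" and "bounded \<Omega>" and "connected \<Omega>" and "\<Omega> \<noteq> {}"
    and "b \<in> Linf \<Omega>"
    and "invariant_measure \<Omega> b \<sigma>"
    and "fe_space \<Omega> h Vh"
    and "galerkin_approximation \<Omega> b Vh \<sigma>h"
    and "ess_inf \<Omega> \<sigma>h > 0"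
  shows "coercive_on (H10 \<Omega>) (H1_norm \<Omega>) (a_ss \<Omega> b \<sigma>h) \<and>
    (\<exists>C>0. \<forall>H U. fe_space \<Omega> H U \<and> U \<subseteq> H10 \<Omega> \<longrightarrow> well_posed \<Omega> b \<sigma>h U C)"
proof -
  interpret bounded_domain \<Omega>
    using assms by unfold_locales
  have V: "\<sigma>h \<in> Vh" using assms(9) by (simp add: galerkin_approximation_def)
  then have s: "\<sigma>h \<in> H1 \<Omega>" using assms(8) by (auto simp: fe_space_def)
  obtain B where B: "B > 0" "AE x in M. \<bar>\<sigma>h x\<bar> \<le> B" "AE x in M. norm (weak_grad \<Omega> \<sigma>h x) \<le> B"
    using fe_function_bounded[OF assms(8) V] by blast
  obtain c where c: "c > 0" "AE x in M. c \<le> \<sigma>h x"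
  proof -
    \<comment> \<open>The essential infimum is a supremum of extended reals, so the first lower
      bound obtained is extended real as well; a real constant is then taken strictly between it and
      0.\<close>
    obtain d :: ereal where d: "AE x in M. d \<le> ereal (\<sigma>h x)" "0 < d"
      using assms(10) by (auto simp: ess_inf_def less_Sup_iff)
    obtain c where c: "0 < ereal c" "ereal c < d" using ereal_dense2[OF d(2)] by auto
    have "AE x in M. c \<le> \<sigma>h x"
      using d(1)
    proof eventually_elim
      case (elim x)
      then have "ereal c \<le> ereal (\<sigma>h x)" using c(2) by (meson less_imp_le order_trans)
      then show ?case by simp
    qed
    then show ?thesis using that c(1) by simp
  qed
  have coercive: "coercive_on (H10 \<Omega>) (H1_norm \<Omega>) (a_ss \<Omega> b \<sigma>h)"
    by (rule a_ss_coercive[OF s B(2,3,1) assms(6) c])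
  then obtain \<alpha> where \<alpha>: "\<alpha> > 0" "\<And>u. u \<in> H10 \<Omega> \<Longrightarrow> \<alpha> * (H1_norm \<Omega> u)\<^sup>2 \<le> a_ss \<Omega> b \<sigma>h u u"
    by (auto simp: coercive_on_def)
  have "well_posed \<Omega> b \<sigma>h U (2 * B / \<alpha>)" if "fe_space \<Omega> H U \<and> U \<subseteq> H10 \<Omega>" for H U
    using that discrete_well_posed[OF s B(2,3,1) assms(6) c \<alpha>] by (simp add: fe_space_def)
  moreover have "2 * B / \<alpha> > 0" using B(1) \<alpha>(1) by simp
  ultimately show ?thesis using coercive by blast
qed

end
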